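(* Let $\mathfrak g=\mathfrak{sl}_{n+1}$ and let $\mathfrak n=\mathfrak n_{\mathcal T}$ be a nilradical with $\mathcal K(\mathfrak n)=\{\beta_1,\dots,\beta_k\}$. Set $\mathcal T'=\mathcal T\cap\{\alpha_1,\dots,\alpha_{k-1}\}$ and $\mathcal T''=\mathcal T\cap\{\alpha_{n+2-k},\dots,\alpha_n\}$, and let $\sigma$ be the symmetry of the Dynkin diagram $A_n$, $\sigma(\alpha_j)=\alpha_{n+1-j}$. Let $\zeta\in\mathfrak n^*$ be a cascade point. Then $\mathfrak n^\zeta$ is a generic stabiliser for the coadjoint representation $(\mathfrak n:\mathfrak n^* )$ if and only if $\sigma(\mathcal T')=\mathcal T''$. In particular, if $\sigma(\mathcal T)=\mathcal T$, then $\mathfrak n_{\mathcal T}$ has a generic stabiliser.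
   Context: Everything is over $\mathbb C$. For $\mathfrak g=\mathfrak{sl}_{n+1}$, $\mathfrak b$ (resp. $\mathfrak u$, $\mathfrak t$) is the set of upper-triangular (resp. strictly upper-triangular, diagonal) traceless matrices; $\Delta^+=\{\varepsilon_i-\varepsilon_j\mid i<j\}$, simple roots $\Pi=\{\alpha_1,\dots,\alpha_n\}$, $\alpha_i=\varepsilon_i-\varepsilon_{i+1}$; $\mathfrak g_\gamma$ is the root space of $\gamma$ and $[\gamma:\alpha]$ the coefficient of $\alpha\in\Pi$ in $\gamma$. For nonempty $\mathcal T\subset\Pi$, $\mathfrak n_{\mathcal T}=\bigoplus\mathfrak g_\gamma$, the sum over all $\gamma\in\Delta^+$ with $[\gamma:\alpha]>0$ for some $\alpha\in\mathcal T$; it is the nilradical of the standard parabolic subalgebra $\mathfrak p_{\mathcal T}\supset\mathfrak b$ whose Levi subalgebra has simple roots $\Pi\setminus\mathcal T$. Every (nonzero standard) nilradical is of this form; $\Delta(\mathfrak n)$ is its set of roots, $N=\exp(\mathfrak n)$. The Kostant cascade of $\mathfrak{sl}_{n+1}$ is $\mathcal K=\{\beta_1,\dots,\beta_t\}$, $t=[(n+1)/2]$, $\beta_i=\varepsilon_i-\varepsilon_{n+2-i}=\alpha_i+\dots+\alpha_{n+1-i}$. Put $\mathcal K(\mathfrak n)=\mathcal K\cap\Delta(\mathfrak n)$; it is always of the form $\{\beta_1,\dots,\beta_k\}$ with $1\le k\le t$. Coadjoint action. Let $\mathfrak n^-$ be the opposite nilradical (roots $-\Delta(\mathfrak n)$),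 $\mathfrak p=\mathfrak p_{\mathcal T}$, so $\mathfrak g=\mathfrak p\oplus\mathfrak n^-$. Identify $\mathfrak n^*\simeq\mathfrak g/\mathfrak p\simeq\mathfrak n^-$; then $x\in\mathfrak n$ acts on $\xi\in\mathfrak n^-$ by $x\cdot\xi=\mathrm{pr}_{\mathfrak n^-}([x,\xi])$, the projection having kernel $\mathfrak p$. A cascade point is any $\zeta=\sum_{\beta\in\mathcal K(\mathfrak n)}e_{-\beta}\in\mathfrak n^-\simeq\mathfrak n^*$ with $0\neq e_{-\beta}\in\mathfrak g_{-\beta}$. $\mathfrak n^\xi$ is the stabiliser of $\xi\in\mathfrak n^*$ in $\mathfrak n$. Generic stabilisers. $\xi\in\mathfrak n^*$ is generic if there is a dense open $\Omega\subset\mathfrak n^*$ with $\xi\in\Omega$ such that $\mathfrak n^{\xi'}$ is $N$-conjugate to $\mathfrak n^\xi$ for all $\xi'\in\Omega$; then $\mathfrak n^\xi$ is a generic stabiliser, and $\mathfrak n$ is said to have a generic stabiliser if such $\xi$ exists. *)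

theory Defs
  imports "HOL-Analysis.Abstract_Topology" "Jordan_Normal_Form.Matrix"
begin

text \<open>
  The Lie algebra \<open>sl\<^sub>n\<^sub>+\<^sub>1\<close> consists of complex matrices of size \<open>n + 1\<close>.  Weights, roots and
  the indices \<open>1, \<dots>, n + 1\<close> of the \<open>\<epsilon>\<^sub>i\<close> are 1-based as in the usual notation, whereas matrix
  entries are 0-based: \<open>\<epsilon>\<^sub>i h = h $$ (i - 1, i - 1)\<close>.
\<close>

definition mat_trace :: "complex mat \<Rightarrow> complex" where
  "mat_trace A = (\<Sum>i<dim_row A. A $$ (i, i))"

definition lie_bracket :: "complex mat \<Rightarrow> complex mat \<Rightarrow> complex mat" where
  "lie_bracket A B = A * B - B * A"

definition mat_sum :: "nat \<Rightarrow> ('b \<Rightarrow> complex mat) \<Rightarrow> 'b set \<Rightarrow> complex mat" where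
  "mat_sum m f S = mat m m (\<lambda>(i, j). \<Sum>s\<in>S. f s $$ (i, j))"

text \<open>
  The type of matrices carries no topology, so the exponential series is summed entrywise.
  On a nilradical the series is finite.
\<close>

definition mat_exp :: "complex mat \<Rightarrow> complex mat" where
  "mat_exp A = mat (dim_row A) (dim_row A) (\<lambda>(i, j). \<Sum>r. (A ^\<^sub>m r) $$ (i, j) / fact r)"

definition sl :: "nat \<Rightarrow> complex mat set" where
  "sl n = {A \<in> carrier_mat (n + 1) (n + 1). mat_trace A = 0}"

definition torus :: "nat \<Rightarrow> complex mat set" where
  "torus n = {h \<in> sl n. diagonal_mat h}"

text \<open>
  A weight is given by its integer coordinates with respect to the \<open>\<epsilon>\<^sub>i\<close>.
\<close>

type_synonym weight = "nat \<Rightarrow> int"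

definition eps :: "nat \<Rightarrow> weight" where
  "eps i = (\<lambda>j. if j = i then 1 else 0)"

definition weight_eval :: "nat \<Rightarrow> weight \<Rightarrow> complex mat \<Rightarrow> complex" where
  "weight_eval n \<gamma> h = (\<Sum>i=1..n+1. of_int (\<gamma> i) * h $$ (i - 1, i - 1))"

definition roots :: "nat \<Rightarrow> weight set" where
  "roots n = {eps i - eps j | i j. i \<in> {1..n+1} \<and> j \<in> {1..n+1} \<and> i \<noteq> j}"

definition pos_roots :: "nat \<Rightarrow> weight set" where
  "pos_roots n = {eps i - eps j | i j. i \<in> {1..n+1} \<and> j \<in> {1..n+1} \<and> i < j}"

definition simple_root :: "nat \<Rightarrow> weight" where
  "simple_root i = eps i - eps (i + 1)"

definition simple_roots :: "nat \<Rightarrow> weight set" where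
  "simple_roots n = simple_root ` {1..n}"

definition root_coeff :: "nat \<Rightarrow> weight \<Rightarrow> weight \<Rightarrow> int" where
  "root_coeff n \<gamma> \<alpha> =
     (THE c. (\<forall>\<beta>. \<beta> \<notin> simple_roots n \<longrightarrow> c \<beta> = 0) \<and>
             \<gamma> = (\<lambda>i. \<Sum>\<beta>\<in>simple_roots n. c \<beta> * \<beta> i)) \<alpha>"

definition root_space :: "nat \<Rightarrow> weight \<Rightarrow> complex mat set" where
  "root_space n \<gamma> = {x \<in> sl n. \<forall>h\<in>torus n. lie_bracket h x = weight_eval n \<gamma> h \<cdot>\<^sub>m x}"

definition root_space_sum :: "nat \<Rightarrow> weight set \<Rightarrow> complex mat set" where
  "root_space_sum n S = {mat_sum (n + 1) f S | f. \<forall>\<gamma>\<in>S. f \<gamma> \<in> root_space n \<gamma>}"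

text \<open>The symmetry \<open>\<alpha>\<^sub>j \<mapsto> \<alpha>\<^bsub>n+1-j\<^esub>\<close> of the Dynkin diagram; meaningful on simple roots only.\<close>

definition diagram_sym :: "nat \<Rightarrow> weight \<Rightarrow> weight" where
  "diagram_sym n \<alpha> = simple_root (n + 1 - inv_into {1..n} simple_root \<alpha>)"

definition cascade_root :: "nat \<Rightarrow> nat \<Rightarrow> weight" where
  "cascade_root n i = eps i - eps (n + 2 - i)"

definition kostant_cascade :: "nat \<Rightarrow> weight set" where
  "kostant_cascade n = cascade_root n ` {1..(n + 1) div 2}"

definition nilradical_roots :: "nat \<Rightarrow> weight set \<Rightarrow> weight set" where
  "nilradical_roots n T = {\<gamma> \<in> pos_roots n. \<exists>\<alpha>\<in>T. root_coeff n \<gamma> \<alpha> > 0}"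

definition nilradical :: "nat \<Rightarrow> weight set \<Rightarrow> complex mat set" where
  "nilradical n T = root_space_sum n (nilradical_roots n T)"

definition opp_nilradical :: "nat \<Rightarrow> weight set \<Rightarrow> complex mat set" where
  "opp_nilradical n T = root_space_sum n (uminus ` nilradical_roots n T)"

text \<open>The standard Levi subalgebra whose simple roots are those not in \<open>T\<close>.\<close>

definition levi :: "nat \<Rightarrow> weight set \<Rightarrow> complex mat set" where
  "levi n T = {h + x | h x. h \<in> torus n \<and>
     x \<in> root_space_sum n {\<gamma> \<in> roots n. \<forall>\<alpha>\<in>T. root_coeff n \<gamma> \<alpha> = 0}}"

definition parabolic :: "nat \<Rightarrow> weight set \<Rightarrow> complex mat set" where
  "parabolic n T = {l + x | l x. l \<in> levi n T \<and> x \<in> nilradical n T}"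

definition nilradical_cascade :: "nat \<Rightarrow> weight set \<Rightarrow> weight set" where
  "nilradical_cascade n T = kostant_cascade n \<inter> nilradical_roots n T"

text \<open>
  The dual of the nilradical is identified with the opposite nilradical, via the decomposition
  \<open>sl\<^sub>n\<^sub>+\<^sub>1 = \<pp> \<oplus> \<nn>\<^sup>-\<close>; the projection to the opposite nilradical has kernel \<open>\<pp>\<close>.
\<close>

definition opp_proj :: "nat \<Rightarrow> weight set \<Rightarrow> complex mat \<Rightarrow> complex mat" where
  "opp_proj n T y = (THE z. z \<in> opp_nilradical n T \<and> y - z \<in> parabolic n T)"

definition coadjoint :: "nat \<Rightarrow> weight set \<Rightarrow> complex mat \<Rightarrow> complex mat \<Rightarrow> complex mat" where
  "coadjoint n T x \<xi> = opp_proj n T (lie_bracket x \<xi>)"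

definition stabiliser :: "nat \<Rightarrow> weight set \<Rightarrow> complex mat \<Rightarrow> complex mat set" where
  "stabiliser n T \<xi> = {x \<in> nilradical n T. coadjoint n T x \<xi> = 0\<^sub>m (n + 1) (n + 1)}"

definition is_cascade_point :: "nat \<Rightarrow> weight set \<Rightarrow> complex mat \<Rightarrow> bool" where
  "is_cascade_point n T \<zeta> \<longleftrightarrow>
     (\<exists>e. (\<forall>\<beta>\<in>nilradical_cascade n T.
             e \<beta> \<in> root_space n (- \<beta>) \<and> e \<beta> \<noteq> 0\<^sub>m (n + 1) (n + 1)) \<and>
          \<zeta> = mat_sum (n + 1) e (nilradical_cascade n T))"

definition nilpotent_group :: "nat \<Rightarrow> weight set \<Rightarrow> complex mat set" where
  "nilpotent_group n T = mat_exp ` nilradical n T"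

definition conjugate_under :: "complex mat set \<Rightarrow> complex mat set \<Rightarrow> complex mat set \<Rightarrow> bool" where
  "conjugate_under G A B \<longleftrightarrow>
     (\<exists>g\<in>G. \<exists>g'. inverts_mat g g' \<and> inverts_mat g' g \<and> A = (\<lambda>y. g * y * g') ` B)"

inductive mat_polynomial :: "nat \<Rightarrow> (complex mat \<Rightarrow> complex) \<Rightarrow> bool" for m where
  const: "mat_polynomial m (\<lambda>_. c)"
| entry: "i < m \<Longrightarrow> j < m \<Longrightarrow> mat_polynomial m (\<lambda>x. x $$ (i, j))"
| add: "mat_polynomial m f \<Longrightarrow> mat_polynomial m g \<Longrightarrow> mat_polynomial m (\<lambda>x. f x + g x)"
| mult: "mat_polynomial m f \<Longrightarrow> mat_polynomial m g \<Longrightarrow> mat_polynomial m (\<lambda>x. f x * g x)"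

text \<open>
  The Zariski topology on a set \<open>V\<close> of \<open>m \<times> m\<close> matrices.  If \<open>V\<close> is a linear subspace, this is the
  Zariski topology of the vector space \<open>V\<close>, since every polynomial function on \<open>V\<close> is the
  restriction of a polynomial in the matrix entries.
\<close>

definition zariski_open :: "nat \<Rightarrow> complex mat set \<Rightarrow> complex mat set \<Rightarrow> bool" where
  "zariski_open m V U \<longleftrightarrow>
     (\<exists>F. (\<forall>f\<in>F. mat_polynomial m f) \<and> U = V - {x. \<forall>f\<in>F. f x = 0})"

definition zariski :: "nat \<Rightarrow> complex mat set \<Rightarrow> complex mat topology" where
  "zariski m V = topology (zariski_open m V)"

lemma istopology_zariski_open: "istopology (zariski_open m V)"
  unfolding istopology_def
proof (intro conjI allI impI)
  fix S U assume "zariski_open m V S" and "zariski_open m V U"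
  then obtain F G where F: "\<forall>f\<in>F. mat_polynomial m f" "S = V - {x. \<forall>f\<in>F. f x = 0}"
    and G: "\<forall>f\<in>G. mat_polynomial m f" "U = V - {x. \<forall>f\<in>G. f x = 0}"
    unfolding zariski_open_def by auto
  let ?H = "{\<lambda>x. f x * g x | f g. f \<in> F \<and> g \<in> G}"
  have "\<forall>f\<in>?H. mat_polynomial m f"
    using F(1) G(1) by (auto intro: mat_polynomial.mult)
  moreover have "S \<inter> U = V - {x. \<forall>f\<in>?H. f x = 0}"
  proof (intro equalityI subsetI)
    fix x assume x: "x \<in> S \<inter> U"
    then obtain f g where "f \<in> F" "f x \<noteq> 0" "g \<in> G" "g x \<noteq> 0"
      unfolding F(2) G(2) by auto
    then have "(\<lambda>x. f x * g x) \<in> ?H" "f x * g x \<noteq> 0" by auto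
    then have "\<not> (\<forall>h\<in>?H. h x = 0)" by (metis (no_types, lifting))
    with x show "x \<in> V - {x. \<forall>f\<in>?H. f x = 0}" unfolding F(2) by auto
  next
    fix x assume "x \<in> V - {x. \<forall>f\<in>?H. f x = 0}"
    then show "x \<in> S \<inter> U" unfolding F(2) G(2) by auto
  qed
  ultimately show "zariski_open m V (S \<inter> U)" unfolding zariski_open_def by blast
next
  fix K assume K: "\<forall>U\<in>K. zariski_open m V U"
  let ?G = "{f. mat_polynomial m f \<and> (\<forall>x\<in>V. f x \<noteq> 0 \<longrightarrow> x \<in> \<Union>K)}"
  have "\<Union>K = V - {x. \<forall>f\<in>?G. f x = 0}"
  proof (intro equalityI subsetI)
    fix x assume "x \<in> \<Union>K"
    then obtain U where U: "x \<in> U" "U \<in> K" by blast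
    with K have "zariski_open m V U" by blast
    then obtain F where F: "\<forall>f\<in>F. mat_polynomial m f" "U = V - {x. \<forall>f\<in>F. f x = 0}"
      unfolding zariski_open_def by (elim exE conjE)
    from F(2) U(1) obtain f where f: "x \<in> V" "f \<in> F" "f x \<noteq> 0" by blast
    from F(2) f(2) have "y \<in> U" if "y \<in> V" "f y \<noteq> 0" for y using that by blast
    with U(2) F(1) f(2) have "f \<in> ?G" by blast
    with f show "x \<in> V - {x. \<forall>f\<in>?G. f x = 0}" by blast
  qed blast
  then show "zariski_open m V (\<Union>K)"
    unfolding zariski_open_def by (intro exI[of _ ?G]) blast
qed

lemma openin_zariski: "openin (zariski m V) = zariski_open m V"
  by (simp add: zariski_def istopology_zariski_open topology_inverse')

lemma topspace_zariski: "topspace (zariski m V) = V"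
proof -
  have "zariski_open m V V"
    unfolding zariski_open_def
    by (intro exI[of _ "{\<lambda>_. 1}"]) (auto intro: mat_polynomial.const)
  moreover have "U \<subseteq> V" if "zariski_open m V U" for U
    using that unfolding zariski_open_def by auto
  ultimately show ?thesis
    unfolding topspace_def openin_zariski by auto
qed

abbreviation dual_zariski :: "nat \<Rightarrow> weight set \<Rightarrow> complex mat topology" where
  "dual_zariski n T \<equiv> zariski (n + 1) (opp_nilradical n T)"

definition is_generic :: "nat \<Rightarrow> weight set \<Rightarrow> complex mat \<Rightarrow> bool" where
  "is_generic n T \<xi> \<longleftrightarrow>
     (\<exists>\<Omega>. openin (dual_zariski n T) \<Omega> \<and> dual_zariski n T closure_of \<Omega> = opp_nilradical n T \<and>
          \<xi> \<in> \<Omega> \<and>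
          (\<forall>\<xi>'\<in>\<Omega>. conjugate_under (nilpotent_group n T) (stabiliser n T \<xi>') (stabiliser n T \<xi>)))"

definition is_generic_stabiliser :: "nat \<Rightarrow> weight set \<Rightarrow> complex mat set \<Rightarrow> bool" where
  "is_generic_stabiliser n T \<ss> \<longleftrightarrow> (\<exists>\<xi>. is_generic n T \<xi> \<and> \<ss> = stabiliser n T \<xi>)"

definition has_generic_stabiliser :: "nat \<Rightarrow> weight set \<Rightarrow> bool" where
  "has_generic_stabiliser n T \<longleftrightarrow> (\<exists>\<ss>. is_generic_stabiliser n T \<ss>)"

lemma inj_simple_root: "inj simple_root"
proof (rule injI)
  fix i j assume "simple_root i = simple_root j"
  then have "simple_root i i = simple_root j i" by simp
  then show "i = j" by (simp add: simple_root_def eps_def split: if_splits)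
qed

lemma diagram_sym_simple_root:
  assumes "j \<in> {1..n}"
  shows "diagram_sym n (simple_root j) = simple_root (n + 1 - j)"
  using assms unfolding diagram_sym_def
  by (simp add: inv_into_f_f inj_on_subset[OF inj_simple_root])

lemma sum_simple_roots:
  "(\<Sum>\<beta>\<in>simple_roots n. c \<beta> * \<beta> p) = (\<Sum>l=1..n. c (simple_root l) * simple_root l p)"
  unfolding simple_roots_def
  by (subst sum.reindex) (auto intro: inj_on_subset[OF inj_simple_root])

lemma sum_simple_root_prefix:
  assumes "m \<in> {1..n}"
  shows "(\<Sum>p=1..m. \<Sum>l=1..n. d l * simple_root l p) = d m"
proof -
  have "(\<Sum>p=1..m. \<Sum>l=1..n. d l * simple_root l p)
      = (\<Sum>l=1..n. d l * (\<Sum>p=1..m. simple_root l p))"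
    by (subst sum.swap) (simp add: sum_distrib_left)
  also have "\<dots> = (\<Sum>l=1..n. if l = m then d l else 0)"
  proof (rule sum.cong)
    fix l assume "l \<in> {1..n}"
    then have "(\<Sum>p=1..m. simple_root l p) = (if l = m then 1 else 0)"
      by (auto simp: simple_root_def eps_def sum_subtractf)
    then show "d l * (\<Sum>p=1..m. simple_root l p) = (if l = m then d l else 0)" by simp
  qed simp
  also have "\<dots> = d m" using assms by simp
  finally show ?thesis .
qed

lemma root_coeff_eqI:
  assumes "\<gamma> = (\<lambda>p. \<Sum>\<beta>\<in>simple_roots n. c \<beta> * \<beta> p)" and "\<alpha> \<in> simple_roots n"
  shows "root_coeff n \<gamma> \<alpha> = c \<alpha>"
proof -
  let ?P = "\<lambda>c'. (\<forall>\<beta>. \<beta> \<notin> simple_roots n \<longrightarrow> c' \<beta> = 0) \<and>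
             \<gamma> = (\<lambda>i. \<Sum>\<beta>\<in>simple_roots n. c' \<beta> * \<beta> i)"
  let ?c = "\<lambda>\<beta>. if \<beta> \<in> simple_roots n then c \<beta> else 0"
  have P: "?P ?c" by (auto simp: assms(1) intro!: ext sum.cong)
  have "c' = ?c" if "?P c'" for c'
  proof
    fix \<beta> show "c' \<beta> = ?c \<beta>"
    proof (cases "\<beta> \<in> simple_roots n")
      case True
      then obtain l where l: "l \<in> {1..n}" "\<beta> = simple_root l" by (auto simp: simple_roots_def)
      have "(\<Sum>p=1..l. \<gamma> p) = c' \<beta>"
        using that sum_simple_root_prefix[OF l(1), of "\<lambda>l. c' (simple_root l)"]
        by (simp add: sum_simple_roots l(2))
      moreover have "(\<Sum>p=1..l. \<gamma> p) = c \<beta>"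
        using assms(1) sum_simple_root_prefix[OF l(1), of "\<lambda>l. c (simple_root l)"]
        by (simp add: sum_simple_roots l(2))
      ultimately show ?thesis using True by simp
    qed (use that in auto)
  qed
  then have "(THE c. ?P c) = ?c" by (rule the_equality[where P = ?P and a = ?c, OF P])
  then show ?thesis using assms(2) by (simp add: root_coeff_def)
qed

lemma root_coeff_pos_root:
  assumes "1 \<le> i" "i < j" "j \<le> n + 1" "l \<in> {1..n}"
  shows "root_coeff n (eps i - eps j) (simple_root l) = (if i \<le> l \<and> l < j then 1 else 0)"
proof -
  let ?c = "\<lambda>\<beta>. if \<beta> \<in> simple_root ` {i..<j} then 1 else 0 :: int"
  have tele: "(\<Sum>l=i..<j. simple_root l p) = eps i p - eps j p" for p
    using sum_Suc_diff'[of i j "\<lambda>l. - eps l p"] assms(2)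
    by (simp add: simple_root_def)
  have "(\<Sum>\<beta>\<in>simple_roots n. ?c \<beta> * \<beta> p) = eps i p - eps j p" for p
  proof -
    have "(\<Sum>\<beta>\<in>simple_roots n. ?c \<beta> * \<beta> p)
        = (\<Sum>l=1..n. if l \<in> {i..<j} then simple_root l p else 0)"
      unfolding sum_simple_roots
      by (intro sum.cong) (auto simp: inj_image_mem_iff[OF inj_simple_root])
    also have "\<dots> = (\<Sum>l\<in>{1..n} \<inter> {i..<j}. simple_root l p)"
      by (simp add: sum.inter_restrict)
    also have "{1..n} \<inter> {i..<j} = {i..<j}" using assms by auto
    finally show ?thesis using tele by simp
  qed
  then have "eps i - eps j = (\<lambda>p. \<Sum>\<beta>\<in>simple_roots n. ?c \<beta> * \<beta> p)" by (simp add: fun_eq_iff)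
  from root_coeff_eqI[OF this, of "simple_root l"] assms(4) show ?thesis
    by (simp add: simple_roots_def inj_image_mem_iff[OF inj_simple_root])
qed

end

theory Submission
  imports Defs "Jordan_Normal_Form.Determinant" "HOL-Computational_Algebra.Polynomial"
begin

text \<open>
  In matrix terms \<open>\<nn>\<close> consists of the strictly block upper triangular matrices. The stabiliser of a
  cascade point does not depend on its nonzero coefficients. If \<open>\<sigma>(\<T>') = \<T>''\<close>, block Gaussian
  elimination by an element of \<open>N\<close> brings every \<open>\<xi>\<close> with nonvanishing corner minors to a form whose
  lower left \<open>k \<times> k\<close> corner is block antidiagonal, and all functionals of this form have the same
  stabiliser as \<open>\<zeta>\<close>. If the symmetry fails at \<open>\<alpha>\<^sub>l\<close>, the matrix unit at
  \<open>(l + 1, n + 1 - l)\<close> lies in \<open>\<nn>\<^sup>\<zeta>\<close>, but no \<open>N\<close>-conjugate of it stabilises a \<open>\<xi>\<close> for which a suitable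
  \<open>l \<times> l\<close> minor does not vanish, and such \<open>\<xi>\<close> exist in every dense open set.
\<close>

section \<open>The nilradical as a space of matrices\<close>

text \<open>A functional is kept as a square matrix that matters only modulo \<pp>, so the coadjoint
  action of N becomes plain conjugation and no projection has to be followed through the
  elimination. The price is that a stabiliser is cut out only by the commutator equations strictly
  below the diagonal blocks, and that a reduced matrix keeps many arbitrary entries: its stabiliser
  has to be found from a zero pattern and an invertible corner alone. The indices between the first
  k and the last k complicate this. They are never cut among themselves, and on at least one side
  they are separated from the outer blocks, but the boundaries at k and n + 1 - k are exempt from
  the symmetry condition, so the middle may hang on either innermost block. Reflection in the
  antidiagonal realises \<sigma> up to sign, so each argument is made on one side only. The l x l
  minor of the converse has this origin: if \<open>\<alpha>\<^sub>l\<close> is in T but its mirror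
  image is not, the 0-based indices n - l and n + 1 - l share a block. Row n - l of an element of N
  then vanishes at n + 1 - l, so l unknowns remain for l equations, and one of these unknowns is the
  diagonal entry 1.\<close>

lemma mat_mult_index:
  assumes "A \<in> carrier_mat m m" "B \<in> carrier_mat m m" "i < m" "j < m"
  shows "(A * B) $$ (i, j) = (\<Sum>c<m. A $$ (i, c) * B $$ (c, j))"
  using assms by (simp add: scalar_prod_def atLeast0LessThan)

text \<open>
  \<open>T\<close> is encoded by the set \<open>S\<close> of the \<open>l\<close> with \<open>\<alpha>\<^sub>l \<in> T\<close>; it cuts the 0-based matrix indices into
  blocks, with a boundary between \<open>l - 1\<close> and \<open>l\<close>.
\<close>

definition cuts :: "nat set \<Rightarrow> nat \<Rightarrow> nat \<Rightarrow> bool" where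
  "cuts S i j \<longleftrightarrow> (\<exists>l\<in>S. i < l \<and> l \<le> j)"

lemma cuts_less: "cuts S i j \<Longrightarrow> i < j"
  by (auto simp: cuts_def)

lemma not_cuts_refl: "\<not> cuts S i i"
  by (auto simp: cuts_def)

lemma cuts_mono: "cuts S i j \<Longrightarrow> i' \<le> i \<Longrightarrow> j \<le> j' \<Longrightarrow> cuts S i' j'"
  unfolding cuts_def by (meson le_less_trans le_trans)

text \<open>A boundary between i and k lies either up to j or beyond j. This is what makes the
  parabolic and nilradical patterns closed under products.\<close>

lemma cuts_cases: "cuts S i k \<Longrightarrow> cuts S i j \<or> cuts S j k"
  by (force simp: cuts_def)

text \<open>The weight of the matrix unit at the 0-based position (i, j). Indexing roots by
  positions turns sums of root spaces into spaces of matrices with prescribed zeros.\<close>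

definition idx_root :: "nat \<times> nat \<Rightarrow> weight" where
  "idx_root = (\<lambda>(i, j). eps (Suc i) - eps (Suc j))"

lemma uminus_idx_root: "- idx_root (i, j) = idx_root (j, i)"
proof
  show "(- idx_root (i, j)) p = idx_root (j, i) p" for p by (simp add: idx_root_def)
qed

lemma idx_root_eq_iff:
  assumes "i \<noteq> j"
  shows "idx_root (i, j) = idx_root (p, q) \<longleftrightarrow> i = p \<and> j = q"
proof
  assume eq: "idx_root (i, j) = idx_root (p, q)"
  show "i = p \<and> j = q"
    using fun_cong[OF eq, of "Suc i"] fun_cong[OF eq, of "Suc j"] assms
    by (auto simp: idx_root_def eps_def split: if_splits)
qed auto

lemma weight_eval_idx_root:
  assumes "i \<le> n" "j \<le> n"
  shows "weight_eval n (idx_root (i, j)) h = h $$ (i, i) - h $$ (j, j)"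
proof -
  have "weight_eval n (idx_root (i, j)) h = (\<Sum>p\<le>n. of_int (idx_root (i, j) (Suc p)) * h $$ (p, p))"
    unfolding weight_eval_def
    by (rule sum.reindex_bij_witness[of _ Suc "\<lambda>p. p - 1"]) auto
  also have "\<dots> = (\<Sum>p\<le>n. (if p = i then h $$ (p, p) else 0) - (if p = j then h $$ (p, p) else 0))"
    by (intro sum.cong) (auto simp: idx_root_def eps_def)
  also have "\<dots> = h $$ (i, i) - h $$ (j, j)"
    using assms by (simp add: sum_subtractf)
  finally show ?thesis .
qed

lemma diagonal_mult_index:
  assumes h: "h \<in> carrier_mat m m" "diagonal_mat h" and x: "x \<in> carrier_mat m m"
    and pq: "p < m" "q < m"
  shows "(h * x) $$ (p, q) = h $$ (p, p) * x $$ (p, q)"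
    and "(x * h) $$ (p, q) = x $$ (p, q) * h $$ (q, q)"
proof -
  have off: "h $$ (i, j) = 0" if "i < m" "j < m" "i \<noteq> j" for i j
    using that h by (auto simp: diagonal_mat_def)
  have "(h * x) $$ (p, q) = (\<Sum>c<m. if c = p then h $$ (p, p) * x $$ (p, q) else 0)"
    unfolding mat_mult_index[OF h(1) x pq] by (rule sum.cong) (use off pq in auto)
  then show "(h * x) $$ (p, q) = h $$ (p, p) * x $$ (p, q)" using pq by simp
  have "(x * h) $$ (p, q) = (\<Sum>c<m. if c = q then x $$ (p, q) * h $$ (q, q) else 0)"
    unfolding mat_mult_index[OF x h(1) pq] by (rule sum.cong) (use off pq in auto)
  then show "(x * h) $$ (p, q) = x $$ (p, q) * h $$ (q, q)" using pq by simp
qed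

lemma root_space_idx_root:
  assumes "i \<le> n" "j \<le> n" "i \<noteq> j"
  shows "root_space n (idx_root (i, j)) =
    {x \<in> carrier_mat (n + 1) (n + 1). \<forall>p\<le>n. \<forall>q\<le>n. (p, q) \<noteq> (i, j) \<longrightarrow> x $$ (p, q) = 0}"
    (is "_ = ?R")
proof (intro equalityI subsetI)
  fix x assume x: "x \<in> root_space n (idx_root (i, j))"
  then have xc: "x \<in> carrier_mat (n + 1) (n + 1)" by (simp add: root_space_def sl_def)
  have "x $$ (p, q) = 0" if pq: "p \<le> n" "q \<le> n" "(p, q) \<noteq> (i, j)" for p q
  proof -
    \<comment> \<open>The weight \<open>(\<epsilon>\<^sub>p - \<epsilon>\<^sub>q) - (\<epsilon>\<^sub>i - \<epsilon>\<^sub>j)\<close> is nonzero at the traceless vector of its own coordinates.\<close>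
    define d where "d r = (if r = p then 1 else 0) - (if r = q then 1 else 0)
      - (if r = i then 1 else 0) + (if r = j then 1 else (0::complex))" for r
    define h where "h = mat (n + 1) (n + 1) (\<lambda>(r, s). if r = s then d r else 0)"
    have hc: "h \<in> carrier_mat (n + 1) (n + 1)" by (simp add: h_def)
    have hd: "diagonal_mat h" by (auto simp: h_def diagonal_mat_def)
    have "mat_trace h = (\<Sum>r<n+1. d r)" by (simp add: mat_trace_def h_def)
    also have "\<dots> = 0"
      using pq assms by (simp add: d_def sum.distrib sum_subtractf)
    finally have "h \<in> torus n" using hc hd by (simp add: torus_def sl_def)
    with x have "lie_bracket h x = weight_eval n (idx_root (i, j)) h \<cdot>\<^sub>m x"
      by (simp add: root_space_def)
    then have "(h * x - x * h) $$ (p, q) = (weight_eval n (idx_root (i, j)) h \<cdot>\<^sub>m x) $$ (p, q)"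
      by (simp add: lie_bracket_def)
    moreover have "(h * x - x * h) $$ (p, q) = (h * x) $$ (p, q) - (x * h) $$ (p, q)"
      using pq hc xc by simp
    ultimately have "h $$ (p, p) * x $$ (p, q) - x $$ (p, q) * h $$ (q, q)
        = (h $$ (i, i) - h $$ (j, j)) * x $$ (p, q)"
      using pq hc hd xc assms diagonal_mult_index[OF hc hd xc, of p q]
      by (simp add: weight_eval_idx_root del: index_mult_mat)
    then have "(d p - d q - (d i - d j)) * x $$ (p, q) = 0"
      using pq assms by (simp add: h_def algebra_simps)
    \<comment> \<open>The expression is the sum of the squares of the coordinates of
      \<open>d\<close>, and these are not all zero because i \<noteq> j and (p, q) \<noteq> (i,
      j).\<close>
    moreover have "d p - d q - (d i - d j) \<noteq> 0"
      using pq(3) assms(3) by (auto simp: d_def)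
    ultimately show ?thesis by simp
  qed
  with xc show "x \<in> ?R" by simp
next
  fix x assume x: "x \<in> ?R"
  then have xc: "x \<in> carrier_mat (n + 1) (n + 1)" by simp
  have "x $$ (p, p) = 0" if "p \<le> n" for p using x that assms by auto
  then have "x \<in> sl n" using xc by (simp add: sl_def mat_trace_def)
  moreover have "\<forall>h\<in>torus n. lie_bracket h x = weight_eval n (idx_root (i, j)) h \<cdot>\<^sub>m x"
  proof
    fix h assume h: "h \<in> torus n"
    have hc: "h \<in> carrier_mat (n + 1) (n + 1)" and hd: "diagonal_mat h"
      using h by (auto simp: torus_def sl_def)
    show "lie_bracket h x = weight_eval n (idx_root (i, j)) h \<cdot>\<^sub>m x"
    proof (rule eq_matI)
      fix p q assume "p < dim_row (weight_eval n (idx_root (i, j)) h \<cdot>\<^sub>m x)"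
        "q < dim_col (weight_eval n (idx_root (i, j)) h \<cdot>\<^sub>m x)"
      then have pq: "p < n + 1" "q < n + 1" using xc by auto
      have "lie_bracket h x $$ (p, q) = (h * x) $$ (p, q) - (x * h) $$ (p, q)"
        using pq hc xc by (simp add: lie_bracket_def)
      also have "\<dots> = (h $$ (p, p) - h $$ (q, q)) * x $$ (p, q)"
        using diagonal_mult_index[OF hc hd xc pq] by (simp add: algebra_simps)
      also have "\<dots> = (weight_eval n (idx_root (i, j)) h \<cdot>\<^sub>m x) $$ (p, q)"
        using x xc pq assms by (cases "(p, q) = (i, j)") (auto simp: weight_eval_idx_root)
      finally show "lie_bracket h x $$ (p, q) = (weight_eval n (idx_root (i, j)) h \<cdot>\<^sub>m x) $$ (p, q)" .
    qed (use hc xc in \<open>auto simp: lie_bracket_def\<close>)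
  qed
  ultimately show "x \<in> root_space n (idx_root (i, j))"
    unfolding root_space_def mem_Collect_eq by (rule conjI)
qed

text \<open>Positions off the diagonal carry pairwise distinct roots, so choosing one vector from
  each root space amounts to a free choice of the entries at the positions in R.\<close>

lemma root_space_sum_roots:
  assumes R: "R \<subseteq> {(i, j). i \<le> n \<and> j \<le> n \<and> i \<noteq> j}"
  shows "root_space_sum n (idx_root ` R) =
    {x \<in> carrier_mat (n + 1) (n + 1). \<forall>p\<le>n. \<forall>q\<le>n. (p, q) \<notin> R \<longrightarrow> x $$ (p, q) = 0}"
    (is "_ = ?X")
proof (intro equalityI subsetI)
  fix x assume "x \<in> root_space_sum n (idx_root ` R)"
  then obtain f where f: "\<forall>\<gamma>\<in>idx_root ` R. f \<gamma> \<in> root_space n \<gamma>"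
    and x: "x = mat_sum (n + 1) f (idx_root ` R)" unfolding root_space_sum_def by blast
  have "x $$ (p, q) = 0" if "p \<le> n" "q \<le> n" "(p, q) \<notin> R" for p q
  proof -
    have "f \<gamma> $$ (p, q) = 0" if "\<gamma> \<in> idx_root ` R" for \<gamma>
    proof -
      obtain i j where ij: "\<gamma> = idx_root (i, j)" "(i, j) \<in> R"
        using \<open>\<gamma> \<in> idx_root ` R\<close> by (metis imageE surj_pair)
      have ij': "i \<le> n" "j \<le> n" "i \<noteq> j" using ij R by auto
      have "f \<gamma> \<in> root_space n (idx_root (i, j))" using f ij by blast
      moreover have "(p, q) \<noteq> (i, j)" using \<open>(p, q) \<notin> R\<close> ij by auto
      ultimately show ?thesis
        using \<open>p \<le> n\<close> \<open>q \<le> n\<close> unfolding root_space_idx_root[OF ij'] by blast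
    qed
    then show ?thesis using that by (simp add: x mat_sum_def)
  qed
  then show "x \<in> ?X" by (simp add: x mat_sum_def)
next
  fix x assume x: "x \<in> ?X"
  define f where "f \<gamma> = mat (n + 1) (n + 1) (\<lambda>(p, q). if \<gamma> = idx_root (p, q) then x $$ (p, q) else 0)" for \<gamma>
  have "finite ({..n} \<times> {..n})" by simp
  then have fin: "finite R" by (rule finite_subset[rotated]) (use R in auto)
  have "f \<gamma> \<in> root_space n \<gamma>" if \<gamma>: "\<gamma> \<in> idx_root ` R" for \<gamma>
  proof -
    obtain r where r: "\<gamma> = idx_root r" "r \<in> R" using \<gamma> by blast
    obtain i j where "r = (i, j)" by (cases r)
    with r have ij: "\<gamma> = idx_root (i, j)" "(i, j) \<in> R" by auto
    have ij': "i \<le> n" "j \<le> n" "i \<noteq> j" using ij R by auto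
    show ?thesis unfolding ij(1) root_space_idx_root[OF ij']
      using ij' by (simp add: f_def idx_root_eq_iff[OF ij'(3)])
  qed
  moreover have "x = mat_sum (n + 1) f (idx_root ` R)"
  proof (rule eq_matI)
    fix p q assume "p < dim_row (mat_sum (n + 1) f (idx_root ` R))" "q < dim_col (mat_sum (n + 1) f (idx_root ` R))"
    then have pq: "p \<le> n" "q \<le> n" by (auto simp: mat_sum_def)
    have "inj_on idx_root R"
    proof (rule inj_onI)
      fix r s assume "r \<in> R" "s \<in> R" "idx_root r = idx_root s"
      then show "r = s" using R by (cases r; cases s) (auto simp: idx_root_eq_iff)
    qed
    then have "mat_sum (n + 1) f (idx_root ` R) $$ (p, q) = (\<Sum>r\<in>R. f (idx_root r) $$ (p, q))"
      using pq by (simp add: mat_sum_def sum.reindex)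
    also have "\<dots> = (\<Sum>r\<in>R. if r = (p, q) then x $$ (p, q) else 0)"
    proof (rule sum.cong)
      fix r assume "r \<in> R"
      then show "f (idx_root r) $$ (p, q) = (if r = (p, q) then x $$ (p, q) else 0)"
        using R pq by (cases r) (auto simp: f_def idx_root_eq_iff)
    qed simp
    also have "\<dots> = x $$ (p, q)" using x pq fin by simp
    finally show "x $$ (p, q) = mat_sum (n + 1) f (idx_root ` R) $$ (p, q)" by simp
  qed (use x in \<open>auto simp: mat_sum_def\<close>)
  ultimately show "x \<in> root_space_sum n (idx_root ` R)" unfolding root_space_sum_def by blast
qed

text \<open>\<open>root_coeff\<close> is a definite description, so the coefficients of a negative
  root are found by exhibiting its expansion. The Levi subalgebra needs roots of both signs.\<close>

lemma root_coeff_uminus: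
  assumes "1 \<le> i" "i < j" "j \<le> n + 1" "l \<in> {1..n}"
  shows "root_coeff n (eps j - eps i) (simple_root l) = (if i \<le> l \<and> l < j then - 1 else 0)"
proof -
  let ?c = "\<lambda>\<beta>. if \<beta> \<in> simple_root ` {i..<j} then - 1 else 0 :: int"
  have tele: "(\<Sum>l=i..<j. simple_root l p) = eps i p - eps j p" for p
    using sum_Suc_diff'[of i j "\<lambda>l. - eps l p"] assms(2)
    by (simp add: simple_root_def)
  have "(\<Sum>\<beta>\<in>simple_roots n. ?c \<beta> * \<beta> p) = eps j p - eps i p" for p
  proof -
    have "(\<Sum>\<beta>\<in>simple_roots n. ?c \<beta> * \<beta> p)
        = (\<Sum>l=1..n. if l \<in> {i..<j} then - simple_root l p else 0)"
      unfolding sum_simple_roots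
      by (intro sum.cong) (auto simp: inj_image_mem_iff[OF inj_simple_root])
    also have "\<dots> = (\<Sum>l\<in>{1..n} \<inter> {i..<j}. - simple_root l p)"
      by (simp add: sum.inter_restrict)
    also have "{1..n} \<inter> {i..<j} = {i..<j}" using assms by auto
    finally show ?thesis using tele by (simp add: sum_negf)
  qed
  then have "eps j - eps i = (\<lambda>p. \<Sum>\<beta>\<in>simple_roots n. ?c \<beta> * \<beta> p)" by (simp add: fun_eq_iff)
  from root_coeff_eqI[OF this, of "simple_root l"] assms(4) show ?thesis
    by (simp add: simple_roots_def inj_image_mem_iff[OF inj_simple_root])
qed

lemma root_coeff_root:
  assumes "i \<le> n" "j \<le> n" "i \<noteq> j" "l \<in> {1..n}"
  shows "root_coeff n (idx_root (i, j)) (simple_root l) =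
    (if i < l \<and> l \<le> j then 1 else if j < l \<and> l \<le> i then - 1 else 0)"
proof (cases "i < j")
  case True
  then show ?thesis
    using root_coeff_pos_root[of "Suc i" "Suc j" n l] assms by (auto simp: idx_root_def)
next
  case False
  then show ?thesis
    using root_coeff_uminus[of "Suc j" "Suc i" n l] assms by (auto simp: idx_root_def)
qed

lemma nilradical_roots_eq:
  assumes "S \<subseteq> {1..n}"
  shows "nilradical_roots n (simple_root ` S) = idx_root ` {(i, j). i \<le> n \<and> j \<le> n \<and> cuts S i j}"
proof (intro equalityI subsetI)
  fix \<gamma> assume "\<gamma> \<in> nilradical_roots n (simple_root ` S)"
  then obtain i j l where ij: "\<gamma> = eps i - eps j" "1 \<le> i" "i < j" "j \<le> n + 1"
    and l: "l \<in> S" "root_coeff n \<gamma> (simple_root l) > 0"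
    by (auto simp: nilradical_roots_def pos_roots_def)
  have "\<gamma> = idx_root (i - 1, j - 1)" using ij by (simp add: idx_root_def)
  moreover have "cuts S (i - 1) (j - 1)"
    using l ij assms root_coeff_pos_root[of i j n l]
    by (auto simp: cuts_def split: if_splits intro!: bexI[of _ l])
  ultimately show "\<gamma> \<in> idx_root ` {(i, j). i \<le> n \<and> j \<le> n \<and> cuts S i j}" using ij by auto
next
  fix \<gamma> assume "\<gamma> \<in> idx_root ` {(i, j). i \<le> n \<and> j \<le> n \<and> cuts S i j}"
  then obtain i j l where ij: "\<gamma> = idx_root (i, j)" "i \<le> n" "j \<le> n" "l \<in> S" "i < l" "l \<le> j"
    by (auto simp: cuts_def)
  then have "root_coeff n \<gamma> (simple_root l) > 0"
    using assms by (auto simp: root_coeff_root)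
  moreover have "\<gamma> = eps (Suc i) - eps (Suc j)" "Suc i \<in> {1..n+1}" "Suc j \<in> {1..n+1}" "Suc i < Suc j"
    using ij by (auto simp: idx_root_def)
  then have "\<gamma> \<in> pos_roots n" unfolding pos_roots_def by blast
  ultimately show "\<gamma> \<in> nilradical_roots n (simple_root ` S)"
    using ij by (auto simp: nilradical_roots_def)
qed

lemma levi_roots_eq:
  assumes "S \<subseteq> {1..n}"
  shows "{\<gamma> \<in> roots n. \<forall>\<alpha>\<in>simple_root ` S. root_coeff n \<gamma> \<alpha> = 0} =
    idx_root ` {(i, j). i \<le> n \<and> j \<le> n \<and> i \<noteq> j \<and> \<not> cuts S i j \<and> \<not> cuts S j i}"
proof -
  have coeff: "(\<forall>\<alpha>\<in>simple_root ` S. root_coeff n (idx_root (i, j)) \<alpha> = 0) \<longleftrightarrow> \<not> cuts S i j \<and> \<not> cuts S j i"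
    if "i \<le> n" "j \<le> n" "i \<noteq> j" for i j
  proof -
    have "root_coeff n (idx_root (i, j)) (simple_root l) = 0 \<longleftrightarrow> \<not> (i < l \<and> l \<le> j) \<and> \<not> (j < l \<and> l \<le> i)"
      if "l \<in> S" for l
      using root_coeff_root[OF \<open>i \<le> n\<close> \<open>j \<le> n\<close> \<open>i \<noteq> j\<close>, of l] that assms by auto
    then show ?thesis by (auto simp: cuts_def)
  qed
  have roots: "roots n = idx_root ` {(i, j). i \<le> n \<and> j \<le> n \<and> i \<noteq> j}"
  proof (intro equalityI subsetI)
    fix \<gamma> assume "\<gamma> \<in> roots n"
    then obtain i j where "\<gamma> = eps i - eps j" "i \<in> {1..n+1}" "j \<in> {1..n+1}" "i \<noteq> j"
      by (auto simp: roots_def)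
    then have "\<gamma> = idx_root (i - 1, j - 1)" "i - 1 \<le> n" "j - 1 \<le> n" "i - 1 \<noteq> j - 1"
      by (auto simp: idx_root_def)
    then show "\<gamma> \<in> idx_root ` {(i, j). i \<le> n \<and> j \<le> n \<and> i \<noteq> j}" by blast
  qed (force simp: roots_def idx_root_def)
  show ?thesis unfolding roots using coeff by auto
qed

definition nil_mats :: "nat \<Rightarrow> nat set \<Rightarrow> complex mat set" where
  "nil_mats m S = {x \<in> carrier_mat m m. \<forall>i<m. \<forall>j<m. \<not> cuts S i j \<longrightarrow> x $$ (i, j) = 0}"

definition opp_mats :: "nat \<Rightarrow> nat set \<Rightarrow> complex mat set" where
  "opp_mats m S = {x \<in> carrier_mat m m. \<forall>i<m. \<forall>j<m. \<not> cuts S j i \<longrightarrow> x $$ (i, j) = 0}"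

text \<open>The trace condition is left out so that the space is closed under products. For
  commutators it is supplied by \<open>mat_trace_lie_bracket\<close>.\<close>

definition par_mats :: "nat \<Rightarrow> nat set \<Rightarrow> complex mat set" where
  "par_mats m S = {x \<in> carrier_mat m m. \<forall>i<m. \<forall>j<m. cuts S j i \<longrightarrow> x $$ (i, j) = 0}"

lemma nilradical_eq:
  assumes "S \<subseteq> {1..n}"
  shows "nilradical n (simple_root ` S) = nil_mats (n + 1) S"
  unfolding nilradical_def nilradical_roots_eq[OF assms]
  by (subst root_space_sum_roots) (auto simp: nil_mats_def less_Suc_eq_le dest: cuts_less)

lemma opp_nilradical_eq:
  assumes "S \<subseteq> {1..n}"
  shows "opp_nilradical n (simple_root ` S) = opp_mats (n + 1) S"
proof -
  have "uminus ` nilradical_roots n (simple_root ` S) = idx_root ` {(i, j). i \<le> n \<and> j \<le> n \<and> cuts S j i}"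
    unfolding nilradical_roots_eq[OF assms] image_image
  proof (intro equalityI subsetI; elim imageE; clarify)
    fix i j assume "i \<le> n" "j \<le> n" "cuts S i j"
    then show "- idx_root (i, j) \<in> idx_root ` {(i, j). i \<le> n \<and> j \<le> n \<and> cuts S j i}"
      unfolding uminus_idx_root by blast
  next
    fix i j assume "i \<le> n" "j \<le> n" "cuts S j i"
    then show "idx_root (i, j) \<in> (\<lambda>x. - idx_root x) ` {(i, j). i \<le> n \<and> j \<le> n \<and> cuts S i j}"
      by (intro image_eqI[of _ _ "(j, i)"]) (auto simp: uminus_idx_root)
  qed
  then show ?thesis unfolding opp_nilradical_def
    by (simp only:) (subst root_space_sum_roots, auto simp: opp_mats_def less_Suc_eq_le dest: cuts_less)
qed

text \<open>A matrix is split into its diagonal, the rest of its diagonal blocks and the part above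
  them. The last two have zero diagonal, so the trace condition falls on the first alone.\<close>

lemma parabolic_eq:
  assumes "S \<subseteq> {1..n}"
  shows "parabolic n (simple_root ` S) = sl n \<inter> par_mats (n + 1) S"
proof (intro equalityI subsetI)
  let ?m = "n + 1"
  have levi: "levi n (simple_root ` S) = {h + x |h x. h \<in> torus n \<and> x \<in> carrier_mat ?m ?m \<and>
    (\<forall>i\<le>n. \<forall>j\<le>n. i = j \<or> cuts S i j \<or> cuts S j i \<longrightarrow> x $$ (i, j) = 0)}"
    unfolding levi_def levi_roots_eq[OF assms]
    by (subst root_space_sum_roots) auto
  {
    fix y assume "y \<in> parabolic n (simple_root ` S)"
    then obtain h x z where y: "y = h + x + z" and h: "h \<in> torus n"
      and x: "x \<in> carrier_mat ?m ?m" "\<And>i j. i \<le> n \<Longrightarrow> j \<le> n \<Longrightarrow> i = j \<or> cuts S i j \<or> cuts S j i \<Longrightarrow> x $$ (i, j) = 0"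
      and z: "z \<in> nil_mats ?m S"
      unfolding parabolic_def levi nilradical_eq[OF assms] by blast
    have hc: "h \<in> carrier_mat ?m ?m" "mat_trace h = 0" "diagonal_mat h"
      using h by (auto simp: torus_def sl_def)
    have zc: "z \<in> carrier_mat ?m ?m" using z by (simp add: nil_mats_def)
    have entry: "y $$ (i, j) = h $$ (i, j) + x $$ (i, j) + z $$ (i, j)" if "i < ?m" "j < ?m" for i j
      using that hc(1) x(1) zc by (auto simp: y)
    have dims: "dim_row y = ?m" "dim_row h = ?m" using hc(1) x(1) zc by (auto simp: y)
    have "y $$ (i, i) = h $$ (i, i)" if "i < ?m" for i
      using entry[of i i] x(2)[of i i] z that not_cuts_refl by (simp add: nil_mats_def)
    then have "mat_trace y = mat_trace h" by (simp add: mat_trace_def dims)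
    moreover have "y $$ (i, j) = 0" if "i < ?m" "j < ?m" "cuts S j i" for i j
    proof -
      have neq: "i \<noteq> j" "\<not> cuts S i j" using cuts_less[OF that(3)] cuts_less[of S i j] by auto
      have "h $$ (i, j) = 0" using hc that neq by (auto simp: diagonal_mat_def)
      moreover have "x $$ (i, j) = 0" using x(2)[of i j] that by simp
      moreover have "z $$ (i, j) = 0" using z that neq by (simp add: nil_mats_def)
      ultimately show ?thesis using entry that by simp
    qed
    moreover have "y \<in> carrier_mat ?m ?m" unfolding y using hc(1) x(1) zc by simp
    ultimately show "y \<in> sl n \<inter> par_mats ?m S" using hc by (simp add: sl_def par_mats_def)
  }
  fix y assume y: "y \<in> sl n \<inter> par_mats ?m S"
  define h where "h = mat ?m ?m (\<lambda>(i, j). if i = j then y $$ (i, j) else 0)"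
  define x where "x = mat ?m ?m (\<lambda>(i, j). if i = j \<or> cuts S i j \<or> cuts S j i then 0 else y $$ (i, j))"
  define z where "z = mat ?m ?m (\<lambda>(i, j). if cuts S i j then y $$ (i, j) else 0)"
  have yc: "y \<in> carrier_mat ?m ?m" using y by (simp add: sl_def)
  have "y = h + x + z"
    by (rule eq_matI) (use yc y not_cuts_refl in \<open>auto simp: h_def x_def z_def par_mats_def less_Suc_eq_le\<close>)
  moreover have "h \<in> torus n"
    using y by (auto simp: torus_def sl_def h_def mat_trace_def diagonal_mat_def)
  moreover have "z \<in> nilradical n (simple_root ` S)"
    unfolding nilradical_eq[OF assms] by (simp add: nil_mats_def z_def)
  moreover have "h + x \<in> levi n (simple_root ` S)"
    unfolding levi mem_Collect_eq using \<open>h \<in> torus n\<close>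
    by - (rule exI[of _ h], rule exI[of _ x], simp add: x_def)
  ultimately show "y \<in> parabolic n (simple_root ` S)"
    unfolding parabolic_def mem_Collect_eq by - (rule exI[of _ "h + x"], rule exI[of _ z], simp)
qed

text \<open>Allows every square \<xi>, since conjugation by N does not preserve the opposite
  nilradical. Changing \<xi> by an element of \<open>par_mats\<close> changes its commutator with an
  element of \<nn> only within \<nn>, so the set depends on \<xi> modulo \<pp> only.\<close>

definition stab :: "nat \<Rightarrow> nat set \<Rightarrow> complex mat \<Rightarrow> complex mat set" where
  "stab m S \<xi> = {x \<in> nil_mats m S. x * \<xi> - \<xi> * x \<in> par_mats m S}"

lemma mat_trace_lie_bracket:
  assumes "A \<in> carrier_mat m m" "B \<in> carrier_mat m m"
  shows "mat_trace (A * B - B * A) = 0"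
proof -
  have "mat_trace (A * B - B * A) = (\<Sum>i<m. (A * B) $$ (i, i) - (B * A) $$ (i, i))"
    using assms by (simp add: mat_trace_def)
  also have "\<dots> = (\<Sum>i<m. (\<Sum>c<m. A $$ (i, c) * B $$ (c, i)) - (\<Sum>c<m. B $$ (i, c) * A $$ (c, i)))"
    by (rule sum.cong) (simp_all add: mat_mult_index[OF assms] mat_mult_index[OF assms(2,1)] del: index_mult_mat)
  also have "\<dots> = (\<Sum>i<m. \<Sum>c<m. A $$ (i, c) * B $$ (c, i)) - (\<Sum>i<m. \<Sum>c<m. A $$ (c, i) * B $$ (i, c))"
    by (simp add: sum_subtractf mult.commute)
  also have "(\<Sum>i<m. \<Sum>c<m. A $$ (c, i) * B $$ (i, c)) = (\<Sum>c<m. \<Sum>i<m. A $$ (c, i) * B $$ (i, c))"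
    by (rule sum.swap)
  finally show ?thesis by simp
qed

text \<open>The projection with kernel \<pp> keeps the entries strictly below the diagonal blocks.
  Removing them from a commutator leaves its zero trace unchanged, as they lie off the diagonal, so
  the remainder is in \<pp>.\<close>

lemma stabiliser_eq:
  assumes S: "S \<subseteq> {1..n}" and \<xi>: "\<xi> \<in> carrier_mat (n + 1) (n + 1)"
  shows "stabiliser n (simple_root ` S) \<xi> = stab (n + 1) S \<xi>"
proof -
  let ?m = "n + 1" and ?O = "opp_nilradical n (simple_root ` S)"
  have "coadjoint n (simple_root ` S) x \<xi> = 0\<^sub>m ?m ?m \<longleftrightarrow> x * \<xi> - \<xi> * x \<in> par_mats ?m S"
    if x: "x \<in> nil_mats ?m S" for x
  proof -
    define y where "y = x * \<xi> - \<xi> * x"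
    define z where "z = mat ?m ?m (\<lambda>(i, j). if cuts S j i then y $$ (i, j) else 0)"
    have xc: "x \<in> carrier_mat ?m ?m" using x by (simp add: nil_mats_def)
    have yc: "y \<in> carrier_mat ?m ?m" unfolding y_def by (rule minus_carrier_mat mult_carrier_mat \<xi> xc)+
    have tr: "mat_trace y = 0" unfolding y_def by (rule mat_trace_lie_bracket[OF xc \<xi>])
    have z: "z \<in> opp_mats ?m S" by (simp add: opp_mats_def z_def)
    have zd: "z $$ (i, i) = 0" if "i < ?m" for i using that by (simp add: z_def not_cuts_refl)
    have zc: "z \<in> carrier_mat ?m ?m" by (simp add: z_def)
    have "mat_trace (y - z) = mat_trace y"
      unfolding mat_trace_def using yc zc zd by (intro sum.cong) auto
    then have "y - z \<in> sl n" using tr yc zc by (simp add: sl_def minus_carrier_mat)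
    moreover have "y - z \<in> par_mats ?m S"
      unfolding par_mats_def using yc by (auto simp: z_def minus_carrier_mat)
    ultimately have yz: "y - z \<in> sl n \<inter> par_mats ?m S" by simp
    have "w = z" if w: "w \<in> opp_mats ?m S" "y - w \<in> par_mats ?m S" for w
    proof (rule eq_matI)
      fix i j assume "i < dim_row z" "j < dim_col z"
      then have ij: "i < ?m" "j < ?m" by (auto simp: z_def)
      have wc: "w \<in> carrier_mat ?m ?m" using w by (simp add: opp_mats_def)
      then have "(y - w) $$ (i, j) = y $$ (i, j) - w $$ (i, j)" using ij yc by auto
      then show "w $$ (i, j) = z $$ (i, j)"
        using w ij by (cases "cuts S j i") (simp_all add: z_def par_mats_def opp_mats_def)
    qed (use w in \<open>auto simp: opp_mats_def z_def\<close>)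
    then have "opp_proj n (simple_root ` S) y = z"
      unfolding opp_proj_def opp_nilradical_eq[OF S] parabolic_eq[OF S]
      using z yz by (intro the_equality) blast+
    moreover have "z = 0\<^sub>m ?m ?m \<longleftrightarrow> y \<in> par_mats ?m S"
    proof
      assume "z = 0\<^sub>m ?m ?m"
      then have "z $$ (i, j) = 0" if "i < ?m" "j < ?m" for i j using that by simp
      then show "y \<in> par_mats ?m S" using yc by (fastforce simp: z_def par_mats_def)
    next
      assume "y \<in> par_mats ?m S"
      then show "z = 0\<^sub>m ?m ?m" by (intro eq_matI) (auto simp: z_def par_mats_def)
    qed
    ultimately show ?thesis by (simp add: coadjoint_def lie_bracket_def y_def)
  qed
  then show ?thesis by (auto simp: stabiliser_def stab_def nilradical_eq[OF S])
qed

section \<open>The unipotent group\<close>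

lemma nil_mats_carrier: "x \<in> nil_mats m S \<Longrightarrow> x \<in> carrier_mat m m"
  by (simp add: nil_mats_def)

lemma nil_mats_le_par_mats: "nil_mats m S \<subseteq> par_mats m S"
proof
  fix x assume x: "x \<in> nil_mats m S"
  have "\<not> cuts S i j" if "cuts S j i" for i j using that cuts_less less_asym by metis
  with x show "x \<in> par_mats m S" by (simp add: nil_mats_def par_mats_def)
qed

lemma par_mats_mult:
  assumes "A \<in> par_mats m S" "B \<in> par_mats m S"
  shows "A * B \<in> par_mats m S"
proof -
  have c: "A \<in> carrier_mat m m" "B \<in> carrier_mat m m" using assms by (auto simp: par_mats_def)
  have "(A * B) $$ (i, j) = 0" if ij: "i < m" "j < m" "cuts S j i" for i j
    unfolding mat_mult_index[OF c ij(1,2)]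
  proof (rule sum.neutral, rule ballI)
    fix l assume "l \<in> {..<m}"
    then show "A $$ (i, l) * B $$ (l, j) = 0"
      using cuts_cases[OF ij(3), of l] assms ij by (auto simp: par_mats_def)
  qed
  then show ?thesis using c mult_carrier_mat[OF c] unfolding par_mats_def by blast
qed

lemma par_mats_mult_nil_mats:
  assumes "A \<in> par_mats m S" "B \<in> nil_mats m S"
  shows "A * B \<in> nil_mats m S"
proof -
  have c: "A \<in> carrier_mat m m" "B \<in> carrier_mat m m"
    using assms by (auto simp: par_mats_def nil_mats_def)
  have "(A * B) $$ (i, j) = 0" if ij: "i < m" "j < m" "\<not> cuts S i j" for i j
    unfolding mat_mult_index[OF c ij(1,2)]
  proof (rule sum.neutral, rule ballI)
    fix l assume "l \<in> {..<m}"
    then show "A $$ (i, l) * B $$ (l, j) = 0"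
      using cuts_cases[of S l j i] assms ij by (cases "cuts S l j") (auto simp: par_mats_def nil_mats_def)
  qed
  then show ?thesis using c mult_carrier_mat[OF c] unfolding nil_mats_def by blast
qed

lemma nil_mats_mult_par_mats:
  assumes "A \<in> nil_mats m S" "B \<in> par_mats m S"
  shows "A * B \<in> nil_mats m S"
proof -
  have c: "A \<in> carrier_mat m m" "B \<in> carrier_mat m m"
    using assms by (auto simp: par_mats_def nil_mats_def)
  have "(A * B) $$ (i, j) = 0" if ij: "i < m" "j < m" "\<not> cuts S i j" for i j
    unfolding mat_mult_index[OF c ij(1,2)]
  proof (rule sum.neutral, rule ballI)
    fix l assume "l \<in> {..<m}"
    then show "A $$ (i, l) * B $$ (l, j) = 0"
      using cuts_cases[of S i l j] assms ij by (cases "cuts S i l") (auto simp: par_mats_def nil_mats_def)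
  qed
  then show ?thesis using c mult_carrier_mat[OF c] unfolding nil_mats_def by blast
qed

text \<open>The set 1 + \<nn>, whose diagonal is 1 because no index is cut from itself. It is
  identified with N once the exponential is shown to be onto.\<close>

definition unip_mats :: "nat \<Rightarrow> nat set \<Rightarrow> complex mat set" where
  "unip_mats m S = {g \<in> carrier_mat m m. \<forall>i<m. \<forall>j<m. \<not> cuts S i j \<longrightarrow> g $$ (i, j) = (if i = j then 1 else 0)}"

lemma unip_mats_carrier: "g \<in> unip_mats m S \<Longrightarrow> g \<in> carrier_mat m m"
  by (simp add: unip_mats_def)

lemma unip_mats_index:
  "g \<in> unip_mats m S \<Longrightarrow> i < m \<Longrightarrow> j < m \<Longrightarrow> \<not> cuts S i j \<Longrightarrow> g $$ (i, j) = (if i = j then 1 else 0)"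
  by (simp add: unip_mats_def)

lemma unip_mats_le_par_mats: "unip_mats m S \<subseteq> par_mats m S"
proof
  fix g assume g: "g \<in> unip_mats m S"
  have "g $$ (i, j) = 0" if "i < m" "j < m" "cuts S j i" for i j
    using unip_mats_index[OF g that(1,2)] cuts_less[OF that(3)] cuts_less[of S i j] by auto
  then show "g \<in> par_mats m S" using unip_mats_carrier[OF g] by (simp add: par_mats_def)
qed

lemma unip_mats_mult:
  assumes "g \<in> unip_mats m S" "h \<in> unip_mats m S"
  shows "g * h \<in> unip_mats m S"
proof -
  note c = unip_mats_carrier[OF assms(1)] unip_mats_carrier[OF assms(2)]
  have "(g * h) $$ (i, j) = (if i = j then 1 else 0)" if ij: "i < m" "j < m" "\<not> cuts S i j" for i j
  proof -
    have "g $$ (i, l) * h $$ (l, j) = (if l = i then if i = j then 1 else 0 else 0)" if l: "l < m" for l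
    proof (cases "l = i")
      case True
      then show ?thesis using unip_mats_index[OF assms(1)] unip_mats_index[OF assms(2)] ij not_cuts_refl
        by simp
    next
      case False
      have "g $$ (i, l) = 0 \<or> h $$ (l, j) = 0"
      proof (cases "cuts S i l")
        case True
        then have "\<not> cuts S l j" "l \<noteq> j"
          using ij cuts_less[OF True] cuts_mono[of S l j i j] by auto
        then show ?thesis using unip_mats_index[OF assms(2)] l ij by simp
      qed (use unip_mats_index[OF assms(1)] False l ij in auto)
      then show ?thesis using False by auto
    qed
    then have "(g * h) $$ (i, j) = (\<Sum>l<m. if l = i then if i = j then 1 else 0 else 0)"
      unfolding mat_mult_index[OF c ij(1,2)] by (intro sum.cong) auto
    then show ?thesis using ij by simp
  qed
  then show ?thesis using mult_carrier_mat[OF c] by (simp add: unip_mats_def del: index_mult_mat)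
qed

text \<open>Back substitution from the last row upwards: row i of \<open>g * h = 1\<close> expresses
  row i of h through rows l with \<open>cuts S i l\<close>, all of which come later.\<close>

lemma unip_mats_right_inverse:
  assumes g: "g \<in> unip_mats m S" and h: "h \<in> carrier_mat m m" and gh: "g * h = 1\<^sub>m m"
  shows "h \<in> unip_mats m S"
proof -
  note c = unip_mats_carrier[OF g] h
  have "\<forall>j<m. \<not> cuts S i j \<longrightarrow> h $$ (i, j) = (if i = j then 1 else 0)" if "i < m" for i
    using that
  proof (induction "m - i" arbitrary: i rule: less_induct)
    case less
    show ?case
    proof (intro allI impI)
      fix j assume j: "j < m" "\<not> cuts S i j"
      have "g $$ (i, l) * h $$ (l, j) = (if l = i then h $$ (i, j) else 0)" if l: "l < m" for l
      proof (cases "l = i")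
        case True
        then show ?thesis using unip_mats_index[OF g less.prems less.prems not_cuts_refl] by simp
      next
        case False
        have "g $$ (i, l) = 0 \<or> h $$ (l, j) = 0"
        proof (cases "cuts S i l")
          case True
          then have "\<not> cuts S l j" "l \<noteq> j" "i < l"
            using j cuts_less[OF True] cuts_mono[of S l j i j] by auto
          then show ?thesis using less.hyps[of l] l j by auto
        qed (use unip_mats_index[OF g] False l less.prems in auto)
        then show ?thesis using False by auto
      qed
      then have "(g * h) $$ (i, j) = (\<Sum>l<m. if l = i then h $$ (i, j) else 0)"
        unfolding mat_mult_index[OF c less.prems j(1)] by (intro sum.cong) auto
      then show "h $$ (i, j) = (if i = j then 1 else 0)" using gh less.prems j by simp
    qed
  qed
  then show ?thesis using h by (simp add: unip_mats_def)
qed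

text \<open>The determinant is a product of ones, so the adjugate is a two-sided inverse, and a
  right inverse stays in the group.\<close>

lemma unip_mats_inverse:
  assumes g: "g \<in> unip_mats m S"
  obtains h where "h \<in> unip_mats m S" "g * h = 1\<^sub>m m" "h * g = 1\<^sub>m m"
proof -
  note c = unip_mats_carrier[OF g]
  have "g $$ (i, j) = 0" if "i < m" "j < i" for i j
    using unip_mats_index[OF g, of i j] cuts_less[of S i j] that by force
  then have "upper_triangular g" using c unfolding upper_triangular_def by auto
  then have "det g = prod_list (diag_mat g)" using c by (rule det_upper_triangular)
  also have "diag_mat g = map (\<lambda>i. 1) [0..<m]"
    unfolding diag_mat_def using c unip_mats_index[OF g] not_cuts_refl by (intro map_cong) auto
  also have "prod_list \<dots> = 1" by (induction m) auto
  finally have det: "det g = 1" by simp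
  have 1: "(1::complex) \<cdot>\<^sub>m 1\<^sub>m m = 1\<^sub>m m" by (rule eq_matI) auto
  note adj = adj_mat[OF c]
  have "g * adj_mat g = 1\<^sub>m m" "adj_mat g * g = 1\<^sub>m m" using adj det 1 by auto
  with adj unip_mats_right_inverse[OF g] that show thesis by blast
qed

section \<open>Conjugation of stabilisers by the unipotent group\<close>

lemma mat_mult_carrier: "A \<in> carrier_mat m m \<Longrightarrow> B \<in> carrier_mat m m \<Longrightarrow> A * B \<in> carrier_mat m m"
  by (rule mult_carrier_mat)

lemma mat_mult_assoc:
  "A \<in> carrier_mat m m \<Longrightarrow> B \<in> carrier_mat m m \<Longrightarrow> C \<in> carrier_mat m m \<Longrightarrow>
    A * B * C = A * (B * (C :: complex mat))"
  by (rule assoc_mult_mat)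

lemma mat_mult_cancel:
  assumes "h * g = 1\<^sub>m m" "g \<in> carrier_mat m m" "h \<in> carrier_mat m m" "X \<in> carrier_mat m m"
  shows "h * (g * X) = (X :: complex mat)"
  using mat_mult_assoc[OF assms(3,2,4)] assms by simp

lemma conj_mat_mult:
  assumes c: "g \<in> carrier_mat m m" "h \<in> carrier_mat m m" and hg: "h * g = 1\<^sub>m m"
    and AB: "A \<in> carrier_mat m m" "B \<in> carrier_mat m m"
  shows "(g * A * h) * (g * B * h) = g * (A * B) * (h :: complex mat)"
  using c AB by (simp only: mat_mult_assoc[of _ m] mat_mult_cancel[OF hg c] mat_mult_carrier)

lemma conj_mat_inverse:
  assumes c: "g \<in> carrier_mat m m" "h \<in> carrier_mat m m" and hg: "h * g = 1\<^sub>m m"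
    and y: "y \<in> carrier_mat m m"
  shows "h * (g * y * h) * g = (y :: complex mat)"
  using c y hg by (simp add: mat_mult_assoc[of _ m] mat_mult_cancel[OF hg c] mat_mult_carrier)

text \<open>Elements of N lie in \<open>par_mats\<close>. Conjugation by them therefore preserves
  both \<open>nil_mats\<close> and \<open>par_mats\<close>, and it commutes with taking
  commutators.\<close>

lemma stab_conj_subset:
  assumes g: "g \<in> unip_mats m S" and h: "h \<in> unip_mats m S" and hg: "h * g = 1\<^sub>m m"
    and \<xi>: "\<xi> \<in> carrier_mat m m" and y: "y \<in> stab m S \<xi>"
  shows "g * y * h \<in> stab m S (g * \<xi> * h)"
proof -
  note gc = unip_mats_carrier[OF g] and hc = unip_mats_carrier[OF h]
  have gp: "g \<in> par_mats m S" and hp: "h \<in> par_mats m S"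
    using g h unip_mats_le_par_mats by auto
  have yn: "y \<in> nil_mats m S" and yp: "y * \<xi> - \<xi> * y \<in> par_mats m S"
    using y by (auto simp: stab_def)
  note yc = nil_mats_carrier[OF yn]
  have "(g * y * h) * (g * \<xi> * h) - (g * \<xi> * h) * (g * y * h) = g * (y * \<xi>) * h - g * (\<xi> * y) * h"
    using conj_mat_mult[OF gc hc hg] yc \<xi> by simp
  also have "\<dots> = (g * (y * \<xi>) - g * (\<xi> * y)) * h"
    by (rule minus_mult_distrib_mat[symmetric]) (use gc hc yc \<xi> in auto)
  also have "g * (y * \<xi>) - g * (\<xi> * y) = g * (y * \<xi> - \<xi> * y)"
    by (rule mult_minus_distrib_mat[symmetric]) (use gc hc yc \<xi> in auto)
  finally have "(g * y * h) * (g * \<xi> * h) - (g * \<xi> * h) * (g * y * h) \<in> par_mats m S"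
    using par_mats_mult[OF par_mats_mult[OF gp yp] hp] by simp
  moreover have "g * y * h \<in> nil_mats m S"
    by (rule nil_mats_mult_par_mats[OF par_mats_mult_nil_mats[OF gp yn] hp])
  ultimately show ?thesis unfolding stab_def by blast
qed

lemma stab_conj:
  assumes g: "g \<in> unip_mats m S" and h: "h \<in> unip_mats m S" and gh: "g * h = 1\<^sub>m m" and hg: "h * g = 1\<^sub>m m"
    and \<xi>: "\<xi> \<in> carrier_mat m m"
  shows "stab m S (g * \<xi> * h) = (\<lambda>y. g * y * h) ` stab m S \<xi>"
proof (intro equalityI subsetI)
  note gc = unip_mats_carrier[OF g] and hc = unip_mats_carrier[OF h]
  {
    fix x assume x: "x \<in> stab m S (g * \<xi> * h)"
    then have "x \<in> nil_mats m S" by (simp add: stab_def)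
    then have xc: "x \<in> carrier_mat m m" by (rule nil_mats_carrier)
    have c: "g * \<xi> * h \<in> carrier_mat m m" by (rule mat_mult_carrier gc hc \<xi>)+
    have "h * x * g \<in> stab m S (h * (g * \<xi> * h) * g)"
      by (rule stab_conj_subset[OF h g gh c x])
    then have "h * x * g \<in> stab m S \<xi>" unfolding conj_mat_inverse[OF gc hc hg \<xi>] .
    moreover have "x = g * (h * x * g) * h" by (rule conj_mat_inverse[OF hc gc gh xc, symmetric])
    ultimately show "x \<in> (\<lambda>y. g * y * h) ` stab m S \<xi>" by blast
  }
  show "x \<in> stab m S (g * \<xi> * h)" if "x \<in> (\<lambda>y. g * y * h) ` stab m S \<xi>" for x
    using that stab_conj_subset[OF g h hg \<xi>] by blast
qed

section \<open>The exponential maps the nilradical onto the unipotent group\<close>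

lemma pow_mat_index_Suc:
  assumes "y \<in> carrier_mat m m" "i < m" "j < m"
  shows "(y ^\<^sub>m Suc r) $$ (i, j) = (\<Sum>l<m. (y ^\<^sub>m r) $$ (i, l) * (y $$ (l, j) :: complex))"
  using mat_mult_index[OF pow_carrier_mat[OF assms(1)] assms(1) assms(2,3)] by simp

lemma nil_mats_pow_index:
  assumes y: "y \<in> nil_mats m S" and i: "i < m" and "j < m" "j < i + r"
  shows "(y ^\<^sub>m r) $$ (i, j) = 0"
  using assms(3,4)
proof (induction r arbitrary: j)
  case 0
  then show ?case using i nil_mats_carrier[OF y] by simp
next
  case (Suc r)
  show ?case unfolding pow_mat_index_Suc[OF nil_mats_carrier[OF y] i Suc.prems(1)]
  proof (rule sum.neutral, rule ballI)
    fix l assume "l \<in> {..<m}"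
    then have l: "l < m" by simp
    show "(y ^\<^sub>m r) $$ (i, l) * y $$ (l, j) = 0"
    proof (cases "l < j")
      case True
      then show ?thesis using Suc.IH[of l] l Suc.prems by simp
    next
      case False
      then have "\<not> cuts S l j" by (auto dest: cuts_less)
      then show ?thesis using y l Suc.prems(1) by (simp add: nil_mats_def)
    qed
  qed
qed

lemma nil_mats_pow:
  assumes y: "y \<in> nil_mats m S"
  shows "y ^\<^sub>m Suc r \<in> nil_mats m S"
proof (induction r)
  case 0
  then show ?case using y nil_mats_carrier[OF y] by simp
next
  case (Suc r)
  have "y ^\<^sub>m Suc r * y \<in> nil_mats m S"
    using nil_mats_mult_par_mats[OF Suc] y nil_mats_le_par_mats by blast
  then show ?case by simp
qed

lemma mat_exp_index:
  assumes y: "y \<in> nil_mats m S" and ij: "i < m" "j < m"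
  shows "mat_exp y $$ (i, j) = (\<Sum>r\<le>m. (y ^\<^sub>m r) $$ (i, j) / fact r)"
proof -
  have "mat_exp y $$ (i, j) = (\<Sum>r. (y ^\<^sub>m r) $$ (i, j) / fact r)"
    using nil_mats_carrier[OF y] ij by (simp add: mat_exp_def)
  also have "\<dots> = (\<Sum>r\<le>m. (y ^\<^sub>m r) $$ (i, j) / fact r)"
    by (rule suminf_finite) (use nil_mats_pow_index[OF y ij] ij in auto)
  finally show ?thesis .
qed

lemma mat_exp_unip:
  assumes y: "y \<in> nil_mats m S"
  shows "mat_exp y \<in> unip_mats m S"
proof -
  have "mat_exp y $$ (i, j) = (if i = j then 1 else 0)" if ij: "i < m" "j < m" "\<not> cuts S i j" for i j
  proof -
    have "(y ^\<^sub>m r) $$ (i, j) / fact r = (if r = 0 then if i = j then 1 else 0 else 0)" for r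
    proof (cases r)
      case (Suc q)
      then show ?thesis using nil_mats_pow[OF y, of q] ij by (simp add: nil_mats_def del: pow_mat.simps)
    qed (use nil_mats_carrier[OF y] ij in simp)
    then show ?thesis unfolding mat_exp_index[OF y ij(1,2)] by simp
  qed
  moreover have "mat_exp y \<in> carrier_mat m m"
    using nil_mats_carrier[OF y] by (simp add: mat_exp_def)
  ultimately show ?thesis by (simp add: unip_mats_def)
qed

lemma nil_mats_add: "y \<in> nil_mats m S \<Longrightarrow> z \<in> nil_mats m S \<Longrightarrow> y + z \<in> nil_mats m S"
  by (auto simp: nil_mats_def)

text \<open>In the expansion of the power, a factor z moves the column index by exactly r, and every
  further factor moves it by at least one. A product containing z and another factor thus lives
  strictly above the r-th superdiagonal, and z alone lives on it.\<close>

lemma pow_mat_add_superdiagonal: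
  assumes y: "y \<in> nil_mats m S" and z: "z \<in> nil_mats m S"
    and zr: "\<And>i j. i < m \<Longrightarrow> j < m \<Longrightarrow> j \<noteq> i + r \<Longrightarrow> z $$ (i, j) = 0"
    and ij: "i < m" "j < m" "j \<le> i + r" "j < i + r \<or> s > 0"
  shows "((y + z) ^\<^sub>m Suc s) $$ (i, j) = (y ^\<^sub>m Suc s) $$ (i, j)"
  using ij(2-)
proof (induction s arbitrary: j)
  case 0
  then show ?case using zr[OF ij(1), of j] nil_mats_carrier[OF y] nil_mats_carrier[OF z] ij(1) by simp
next
  case (Suc s)
  note yz = nil_mats_add[OF y z]
  show ?case
    unfolding pow_mat_index_Suc[OF nil_mats_carrier[OF yz] ij(1) Suc.prems(1), of "Suc s"]
      pow_mat_index_Suc[OF nil_mats_carrier[OF y] ij(1) Suc.prems(1), of "Suc s"]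
  proof (rule sum.cong)
    fix l assume "l \<in> {..<m}"
    then have l: "l < m" by simp
    consider "l \<ge> j" | "l < j" "l \<le> i" | "i < l" "l < j" by linarith
    then show "((y + z) ^\<^sub>m Suc s) $$ (i, l) * (y + z) $$ (l, j) = (y ^\<^sub>m Suc s) $$ (i, l) * y $$ (l, j)"
    proof cases
      case 1
      then have "\<not> cuts S l j" by (auto dest: cuts_less)
      then have "(y + z) $$ (l, j) = 0" "y $$ (l, j) = 0"
        using y yz l Suc.prems(1) unfolding nil_mats_def by blast+
      then show ?thesis by simp
    next
      case 2
      then have "((y + z) ^\<^sub>m Suc s) $$ (i, l) = 0" "(y ^\<^sub>m Suc s) $$ (i, l) = 0"
        using nil_mats_pow_index[OF yz ij(1) l, of "Suc s"] nil_mats_pow_index[OF y ij(1) l, of "Suc s"]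
        by (simp_all del: pow_mat.simps)
      then show ?thesis by (simp del: pow_mat.simps)
    next
      case 3
      then have "((y + z) ^\<^sub>m Suc s) $$ (i, l) = (y ^\<^sub>m Suc s) $$ (i, l)"
        using Suc.IH[of l] l Suc.prems by simp
      moreover have "(y + z) $$ (l, j) = y $$ (l, j)"
        using zr[OF l Suc.prems(1)] 3 Suc.prems l nil_mats_carrier[OF y] nil_mats_carrier[OF z] by simp
      ultimately show ?thesis by simp
    qed
  qed simp
qed

lemma mat_exp_add_superdiagonal:
  assumes y: "y \<in> nil_mats m S" and z: "z \<in> nil_mats m S"
    and zr: "\<And>i j. i < m \<Longrightarrow> j < m \<Longrightarrow> j \<noteq> i + r \<Longrightarrow> z $$ (i, j) = 0"
    and ij: "i < m" "j < m" "j \<le> i + r"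
  shows "mat_exp (y + z) $$ (i, j) = mat_exp y $$ (i, j) + z $$ (i, j)"
proof -
  have c: "y \<in> carrier_mat m m" "z \<in> carrier_mat m m" using y z by (auto dest: nil_mats_carrier)
  have "((y + z) ^\<^sub>m s) $$ (i, j) / fact s = (y ^\<^sub>m s) $$ (i, j) / fact s + (if s = 1 then z $$ (i, j) else 0)" for s
  proof (cases s)
    case 0
    then show ?thesis using c by simp
  next
    case s: (Suc q)
    show ?thesis
    proof (cases q)
      case 0
      then show ?thesis using c ij s by simp
    next
      case (Suc p)
      then show ?thesis
        using pow_mat_add_superdiagonal[OF y z zr ij, of q] s by (simp del: pow_mat.simps)
    qed
  qed
  then show ?thesis
    unfolding mat_exp_index[OF y ij(1,2)] mat_exp_index[OF nil_mats_add[OF y z] ij(1,2)]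
    using ij by (simp add: sum.distrib)
qed

text \<open>
  A logarithm is built one superdiagonal at a time: to first order, a correction on the
  \<open>r\<close>-th superdiagonal changes the exponential there by exactly that correction.
\<close>

lemma mat_exp_image_nil_mats: "mat_exp ` nil_mats m S = unip_mats m S"
proof (intro equalityI subsetI)
  fix g assume g: "g \<in> unip_mats m S"
  have "\<exists>y\<in>nil_mats m S. \<forall>i<m. \<forall>j<m. j < i + Suc r \<longrightarrow> mat_exp y $$ (i, j) = g $$ (i, j)" for r
  proof (induction r)
    case 0
    have 0: "0\<^sub>m m m \<in> nil_mats m S" by (simp add: nil_mats_def)
    have "mat_exp (0\<^sub>m m m) $$ (i, j) = g $$ (i, j)" if "i < m" "j < m" "j < i + Suc 0" for i j
    proof -
      have "\<not> cuts S i j" using that(3) by (auto dest: cuts_less)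
      then show ?thesis
        using unip_mats_index[OF g that(1,2)] unip_mats_index[OF mat_exp_unip[OF 0] that(1,2)] by simp
    qed
    with 0 show ?case by blast
  next
    case (Suc r)
    then obtain y where y: "y \<in> nil_mats m S"
      and eq: "\<And>i j. i < m \<Longrightarrow> j < m \<Longrightarrow> j < i + Suc r \<Longrightarrow> mat_exp y $$ (i, j) = g $$ (i, j)" by blast
    define z where "z = mat m m (\<lambda>(i, j). if j = i + Suc r then g $$ (i, j) - mat_exp y $$ (i, j) else 0)"
    have z: "z \<in> nil_mats m S"
      using unip_mats_index[OF g] unip_mats_index[OF mat_exp_unip[OF y]] by (auto simp: nil_mats_def z_def)
    have "mat_exp (y + z) $$ (i, j) = g $$ (i, j)" if ij: "i < m" "j < m" "j < i + Suc (Suc r)" for i j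
    proof -
      have "mat_exp (y + z) $$ (i, j) = mat_exp y $$ (i, j) + z $$ (i, j)"
        by (rule mat_exp_add_superdiagonal[OF y z, of "Suc r"]) (use ij in \<open>auto simp: z_def\<close>)
      then show ?thesis using eq[of i j] ij by (cases "j = i + Suc r") (auto simp: z_def)
    qed
    then show ?case using nil_mats_add[OF y z] by blast
  qed
  from this[of m] obtain y where y: "y \<in> nil_mats m S"
    and eq: "\<And>i j. i < m \<Longrightarrow> j < m \<Longrightarrow> mat_exp y $$ (i, j) = g $$ (i, j)" by force
  have "g = mat_exp y"
    by (rule eq_matI) (use eq unip_mats_carrier[OF g] unip_mats_carrier[OF mat_exp_unip[OF y]] in auto)
  with y show "g \<in> mat_exp ` nil_mats m S" by blast
qed (use mat_exp_unip in blast)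

lemma nilpotent_group_eq:
  assumes "S \<subseteq> {1..n}"
  shows "nilpotent_group n (simple_root ` S) = unip_mats (n + 1) S"
  unfolding nilpotent_group_def nilradical_eq[OF assms] by (rule mat_exp_image_nil_mats)

section \<open>Polynomials, minors and density\<close>

lemma mat_polynomial_sum:
  "(\<And>a. a \<in> A \<Longrightarrow> mat_polynomial m (f a)) \<Longrightarrow> mat_polynomial m (\<lambda>x. \<Sum>a\<in>A. f a x)"
proof (induction A rule: infinite_finite_induct)
  case (insert a A)
  then show ?case using mat_polynomial.add[of m "f a" "\<lambda>x. \<Sum>a\<in>A. f a x"] by simp
qed (simp_all add: mat_polynomial.const)

lemma mat_polynomial_prod:
  "(\<And>a. a \<in> A \<Longrightarrow> mat_polynomial m (f a)) \<Longrightarrow> mat_polynomial m (\<lambda>x. \<Prod>a\<in>A. f a x)"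
proof (induction A rule: infinite_finite_induct)
  case (insert a A)
  then show ?case using mat_polynomial.mult[of m "f a" "\<lambda>x. \<Prod>a\<in>A. f a x"] by simp
qed (simp_all add: mat_polynomial.const)

text \<open>Mostly used with rows \<open>flip m\<close> and columns \<open>id\<close>: the lower
  left corner with its rows read from the bottom, so that pairing b with \<open>flip m b\<close>
  becomes the diagonal.\<close>

definition minor :: "nat \<Rightarrow> (nat \<Rightarrow> nat) \<Rightarrow> (nat \<Rightarrow> nat) \<Rightarrow> complex mat \<Rightarrow> complex" where
  "minor l r c x = det (mat l l (\<lambda>(a, b). x $$ (r a, c b)))"

lemma mat_polynomial_minor:
  assumes "\<And>a. a < l \<Longrightarrow> r a < m" "\<And>b. b < l \<Longrightarrow> c b < m"
  shows "mat_polynomial m (minor l r c)"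
proof -
  have "minor l r c x = (\<Sum>p\<in>{p. p permutes {0..<l}}. signof p * (\<Prod>i=0..<l. x $$ (r i, c (p i))))" for x
  proof -
    have "minor l r c x = (\<Sum>p\<in>{p. p permutes {0..<l}}. signof p *
        (\<Prod>i=0..<l. mat l l (\<lambda>(a, b). x $$ (r a, c b)) $$ (i, p i)))"
      unfolding minor_def by (rule det_def') simp
    also have "\<dots> = (\<Sum>p\<in>{p. p permutes {0..<l}}. signof p * (\<Prod>i=0..<l. x $$ (r i, c (p i))))"
    proof (intro sum.cong prod.cong arg_cong2[where f = "(*)"] refl)
      fix p i assume "p \<in> {p. p permutes {0..<l}}" "i \<in> {0..<l}"
      then have "p i < l" "i < l" using permutes_in_image[of p "{0..<l}" i] by auto
      then show "mat l l (\<lambda>(a, b). x $$ (r a, c b)) $$ (i, p i) = x $$ (r i, c (p i))" by simp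
    qed
    finally show ?thesis .
  qed
  then have "minor l r c = (\<lambda>x. \<Sum>p\<in>{p. p permutes {0..<l}}. signof p * (\<Prod>i=0..<l. x $$ (r i, c (p i))))"
    by (rule ext)
  moreover have "mat_polynomial m (\<lambda>x. \<Sum>p\<in>{p. p permutes {0..<l}}. signof p * (\<Prod>i=0..<l. x $$ (r i, c (p i))))"
  proof (intro mat_polynomial_sum mat_polynomial.mult mat_polynomial.const mat_polynomial_prod mat_polynomial.entry)
    fix p i assume "p \<in> {p. p permutes {0..<l}}" "i \<in> {0..<l}"
    then have "p i < l" "i < l" using permutes_in_image[of p "{0..<l}" i] by auto
    then show "r i < m" "c (p i) < m" using assms by auto
  qed
  ultimately show ?thesis by simp
qed

lemma minor_nonzero_imp_trivial_kernel:
  assumes nz: "minor l r c x \<noteq> 0"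
    and ker: "\<And>b. b < l \<Longrightarrow> (\<Sum>a<l. x $$ (r b, c a) * v a) = 0" and "a < l"
  shows "v a = 0"
proof (rule ccontr)
  assume "v a \<noteq> 0"
  let ?A = "mat l l (\<lambda>(a, b). x $$ (r a, c b))"
  have "vec l v \<noteq> 0\<^sub>v l" using \<open>v a \<noteq> 0\<close> \<open>a < l\<close> by (metis index_vec index_zero_vec(1))
  moreover have "?A *\<^sub>v vec l v = 0\<^sub>v l"
    by (rule eq_vecI) (use ker in \<open>auto simp: scalar_prod_def atLeast0LessThan\<close>)
  ultimately have "det ?A = 0"
    using det_0_iff_vec_prod_zero[of ?A l] by (metis mat_carrier vec_carrier)
  with nz show False by (simp add: minor_def)
qed

lemma minor_nonzero_imp_trivial_left_kernel:
  assumes nz: "minor l r c x \<noteq> 0"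
    and ker: "\<And>b. b < l \<Longrightarrow> (\<Sum>a<l. v a * x $$ (r a, c b)) = 0" and "a < l"
  shows "v a = 0"
proof (rule ccontr)
  assume "v a \<noteq> 0"
  let ?A = "transpose_mat (mat l l (\<lambda>(a, b). x $$ (r a, c b)))"
  have "vec l v \<noteq> 0\<^sub>v l" using \<open>v a \<noteq> 0\<close> \<open>a < l\<close> by (metis index_vec index_zero_vec(1))
  moreover have "?A *\<^sub>v vec l v = 0\<^sub>v l"
    by (rule eq_vecI) (use ker in \<open>auto simp: scalar_prod_def atLeast0LessThan mult.commute\<close>)
  ultimately have "det ?A = 0"
    using det_0_iff_vec_prod_zero[of ?A l] by (metis mat_carrier transpose_carrier_mat vec_carrier)
  with nz show False
    using det_transpose[of "mat l l (\<lambda>(a, b). x $$ (r a, c b))" l] by (simp add: minor_def)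
qed

text \<open>Cramer's rule: the solution is u times the adjugate, divided by the determinant.\<close>

lemma minor_nonzero_imp_left_solution:
  assumes nz: "minor l r c x \<noteq> 0"
  obtains h where "\<And>b. b < l \<Longrightarrow> (\<Sum>a<l. h a * x $$ (r a, c b)) = u b"
proof -
  let ?A = "mat l l (\<lambda>(a, b). x $$ (r a, c b))"
  have A: "?A \<in> carrier_mat l l" by simp
  note adj = adj_mat[OF A]
  define h where "h a = (\<Sum>d<l. u d * (adj_mat ?A $$ (d, a))) / det ?A" for a
  show thesis
  proof (rule that[of h])
    fix b assume b: "b < l"
    have "(\<Sum>a<l. h a * x $$ (r a, c b)) = (\<Sum>a<l. \<Sum>d<l. u d * (adj_mat ?A $$ (d, a) * ?A $$ (a, b))) / det ?A"
      using b by (simp add: h_def sum_divide_distrib sum_distrib_right mult.assoc)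
    also have "(\<Sum>a<l. \<Sum>d<l. u d * (adj_mat ?A $$ (d, a) * ?A $$ (a, b)))
        = (\<Sum>d<l. u d * (\<Sum>a<l. adj_mat ?A $$ (d, a) * ?A $$ (a, b)))"
      by (subst sum.swap) (simp add: sum_distrib_left)
    also have "\<dots> = (\<Sum>d<l. if d = b then u b * det ?A else 0)"
    proof (rule sum.cong)
      fix d assume "d \<in> {..<l}"
      then have d: "d < l" by simp
      have "(\<Sum>a<l. adj_mat ?A $$ (d, a) * ?A $$ (a, b)) = (adj_mat ?A * ?A) $$ (d, b)"
        by (rule mat_mult_index[OF adj(1) A d b, symmetric])
      also have "\<dots> = (if d = b then det ?A else 0)" unfolding adj(3) using d b by simp
      finally show "u d * (\<Sum>a<l. adj_mat ?A $$ (d, a) * ?A $$ (a, b)) = (if d = b then u b * det ?A else 0)"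
        by simp
    qed simp
    also have "\<dots> / det ?A = u b" using b nz by (simp add: minor_def)
    finally show "(\<Sum>a<l. h a * x $$ (r a, c b)) = u b" .
  qed
qed

section \<open>Density of nonvanishing loci in linear spaces\<close>

definition mat_line :: "nat \<Rightarrow> complex mat \<Rightarrow> complex mat \<Rightarrow> complex \<Rightarrow> complex mat" where
  "mat_line m a b t = mat m m (\<lambda>(i, j). a $$ (i, j) + t * (b $$ (i, j) - a $$ (i, j)))"

lemma mat_line_0: "a \<in> carrier_mat m m \<Longrightarrow> mat_line m a b 0 = a"
  by (rule eq_matI) (auto simp: mat_line_def)

lemma mat_line_1: "b \<in> carrier_mat m m \<Longrightarrow> mat_line m a b 1 = b"
  by (rule eq_matI) (auto simp: mat_line_def)

lemma mat_polynomial_mat_line: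
  "mat_polynomial m f \<Longrightarrow> \<exists>p. \<forall>t. poly p t = f (mat_line m a b t)"
proof (induction rule: mat_polynomial.induct)
  case (const c)
  then show ?case by (intro exI[of _ "[:c:]"]) simp
next
  case (entry i j)
  then show ?case
    by (intro exI[of _ "[:a $$ (i, j), b $$ (i, j) - a $$ (i, j):]"]) (simp add: mat_line_def)
next
  case (add f g)
  then obtain p q where "\<forall>t. poly p t = f (mat_line m a b t)" "\<forall>t. poly q t = g (mat_line m a b t)" by blast
  then show ?case by (intro exI[of _ "p + q"]) simp
next
  case (mult f g)
  then obtain p q where "\<forall>t. poly p t = f (mat_line m a b t)" "\<forall>t. poly q t = g (mat_line m a b t)" by blast
  then show ?case by (intro exI[of _ "p * q"]) simp
qed

lemma openin_zariski_nonzero: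
  assumes "mat_polynomial m f"
  shows "openin (zariski m V) {x \<in> V. f x \<noteq> 0}"
  unfolding openin_zariski zariski_open_def
  by (rule exI[of _ "{f}"]) (use assms in auto)

text \<open>Irreducibility of a linear space reduces to that of a line.\<close>

lemma zariski_dense_nonzero:
  assumes V: "V \<subseteq> carrier_mat m m" and line: "\<And>a b t. a \<in> V \<Longrightarrow> b \<in> V \<Longrightarrow> mat_line m a b t \<in> V"
    and f: "mat_polynomial m f" and a: "a \<in> V" "f a \<noteq> 0"
  shows "zariski m V closure_of {x \<in> V. f x \<noteq> 0} = V"
proof (intro equalityI subsetI)
  fix b assume b: "b \<in> V"
  have "\<exists>y\<in>{x \<in> V. f x \<noteq> 0}. y \<in> U" if U: "b \<in> U" "openin (zariski m V) U" for U
  proof -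
    obtain F where F: "\<forall>g\<in>F. mat_polynomial m g" "U = V - {x. \<forall>g\<in>F. g x = 0}"
      using U(2) unfolding openin_zariski zariski_open_def by blast
    then obtain g where g: "g \<in> F" "g b \<noteq> 0" "mat_polynomial m g" using U(1) by blast
    obtain p where p: "\<And>t. poly p t = f (mat_line m a b t)" using mat_polynomial_mat_line[OF f] by blast
    obtain q where q: "\<And>t. poly q t = g (mat_line m a b t)" using mat_polynomial_mat_line[OF g(3)] by blast
    \<comment> \<open>The line starts at a, where f does not vanish, and ends at b, where g does
      not. Both restrictions are nonzero polynomials, so some parameter avoids the roots of their
      product.\<close>
    have "poly p 0 \<noteq> 0" "poly q 1 \<noteq> 0"
      using p[of 0] q[of 1] a b g V by (auto simp: mat_line_0 mat_line_1)
    then have "p * q \<noteq> 0" by auto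
    then have "finite {t. poly (p * q) t = 0}" by (rule poly_roots_finite)
    then obtain t where "poly (p * q) t \<noteq> 0"
      using infinite_UNIV_char_0[where 'a = complex] by (metis (mono_tags) finite_subset mem_Collect_eq subsetI)
    then have "f (mat_line m a b t) \<noteq> 0" "g (mat_line m a b t) \<noteq> 0" using p q by auto
    moreover have "mat_line m a b t \<in> V" by (rule line[OF a(1) b])
    ultimately show ?thesis using F(2) g(1) by blast
  qed
  then show "b \<in> zariski m V closure_of {x \<in> V. f x \<noteq> 0}"
    using b by (auto simp: in_closure_of topspace_zariski)
qed (metis closure_of_subset_topspace subsetD topspace_zariski)

lemma opp_mats_line: "a \<in> opp_mats m S \<Longrightarrow> b \<in> opp_mats m S \<Longrightarrow> mat_line m a b t \<in> opp_mats m S"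
  by (simp add: opp_mats_def mat_line_def)

section \<open>Stabilisers of reduced functionals\<close>

definition flip :: "nat \<Rightarrow> nat \<Rightarrow> nat" where
  "flip m i = m - Suc i"

lemma flip_less: "i < m \<Longrightarrow> flip m i < m"
  by (auto simp: flip_def)

lemma flip_flip: "i < m \<Longrightarrow> flip m (flip m i) = i"
  by (auto simp: flip_def)

lemma sum_flip: "(\<Sum>c<m. f (flip m c)) = (\<Sum>c<m. f c)"
  by (rule sum.reindex_bij_witness[of _ "flip m" "flip m"]) (auto simp: flip_flip flip_less)

text \<open>The effect of \<sigma> on boundaries: the one between l - 1 and l goes to the one
  between \<open>flip m l\<close> and \<open>flip m (l - 1)\<close>, which is numbered m - l. The
  bound l \<le> m guards against truncated subtraction.\<close>

definition reflect :: "nat \<Rightarrow> nat set \<Rightarrow> nat set" where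
  "reflect m S = {l. l \<le> m \<and> m - l \<in> S}"

lemma cuts_reflect:
  assumes "i < m" "j < m"
  shows "cuts (reflect m S) i j \<longleftrightarrow> cuts S (flip m j) (flip m i)"
proof
  assume "cuts (reflect m S) i j"
  then obtain l where "l \<le> m" "m - l \<in> S" "i < l" "l \<le> j" by (auto simp: cuts_def reflect_def)
  then show "cuts S (flip m j) (flip m i)"
    using assms unfolding cuts_def flip_def by (intro bexI[of _ "m - l"]) auto
next
  assume "cuts S (flip m j) (flip m i)"
  then obtain l where "l \<in> S" "flip m j < l" "l \<le> flip m i" by (auto simp: cuts_def)
  then show "cuts (reflect m S) i j"
    using assms unfolding cuts_def flip_def reflect_def by (intro bexI[of _ "m - l"]) auto
qed

lemma cuts_reflect_flip:
  assumes "i < m" "j < m"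
  shows "cuts (reflect m S) (flip m i) (flip m j) \<longleftrightarrow> cuts S j i"
  using cuts_reflect[of "flip m i" m "flip m j" S] assms by (simp add: flip_less flip_flip)

text \<open>Its negative is the Lie algebra automorphism induced by \<sigma>. The sign is immaterial
  for stabilisers, and without it the map reverses products, so statements about left multiplication
  and first columns become statements about right multiplication and last rows.\<close>

definition antitranspose :: "nat \<Rightarrow> complex mat \<Rightarrow> complex mat" where
  "antitranspose m x = mat m m (\<lambda>(i, j). x $$ (flip m j, flip m i))"

lemma antitranspose_carrier: "antitranspose m x \<in> carrier_mat m m"
  by (simp add: antitranspose_def)

lemma antitranspose_index:
  "i < m \<Longrightarrow> j < m \<Longrightarrow> antitranspose m x $$ (i, j) = x $$ (flip m j, flip m i)"
  by (simp add: antitranspose_def)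

lemma antitranspose_index_flip:
  "i < m \<Longrightarrow> j < m \<Longrightarrow> antitranspose m x $$ (flip m j, flip m i) = x $$ (i, j)"
  by (simp add: antitranspose_index flip_less flip_flip)

lemma antitranspose_nil_mats: "x \<in> nil_mats m S \<Longrightarrow> antitranspose m x \<in> nil_mats m (reflect m S)"
  unfolding nil_mats_def by (simp add: antitranspose_carrier antitranspose_index cuts_reflect flip_less)

lemma mem_stab_iff:
  assumes "\<eta> \<in> carrier_mat m m"
  shows "x \<in> stab m S \<eta> \<longleftrightarrow> x \<in> nil_mats m S \<and> (\<forall>a<m. \<forall>b<m. cuts S b a \<longrightarrow>
    (\<Sum>c<m. x $$ (a, c) * \<eta> $$ (c, b)) = (\<Sum>c<m. \<eta> $$ (a, c) * x $$ (c, b)))"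
proof (cases "x \<in> nil_mats m S")
  case True
  note x = nil_mats_carrier[OF True]
  have "(x * \<eta> - \<eta> * x) $$ (a, b) =
      (\<Sum>c<m. x $$ (a, c) * \<eta> $$ (c, b)) - (\<Sum>c<m. \<eta> $$ (a, c) * x $$ (c, b))" if "a < m" "b < m" for a b
  proof -
    have "(x * \<eta> - \<eta> * x) $$ (a, b) = (x * \<eta>) $$ (a, b) - (\<eta> * x) $$ (a, b)"
      by (rule index_minus_mat) (use that assms x in auto)
    then show ?thesis unfolding mat_mult_index[OF x assms that] mat_mult_index[OF assms x that] .
  qed
  moreover have "x * \<eta> - \<eta> * x \<in> carrier_mat m m"
    by (rule minus_carrier_mat mat_mult_carrier assms x)+
  ultimately show ?thesis using True by (simp add: stab_def par_mats_def)
qed (simp add: stab_def)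

lemma antitranspose_stab:
  assumes \<eta>: "\<eta> \<in> carrier_mat m m" and x: "x \<in> stab m S \<eta>"
  shows "antitranspose m x \<in> stab m (reflect m S) (antitranspose m \<eta>)"
  unfolding mem_stab_iff[OF antitranspose_carrier]
proof (intro conjI allI impI)
  show "antitranspose m x \<in> nil_mats m (reflect m S)"
    using x by (simp add: stab_def antitranspose_nil_mats)
  fix a b assume ab: "a < m" "b < m" "cuts (reflect m S) b a"
  let ?x = "\<lambda>i j. x $$ (i, j)" and ?e = "\<lambda>i j. \<eta> $$ (i, j)"
  have "(\<Sum>c<m. antitranspose m x $$ (a, c) * antitranspose m \<eta> $$ (c, b))
      = (\<Sum>c<m. ?e (flip m b) (flip m c) * ?x (flip m c) (flip m a))"
    using ab by (intro sum.cong) (auto simp: antitranspose_index)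
  also have "\<dots> = (\<Sum>c<m. ?e (flip m b) c * ?x c (flip m a))" by (rule sum_flip)
  also have "\<dots> = (\<Sum>c<m. ?x (flip m b) c * ?e c (flip m a))"
  proof -
    have "cuts S (flip m a) (flip m b)" using ab by (simp add: cuts_reflect)
    then show ?thesis using x ab unfolding mem_stab_iff[OF \<eta>] by (simp add: flip_less)
  qed
  also have "\<dots> = (\<Sum>c<m. ?x (flip m b) (flip m c) * ?e (flip m c) (flip m a))" by (rule sum_flip[symmetric])
  also have "\<dots> = (\<Sum>c<m. antitranspose m \<eta> $$ (a, c) * antitranspose m x $$ (c, b))"
    using ab by (intro sum.cong) (auto simp: antitranspose_index)
  finally show "(\<Sum>c<m. antitranspose m x $$ (a, c) * antitranspose m \<eta> $$ (c, b))
      = (\<Sum>c<m. antitranspose m \<eta> $$ (a, c) * antitranspose m x $$ (c, b))" .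
qed

text \<open>With rows read from the bottom, reflection merely transposes the lower left
  corner.\<close>

lemma minor_antitranspose:
  assumes "l \<le> m"
  shows "minor l (flip m) id (antitranspose m x) = minor l (flip m) id x"
proof -
  have "mat l l (\<lambda>(a, b). antitranspose m x $$ (flip m a, id b))
      = transpose_mat (mat l l (\<lambda>(a, b). x $$ (flip m a, id b)))"
    by (rule eq_matI) (use assms in \<open>auto simp: antitranspose_index flip_less flip_flip\<close>)
  then show ?thesis
    unfolding minor_def using det_transpose[of "mat l l (\<lambda>(a, b). x $$ (flip m a, id b))" l] by simp
qed

text \<open>
  A reduced functional pairs the blocks of the first \<open>k\<close> indices with the opposite blocks,
  block by block; the middle block belongs to whichever innermost block it is joined with.
\<close>

definition reduced :: "nat \<Rightarrow> nat \<Rightarrow> nat set \<Rightarrow> complex mat \<Rightarrow> bool" where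
  "reduced m k S \<eta> \<longleftrightarrow> \<eta> \<in> carrier_mat m m \<and>
     (\<forall>a b. k \<le> a \<and> a < m \<and> b < k \<and> cuts S a (flip m b) \<longrightarrow> \<eta> $$ (a, b) = 0) \<and>
     (\<forall>a b. m - k \<le> a \<and> a < m \<and> b < m - k \<and> cuts S (flip m a) b \<longrightarrow> \<eta> $$ (a, b) = 0) \<and>
     minor k (flip m) id \<eta> \<noteq> 0"

text \<open>In the symmetric case an entry with i < k and j among the last k survives only if the
  blocks of i and j mirror each other. The condition is phrased by two cuts so that it also covers
  the middle indices; reflection exchanges the two.\<close>

definition paired_blocks :: "nat \<Rightarrow> nat set \<Rightarrow> complex mat set" where
  "paired_blocks m S = {x \<in> nil_mats m S. \<forall>i<m. \<forall>j<m.
     cuts S j (flip m i) \<or> cuts S (flip m j) i \<longrightarrow> x $$ (i, j) = 0}"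

lemma antitranspose_paired_blocks:
  "x \<in> paired_blocks m S \<Longrightarrow> antitranspose m x \<in> paired_blocks m (reflect m S)"
  unfolding paired_blocks_def
  by (auto simp: antitranspose_nil_mats antitranspose_index cuts_reflect flip_less flip_flip)

text \<open>With m = n + 1 and k \<ge> 1, the second condition says that
  \<open>\<beta>\<^sub>k\<close>, at position (k - 1, m - k), is a root of \<nn>. The third says
  that no boundary separates k from m - k - 1, the position of the next cascade root.\<close>

locale cascade_blocks =
  fixes m k :: nat and S :: "nat set"
  assumes two_k: "2 * k \<le> m"
    and middle_cut: "\<exists>l\<in>S. k \<le> l \<and> l \<le> m - k"
    and middle_block: "l \<in> S \<Longrightarrow> k < l \<Longrightarrow> m - k \<le> l"
begin

lemma cuts_outer: "i < k \<Longrightarrow> m - k \<le> j \<Longrightarrow> cuts S i j"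
  unfolding cuts_def using middle_cut by (meson le_trans less_le_trans)

lemma not_cuts_middle: "k \<le> i \<Longrightarrow> j < m - k \<Longrightarrow> \<not> cuts S i j"
  unfolding cuts_def using middle_block by force

lemma k_less: "i < k \<Longrightarrow> i < m - k" "i < k \<Longrightarrow> i < m"
  using two_k by auto

lemma flip_first: "i < k \<Longrightarrow> m - k \<le> flip m i" "i < k \<Longrightarrow> k \<le> flip m i" "i < k \<Longrightarrow> flip m i < m"
  using two_k by (auto simp: flip_def)

lemma flip_last: "m - k \<le> j \<Longrightarrow> j < m \<Longrightarrow> flip m j < k"
  using two_k by (auto simp: flip_def)

lemma flip_middle: "k \<le> c \<Longrightarrow> c < m - k \<Longrightarrow> k \<le> flip m c \<and> flip m c < m - k"
  by (auto simp: flip_def)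

lemma cascade_blocks_reflect: "cascade_blocks m k (reflect m S)"
proof unfold_locales
  show "2 * k \<le> m" by (rule two_k)
  from middle_cut obtain l where "l \<in> S" "k \<le> l" "l \<le> m - k" by blast
  then show "\<exists>l\<in>reflect m S. k \<le> l \<and> l \<le> m - k"
    using two_k by (intro bexI[of _ "m - l"]) (auto simp: reflect_def)
  show "m - k \<le> l" if "l \<in> reflect m S" "k < l" for l
  proof (rule ccontr)
    assume "\<not> m - k \<le> l"
    moreover from this have "m - k \<le> m - l"
      using that by (intro middle_block) (auto simp: reflect_def)
    ultimately show False using that two_k by linarith
  qed
qed

end

text \<open>The condition \<sigma>(T') = T'' in terms of boundaries. Those at k and m - k are
  exempt, so the middle indices may be joined to one side only.\<close>

locale symmetric_blocks = cascade_blocks +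
  assumes symmetric: "0 < l \<Longrightarrow> l < k \<Longrightarrow> l \<in> S \<longleftrightarrow> m - l \<in> S"
begin

lemma cuts_flip:
  assumes "i < k" "j < k"
  shows "cuts S (flip m j) (flip m i) \<longleftrightarrow> cuts S i j"
proof
  assume "cuts S (flip m j) (flip m i)"
  then obtain l where "l \<in> S" "flip m j < l" "l \<le> flip m i" by (auto simp: cuts_def)
  then show "cuts S i j"
    using symmetric[of "m - l"] assms two_k unfolding cuts_def flip_def by (intro bexI[of _ "m - l"]) auto
next
  assume "cuts S i j"
  then obtain l where "l \<in> S" "i < l" "l \<le> j" by (auto simp: cuts_def)
  then show "cuts S (flip m j) (flip m i)"
    using symmetric[of l] assms two_k unfolding cuts_def flip_def by (intro bexI[of _ "m - l"]) auto
qed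

lemma symmetric_blocks_reflect: "symmetric_blocks m k (reflect m S)"
proof (intro symmetric_blocks.intro cascade_blocks_reflect symmetric_blocks_axioms.intro)
  show "l \<in> reflect m S \<longleftrightarrow> m - l \<in> reflect m S" if "0 < l" "l < k" for l
    using symmetric[OF that] two_k that by (auto simp: reflect_def)
qed

lemma reduced_antitranspose:
  assumes "reduced m k S \<eta>"
  shows "reduced m k (reflect m S) (antitranspose m \<eta>)"
  unfolding reduced_def
proof (intro conjI allI impI; (elim conjE)?)
  show "antitranspose m \<eta> \<in> carrier_mat m m" by (rule antitranspose_carrier)
  fix a b
  show "antitranspose m \<eta> $$ (a, b) = 0" if "k \<le> a" "a < m" "b < k" "cuts (reflect m S) a (flip m b)"
  proof -
    have "cuts S (flip m (flip m b)) (flip m a)"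
      using that k_less by (simp add: cuts_reflect flip_less flip_flip)
    moreover have "flip m a < m - k" using that by (auto simp: flip_def)
    ultimately have "\<eta> $$ (flip m b, flip m a) = 0"
      using assms that flip_first[of b] by (simp add: reduced_def)
    then show ?thesis using that k_less by (simp add: antitranspose_index)
  qed
  show "antitranspose m \<eta> $$ (a, b) = 0" if "m - k \<le> a" "a < m" "b < m - k" "cuts (reflect m S) (flip m a) b"
  proof -
    have "cuts S (flip m b) (flip m (flip m a))"
      using that by (simp add: cuts_reflect flip_less flip_flip)
    moreover have "k \<le> flip m b" "flip m b < m" using that by (auto simp: flip_def)
    ultimately have "\<eta> $$ (flip m b, flip m a) = 0"
      using assms that flip_last[of a] by (simp add: reduced_def)
    then show ?thesis using that by (simp add: antitranspose_index)
  qed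
next
  show "minor k (flip m) id (antitranspose m \<eta>) \<noteq> 0"
    using assms two_k by (simp add: minor_antitranspose reduced_def)
qed

section \<open>Vanishing entries in the stabiliser of a reduced functional\<close>

context
  fixes \<eta> x :: "complex mat"
  assumes red: "reduced m k S \<eta>" and x: "x \<in> stab m S \<eta>"
begin

lemma red_carrier: "\<eta> \<in> carrier_mat m m"
  using red by (simp add: reduced_def)

lemma red_rows: "k \<le> a \<Longrightarrow> a < m \<Longrightarrow> b < k \<Longrightarrow> cuts S a (flip m b) \<Longrightarrow> \<eta> $$ (a, b) = 0"
  and red_cols: "m - k \<le> a \<Longrightarrow> a < m \<Longrightarrow> b < m - k \<Longrightarrow> cuts S (flip m a) b \<Longrightarrow> \<eta> $$ (a, b) = 0"
  and red_minor: "minor k (flip m) id \<eta> \<noteq> 0"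
  using red by (simp_all add: reduced_def)

lemma x_zero: "i < m \<Longrightarrow> j < m \<Longrightarrow> \<not> cuts S i j \<Longrightarrow> x $$ (i, j) = 0"
  using x by (simp add: stab_def nil_mats_def)

lemma x_commutes: "a < m \<Longrightarrow> b < m \<Longrightarrow> cuts S b a \<Longrightarrow>
    (\<Sum>c<m. x $$ (a, c) * \<eta> $$ (c, b)) = (\<Sum>c<m. \<eta> $$ (a, c) * x $$ (c, b))"
  using x unfolding mem_stab_iff[OF red_carrier] by simp

lemma red_kernel:
  assumes "\<And>i. i < k \<Longrightarrow> (\<Sum>c<k. \<eta> $$ (flip m i, c) * v c) = 0" "c < k"
  shows "v c = 0"
  using minor_nonzero_imp_trivial_kernel[OF red_minor, of v c] assms by simp

lemma sum_first:
  assumes "\<And>c. k \<le> c \<Longrightarrow> c < m \<Longrightarrow> f c = (0::complex)"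
  shows "(\<Sum>c<m. f c) = (\<Sum>c<k. f c)"
  by (rule sum.mono_neutral_right) (use assms two_k in \<open>auto simp: not_less\<close>)

text \<open>The part of column b of x in the first k rows is killed by the invertible corner of
  \<eta>. If \<open>cuts S i b\<close>, row \<open>flip m i\<close> of this claim is the commutator
  equation at (flip m i, b), whose other side vanishes by the column pattern of \<eta>. For the
  remaining i each term vanishes by the zero patterns.\<close>

lemma stab_first_first:
  assumes "i < k" "b < k"
  shows "x $$ (i, b) = 0"
proof (rule red_kernel[of "\<lambda>c. x $$ (c, b)", OF _ assms(1)])
  fix i assume i: "i < k"
  show "(\<Sum>c<k. \<eta> $$ (flip m i, c) * x $$ (c, b)) = 0"
  proof (cases "cuts S i b")
    case True
    have "(\<Sum>c<m. x $$ (flip m i, c) * \<eta> $$ (c, b)) = 0"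
    proof (rule sum.neutral, rule ballI)
      fix c assume "c \<in> {..<m}"
      then have c: "c < m" by simp
      show "x $$ (flip m i, c) * \<eta> $$ (c, b) = 0"
      proof (cases "cuts S (flip m i) c")
        case cut: True
        then have cL: "m - k \<le> c" using cuts_less[OF cut] flip_first(1)[OF i] by simp
        have "cuts S (flip m i) (flip m (flip m c))" using cut c by (simp add: flip_flip)
        then have "cuts S (flip m c) i" using cuts_flip[OF flip_last[OF cL c] i] by simp
        then have "cuts S (flip m c) b" using cuts_less[OF True] by (auto intro: cuts_mono)
        then show ?thesis using red_cols[OF cL c] k_less(1)[OF assms(2)] by simp
      qed (use x_zero[OF flip_first(3)[OF i] c] in simp)
    qed
    also have "(\<Sum>c<m. x $$ (flip m i, c) * \<eta> $$ (c, b)) = (\<Sum>c<m. \<eta> $$ (flip m i, c) * x $$ (c, b))"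
      using i assms k_less cuts_outer flip_first by (intro x_commutes) auto
    also have "\<dots> = (\<Sum>c<k. \<eta> $$ (flip m i, c) * x $$ (c, b))"
    proof (rule sum_first)
      fix c assume "k \<le> c" "c < m"
      then have "\<not> cuts S c b" using assms by (auto dest: cuts_less)
      then show "\<eta> $$ (flip m i, c) * x $$ (c, b) = 0"
        using x_zero[of c b] \<open>c < m\<close> assms k_less by simp
    qed
    finally show ?thesis by simp
  next
    case False
    show ?thesis
    proof (rule sum.neutral, rule ballI)
      fix c assume "c \<in> {..<k}"
      then have c: "c < k" by simp
      show "\<eta> $$ (flip m i, c) * x $$ (c, b) = 0"
      proof (cases "cuts S c b")
        case True
        then have "cuts S c i" using cuts_cases[OF True, of i] False by simp
        then have "cuts S (flip m i) (flip m c)" using cuts_flip[OF c i] by simp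
        then show ?thesis using red_rows[OF _ _ c] flip_first[OF i] by simp
      qed (use x_zero[of c b] c assms k_less in simp)
    qed
  qed
qed

text \<open>Again a vector is killed by the corner of \<eta>. The assumption \<open>middle_b\<close>
  is void for b in the middle; that case, after reflection, supplies it for b among the last k,
  which avoids a circular argument.\<close>

lemma stab_first_other:
  assumes i: "i < k" and b: "k \<le> b" "b < m" and cut: "cuts S b (flip m i)"
    and last_last: "\<And>a c. m - k \<le> a \<Longrightarrow> m - k \<le> c \<Longrightarrow> a < m \<Longrightarrow> c < m \<Longrightarrow> x $$ (a, c) = 0"
    and middle_b: "\<And>c. k \<le> c \<Longrightarrow> c < m - k \<Longrightarrow> m - k \<le> b \<Longrightarrow> cuts S (flip m b) c \<Longrightarrow> x $$ (c, b) = 0"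
  shows "x $$ (i, b) = 0"
proof -
  \<comment> \<open>Commutator equations are available only in rows \<open>flip m i\<close> that are
    cut from b, so column b of x is truncated to the matching indices. The corner of \<eta> is block
    antidiagonal and respects this truncation.\<close>
  define v where "v c = (if cuts S b (flip m c) then x $$ (c, b) else 0)" for c
  have "v i = 0"
  proof (rule red_kernel[of v, OF _ i])
    fix i assume i: "i < k"
    show "(\<Sum>c<k. \<eta> $$ (flip m i, c) * v c) = 0"
    proof (cases "cuts S b (flip m i)")
      case True
      have "(\<Sum>c<m. x $$ (flip m i, c) * \<eta> $$ (c, b)) = 0"
      proof (rule sum.neutral, rule ballI)
        fix c assume "c \<in> {..<m}"
        then have c: "c < m" by simp
        show "x $$ (flip m i, c) * \<eta> $$ (c, b) = 0"
        proof (cases "cuts S (flip m i) c")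
          case cut: True
          then have cL: "m - k \<le> c" using cuts_less[OF cut] flip_first(1)[OF i] by simp
          then show ?thesis using last_last[OF flip_first(1)[OF i] cL flip_first(3)[OF i] c] by simp
        qed (use x_zero[OF flip_first(3)[OF i] c] in simp)
      qed
      also have "(\<Sum>c<m. x $$ (flip m i, c) * \<eta> $$ (c, b)) = (\<Sum>c<m. \<eta> $$ (flip m i, c) * x $$ (c, b))"
        by (rule x_commutes[OF flip_first(3)[OF i] b(2) True])
      also have "\<dots> = (\<Sum>c<k. \<eta> $$ (flip m i, c) * x $$ (c, b))"
      proof (rule sum_first)
        fix c assume c: "k \<le> c" "c < m"
        show "\<eta> $$ (flip m i, c) * x $$ (c, b) = 0"
        proof (cases "cuts S c b")
          case cut: True
          then have bL: "m - k \<le> b" using not_cuts_middle[OF c(1), of b] by force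
          show ?thesis
          proof (cases "m - k \<le> c")
            case True
            then show ?thesis using last_last[OF True bL c(2) b(2)] by simp
          next
            case False
            then have cM: "c < m - k" by simp
            show ?thesis
            proof (cases "cuts S (flip m b) c")
              case True
              then show ?thesis using middle_b[OF c(1) cM bL] by simp
            next
              case nc: False
              have "cuts S (flip m (flip m b)) (flip m i)" using True b by (simp add: flip_flip)
              then have "cuts S i (flip m b)" using cuts_flip[OF i flip_last[OF bL b(2)]] by simp
              then have "cuts S i c"
                by (rule cuts_mono) (use flip_last[OF bL b(2)] c in auto)
              then show ?thesis
                using red_cols[OF flip_first(1,3)[OF i] cM] flip_flip[of i m] k_less(2)[OF i] by simp
            qed
          qed
        qed (use x_zero[of c b] c b in simp)
      qed
      also have "\<dots> = (\<Sum>c<k. \<eta> $$ (flip m i, c) * v c)"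
      proof (rule sum.cong)
        fix c assume "c \<in> {..<k}"
        then have c: "c < k" by simp
        show "\<eta> $$ (flip m i, c) * x $$ (c, b) = \<eta> $$ (flip m i, c) * v c"
        proof (cases "cuts S b (flip m c)")
          case False
          then have "cuts S (flip m c) (flip m i)" using cuts_cases[OF True, of "flip m c"] by simp
          then have "cuts S i c" using cuts_flip[OF i c] by simp
          then show ?thesis
            using red_cols[OF flip_first(1,3)[OF i] k_less(1)[OF c]] flip_flip[of i m] k_less(2)[OF i] by simp
        qed (simp add: v_def)
      qed simp
      finally show ?thesis by simp
    next
      case False
      show ?thesis
      proof (rule sum.neutral, rule ballI)
        fix c assume "c \<in> {..<k}"
        then have c: "c < k" by simp
        show "\<eta> $$ (flip m i, c) * v c = 0"
        proof (cases "cuts S b (flip m c)")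
          case True
          then have "cuts S (flip m i) (flip m c)" using cuts_cases[OF True, of "flip m i"] False by simp
          then show ?thesis using red_rows[OF _ _ c] flip_first[OF i] by simp
        qed (simp add: v_def)
      qed
    qed
  qed
  then show ?thesis using cut by (simp add: v_def)
qed

end

lemma stab_last_last:
  assumes red: "reduced m k S \<eta>" and x: "x \<in> stab m S \<eta>"
    and "m - k \<le> a" "m - k \<le> c" "a < m" "c < m"
  shows "x $$ (a, c) = 0"
proof -
  interpret R: symmetric_blocks m k "reflect m S" by (rule symmetric_blocks_reflect)
  have "\<eta> \<in> carrier_mat m m" using red by (simp add: reduced_def)
  from R.stab_first_first[OF reduced_antitranspose[OF red] antitranspose_stab[OF this x]
      flip_last flip_last, of c a]
  show ?thesis using assms by (simp add: antitranspose_index_flip)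
qed

lemma stab_first_middle:
  assumes red: "reduced m k S \<eta>" and x: "x \<in> stab m S \<eta>"
    and "i < k" "k \<le> b" "b < m - k" "cuts S b (flip m i)"
  shows "x $$ (i, b) = 0"
  by (rule stab_first_other[OF red x]) (use assms stab_last_last[OF red x] in auto)

lemma stab_middle_last:
  assumes red: "reduced m k S \<eta>" and x: "x \<in> stab m S \<eta>"
    and a: "k \<le> a" "a < m - k" and j: "m - k \<le> j" "j < m" and cut: "cuts S (flip m j) a"
  shows "x $$ (a, j) = 0"
proof -
  interpret R: symmetric_blocks m k "reflect m S" by (rule symmetric_blocks_reflect)
  have "\<eta> \<in> carrier_mat m m" using red by (simp add: reduced_def)
  note R = R.stab_first_middle[OF reduced_antitranspose[OF red] antitranspose_stab[OF this x]
      flip_last, of j "flip m a"]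
  have "cuts (reflect m S) (flip m a) (flip m (flip m j))"
    using cut a j by (simp add: cuts_reflect_flip flip_less)
  with R show ?thesis using a j flip_middle[OF a] by (simp add: antitranspose_index_flip)
qed

lemma stab_zero_right:
  assumes red: "reduced m k S \<eta>" and x: "x \<in> stab m S \<eta>"
    and ij: "i < m" "j < m" and cut: "cuts S j (flip m i)"
  shows "x $$ (i, j) = 0"
proof (cases "cuts S i j")
  case True
  have "i < k"
  proof (rule ccontr)
    assume "\<not> i < k"
    then have "k \<le> i" "flip m i < m - k" using ij by (auto simp: flip_def)
    then show False
      using not_cuts_middle[of i j] True cuts_less[OF cut] by simp
  qed
  then show ?thesis
    using stab_first_first[OF red x, of i j] stab_first_other[OF red x \<open>i < k\<close> _ ij(2) cut]
      stab_last_last[OF red x] stab_middle_last[OF red x _ _ _ ij(2)] by (cases "j < k") auto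
next
  case False
  then show ?thesis using x ij by (simp add: stab_def nil_mats_def)
qed

lemma stab_zero_left:
  assumes red: "reduced m k S \<eta>" and x: "x \<in> stab m S \<eta>"
    and ij: "i < m" "j < m" and cut: "cuts S (flip m j) i"
  shows "x $$ (i, j) = 0"
proof -
  interpret R: symmetric_blocks m k "reflect m S" by (rule symmetric_blocks_reflect)
  have "\<eta> \<in> carrier_mat m m" using red by (simp add: reduced_def)
  note R = R.stab_zero_right[OF reduced_antitranspose[OF red] antitranspose_stab[OF this x]
      flip_less flip_less, of j i]
  have "cuts (reflect m S) (flip m i) (flip m (flip m j))"
    using cut ij by (simp add: cuts_reflect_flip flip_less)
  with R show ?thesis using ij by (simp add: antitranspose_index_flip)
qed

text \<open>A nonzero \<open>x $$ (a, c)\<close> ties c to the mirror block of a. As b lies in an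
  earlier block than a, c is cut from \<open>flip m b\<close>, and there a reduced \<eta> vanishes.
  Together with its reflection this makes both products, and not just their difference, vanish below
  the diagonal blocks.\<close>

lemma paired_blocks_mult_zero:
  assumes red: "reduced m k S \<eta>" and x: "x \<in> paired_blocks m S"
    and lt: "a < m" "b < m" "c < m" and cut: "cuts S b a"
  shows "x $$ (a, c) * \<eta> $$ (c, b) = 0"
proof (rule ccontr)
  assume "\<not> ?thesis"
  then have "x $$ (a, c) \<noteq> 0" and \<eta>: "\<eta> $$ (c, b) \<noteq> 0" by auto
  then have ac: "cuts S a c" and n1: "\<not> cuts S c (flip m a)" and n2: "\<not> cuts S (flip m c) a"
    using x lt by (auto simp: paired_blocks_def nil_mats_def)
  have a: "a < m - k"
  proof (rule ccontr)
    assume "\<not> a < m - k"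
    then show False using n2 cuts_outer[of "flip m c" a] flip_last[of c] cuts_less[OF ac] lt by simp
  qed
  have b: "b < k"
    using not_cuts_middle[of b a] cut a by force
  have c: "k \<le> c"
  proof (rule ccontr)
    assume "\<not> k \<le> c"
    then show False using n1 cuts_outer[of c "flip m a"] flip_first[of a] cuts_less[OF ac] by simp
  qed
  have "cuts S c (flip m b)"
  proof (cases "a < k")
    case True
    then have "cuts S (flip m a) (flip m b)" using cuts_flip[OF b True] cut by simp
    moreover have "\<not> cuts S (flip m a) c"
    proof
      assume fc: "cuts S (flip m a) c"
      then have cL: "m - k \<le> c" using cuts_less[OF fc] flip_first(1)[OF True] by simp
      have "cuts S (flip m a) (flip m (flip m c))" using fc lt by (simp add: flip_flip)
      then show False using cuts_flip[OF flip_last[OF cL lt(3)] True] n2 by simp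
    qed
    ultimately show ?thesis using cuts_cases by blast
  next
    case False
    then have cL: "m - k \<le> c" using not_cuts_middle[of a c] ac by force
    have "cuts S b (flip m c)" using cuts_cases[OF cut] n2 by blast
    then have "cuts S (flip m (flip m c)) (flip m b)"
      using cuts_flip[OF b flip_last[OF cL lt(3)]] by simp
    then show ?thesis using lt by (simp add: flip_flip)
  qed
  then show False using red \<eta> b c lt by (simp add: reduced_def)
qed

lemma stab_reduced:
  assumes red: "reduced m k S \<eta>"
  shows "stab m S \<eta> = paired_blocks m S"
proof (intro equalityI subsetI)
  fix x assume x: "x \<in> stab m S \<eta>"
  then show "x \<in> paired_blocks m S"
    using stab_zero_left[OF red x] stab_zero_right[OF red x] by (auto simp: paired_blocks_def stab_def)
next
  interpret R: symmetric_blocks m k "reflect m S" by (rule symmetric_blocks_reflect)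
  have \<eta>: "\<eta> \<in> carrier_mat m m" using red by (simp add: reduced_def)
  fix x assume x: "x \<in> paired_blocks m S"
  show "x \<in> stab m S \<eta>" unfolding mem_stab_iff[OF \<eta>]
  proof (intro conjI allI impI)
    show "x \<in> nil_mats m S" using x by (simp add: paired_blocks_def)
    fix a b assume ab: "a < m" "b < m" "cuts S b a"
    have "\<eta> $$ (a, c) * x $$ (c, b) = 0" if "c < m" for c
    proof -
      have "cuts (reflect m S) (flip m a) (flip m b)" using ab by (simp add: cuts_reflect_flip)
      from R.paired_blocks_mult_zero[OF reduced_antitranspose[OF red] antitranspose_paired_blocks[OF x]
          flip_less flip_less flip_less this, of c]
      show ?thesis using ab that by (simp add: antitranspose_index_flip mult.commute)
    qed
    then show "(\<Sum>c<m. x $$ (a, c) * \<eta> $$ (c, b)) = (\<Sum>c<m. \<eta> $$ (a, c) * x $$ (c, b))"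
      using paired_blocks_mult_zero[OF red x ab(1,2) _ ab(3)] by (simp del: mult_eq_0_iff)
  qed
qed

end

section \<open>Gaussian elimination\<close>

lemma antitranspose_unip_mats: "g \<in> unip_mats m S \<Longrightarrow> antitranspose m g \<in> unip_mats m (reflect m S)"
proof -
  assume g: "g \<in> unip_mats m S"
  have eq: "flip m j = flip m i \<longleftrightarrow> i = j" if "i < m" "j < m" for i j
    using that by (metis flip_flip)
  show ?thesis
    using unip_mats_index[OF g]
    by (auto simp: unip_mats_def antitranspose_carrier antitranspose_index cuts_reflect flip_less eq)
qed

lemma reflect_reflect: "S \<subseteq> {..m} \<Longrightarrow> reflect m (reflect m S) = S"
  by (auto simp: reflect_def)

lemma down_closed_initial_segment:
  assumes "\<And>b b'. b' \<le> b \<Longrightarrow> P b \<Longrightarrow> P b'"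
  shows "\<exists>i\<le>k. \<forall>b<k. P b \<longleftrightarrow> b < (i::nat)"
proof (induction k)
  case (Suc k)
  then obtain i where i: "i \<le> k" "\<forall>b<k. P b \<longleftrightarrow> b < i" by blast
  show ?case
  proof (cases "P k")
    case True
    then show ?thesis using assms[of _ k] by (intro exI[of _ "Suc k"]) (simp add: less_Suc_eq_le)
  next
    case False
    then show ?thesis using i by (intro exI[of _ i]) (auto simp: less_Suc_eq)
  qed
qed simp

lemma prod_list_map_1: "prod_list (map (\<lambda>_. 1) xs) = (1 :: 'a :: comm_monoid_mult)"
  by (induction xs) auto

lemma det_lower_unitriangular:
  assumes A: "A \<in> carrier_mat l l" and "\<And>i j. i < j \<Longrightarrow> j < l \<Longrightarrow> A $$ (i, j) = 0"
    and "\<And>i. i < l \<Longrightarrow> A $$ (i, i) = 1"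
  shows "det A = (1 :: complex)"
proof -
  have "diag_mat A = map (\<lambda>_. 1) [0..<l]"
    unfolding diag_mat_def using assms by (intro map_cong) auto
  then show ?thesis using det_lower_triangular[OF assms(2) A] by (simp add: prod_list_map_1)
qed

context cascade_blocks
begin

text \<open>The columns b to be cleared in row a and the rows \<open>flip m c\<close> that an
  element of N may add to row a are given by the same condition. It describes an initial segment of
  length i, so the system is square and its matrix is the i x i corner. Hence corner minors of all
  sizes up to k are required.\<close>

lemma clearing_row:
  assumes minors: "\<And>i. i \<le> k \<Longrightarrow> minor i (flip m) id \<xi> \<noteq> 0"
  shows "\<exists>h. (\<forall>b<k. \<not> cuts S a (flip m b) \<longrightarrow> h b = 0) \<and>
    (\<forall>b<k. cuts S a (flip m b) \<longrightarrow> \<xi> $$ (a, b) + (\<Sum>c<k. h c * \<xi> $$ (flip m c, b)) = 0)"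
proof -
  have "\<exists>i\<le>k. \<forall>b<k. cuts S a (flip m b) \<longleftrightarrow> b < i"
    by (rule down_closed_initial_segment) (auto simp: flip_def elim!: cuts_mono)
  then obtain i where i: "i \<le> k" "\<And>b. b < k \<Longrightarrow> cuts S a (flip m b) \<longleftrightarrow> b < i" by blast
  obtain h where h: "\<And>b. b < i \<Longrightarrow> (\<Sum>c<i. h c * \<xi> $$ (flip m c, id b)) = - \<xi> $$ (a, b)"
    using minor_nonzero_imp_left_solution[OF minors[OF i(1)], of "\<lambda>b. - \<xi> $$ (a, b)"] by blast
  have "(\<Sum>c<k. (if c < i then h c else 0) * \<xi> $$ (flip m c, b)) = (\<Sum>c<i. h c * \<xi> $$ (flip m c, b))" for b
    using i(1) by (intro sum.mono_neutral_cong_right) auto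
  then show ?thesis using h i(2) by (intro exI[of _ "\<lambda>c. if c < i then h c else 0"]) auto
qed

lemma clearing_rows:
  assumes \<xi>: "\<xi> \<in> carrier_mat m m" and minors: "\<And>i. i \<le> k \<Longrightarrow> minor i (flip m) id \<xi> \<noteq> 0"
  obtains H where "H \<in> unip_mats m S"
    "\<And>a c. a < m \<Longrightarrow> c < m \<Longrightarrow> a \<noteq> c \<Longrightarrow> \<not> (k \<le> a \<and> m - k \<le> c) \<Longrightarrow> H $$ (a, c) = 0"
    "\<And>a b. k \<le> a \<Longrightarrow> a < m \<Longrightarrow> b < k \<Longrightarrow> cuts S a (flip m b) \<Longrightarrow> (H * \<xi>) $$ (a, b) = 0"
proof -
  obtain h where h0: "\<And>a b. b < k \<Longrightarrow> \<not> cuts S a (flip m b) \<Longrightarrow> h a b = 0"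
    and h: "\<And>a b. b < k \<Longrightarrow> cuts S a (flip m b) \<Longrightarrow>
      \<xi> $$ (a, b) + (\<Sum>c<k. h a c * \<xi> $$ (flip m c, b)) = 0"
    using clearing_row[OF minors] by metis
  define H where "H = mat m m (\<lambda>(a, c). if a = c then 1 else if k \<le> a \<and> m - k \<le> c then h a (flip m c) else 0)"
  have Hc: "H \<in> carrier_mat m m" by (simp add: H_def)
  have "H \<in> unip_mats m S"
    unfolding unip_mats_def using Hc by (auto simp: H_def h0 flip_last flip_flip)
  moreover have "H $$ (a, c) = 0" if "a < m" "c < m" "a \<noteq> c" "\<not> (k \<le> a \<and> m - k \<le> c)" for a c
    using that by (auto simp: H_def)
  moreover have "(H * \<xi>) $$ (a, b) = 0" if a: "k \<le> a" "a < m" and b: "b < k" and cut: "cuts S a (flip m b)" for a b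
  proof -
    have bm: "b < m" using b by (rule k_less)
    have "(H * \<xi>) $$ (a, b) = (\<Sum>c<m. H $$ (a, c) * \<xi> $$ (c, b))"
      by (rule mat_mult_index[OF Hc \<xi> a(2) bm])
    also have "\<dots> = (\<Sum>c<m. (if c = a then \<xi> $$ (a, b) else 0) +
        (if m - k \<le> c then h a (flip m c) * \<xi> $$ (c, b) else 0))"
    proof (rule sum.cong)
      fix c assume "c \<in> {..<m}"
      then have c: "c < m" by simp
      \<comment> \<open>For a among the last k, the diagonal place c = a also occurs in the second
        sum. Its coefficient is zero since a is not cut from itself.\<close>
      have "h a (flip m a) = 0" if "m - k \<le> a"
        using that a by (intro h0) (auto simp: flip_last flip_flip not_cuts_refl)
      then show "H $$ (a, c) * \<xi> $$ (c, b) = (if c = a then \<xi> $$ (a, b) else 0) +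
          (if m - k \<le> c then h a (flip m c) * \<xi> $$ (c, b) else 0)"
        using a c by (auto simp: H_def)
    qed simp
    also have "\<dots> = \<xi> $$ (a, b) + (\<Sum>c<m. if m - k \<le> c then h a (flip m c) * \<xi> $$ (c, b) else 0)"
      using a by (simp add: sum.distrib)
    also have "(\<Sum>c<m. if m - k \<le> c then h a (flip m c) * \<xi> $$ (c, b) else 0)
        = (\<Sum>c<m. if m - k \<le> flip m c then h a (flip m (flip m c)) * \<xi> $$ (flip m c, b) else 0)"
      by (rule sum_flip[symmetric])
    also have "\<dots> = (\<Sum>c<k. h a c * \<xi> $$ (flip m c, b))"
    proof (rule sum.mono_neutral_cong_right)
      show "{..<k} \<subseteq> {..<m}" using two_k by auto
      show "\<forall>c\<in>{..<m} - {..<k}. (if m - k \<le> flip m c then h a (flip m (flip m c)) * \<xi> $$ (flip m c, b) else 0) = 0"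
        by (auto simp: flip_def)
    qed (use k_less flip_first in \<open>auto simp: flip_flip\<close>)
    finally show ?thesis using h[OF b cut] by simp
  qed
  ultimately show thesis by (rule that)
qed

end

context symmetric_blocks
begin

text \<open>Row clearing for the reflected matrix: reflection turns the left factor into a right
  factor.\<close>

lemma clearing_columns:
  assumes S: "S \<subseteq> {..m}" and \<xi>: "\<xi> \<in> carrier_mat m m"
    and minors: "\<And>i. i \<le> k \<Longrightarrow> minor i (flip m) id \<xi> \<noteq> 0"
  obtains G where "G \<in> unip_mats m S"
    "\<And>a c. a < m \<Longrightarrow> c < m \<Longrightarrow> a \<noteq> c \<Longrightarrow> \<not> (a < k \<and> c < m - k) \<Longrightarrow> G $$ (a, c) = 0"
    "\<And>a b. m - k \<le> a \<Longrightarrow> a < m \<Longrightarrow> b < m - k \<Longrightarrow> cuts S (flip m a) b \<Longrightarrow> (\<xi> * G) $$ (a, b) = 0"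
proof -
  interpret R: symmetric_blocks m k "reflect m S" by (rule symmetric_blocks_reflect)
  have "minor i (flip m) id (antitranspose m \<xi>) \<noteq> 0" if "i \<le> k" for i
    using minors[OF that] two_k that by (simp add: minor_antitranspose)
  then obtain H where H: "H \<in> unip_mats m (reflect m S)"
    and H0: "\<And>a c. a < m \<Longrightarrow> c < m \<Longrightarrow> a \<noteq> c \<Longrightarrow> \<not> (k \<le> a \<and> m - k \<le> c) \<Longrightarrow> H $$ (a, c) = 0"
    and H\<xi>: "\<And>a b. k \<le> a \<Longrightarrow> a < m \<Longrightarrow> b < k \<Longrightarrow> cuts (reflect m S) a (flip m b) \<Longrightarrow>
      (H * antitranspose m \<xi>) $$ (a, b) = 0"
    using R.clearing_rows[OF antitranspose_carrier] by blast
  note Hc = unip_mats_carrier[OF H]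
  show thesis
  proof (rule that[of "antitranspose m H"])
    show "antitranspose m H \<in> unip_mats m S"
      using antitranspose_unip_mats[OF H] reflect_reflect[OF S] by simp
    show "antitranspose m H $$ (a, c) = 0" if "a < m" "c < m" "a \<noteq> c" "\<not> (a < k \<and> c < m - k)" for a c
    proof -
      have "flip m c \<noteq> flip m a" using that by (metis flip_flip)
      moreover have "\<not> (k \<le> flip m c \<and> m - k \<le> flip m a)" using that two_k by (auto simp: flip_def)
      ultimately show ?thesis using H0[of "flip m c" "flip m a"] that
        by (simp add: antitranspose_index flip_less)
    qed
    fix a b assume a: "m - k \<le> a" "a < m" and b: "b < m - k" and cut: "cuts S (flip m a) b"
    have bm: "b < m" using b by simp
    have fb: "k \<le> flip m b" "flip m b < m" using b by (auto simp: flip_def)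
    have fa: "flip m a < k" "flip m a < m" using flip_last[OF a] flip_less[OF a(2)] by auto
    have "(\<xi> * antitranspose m H) $$ (a, b) = (\<Sum>c<m. \<xi> $$ (a, c) * antitranspose m H $$ (c, b))"
      by (rule mat_mult_index[OF \<xi> antitranspose_carrier a(2) bm])
    also have "\<dots> = (\<Sum>c<m. \<xi> $$ (a, flip m c) * antitranspose m H $$ (flip m c, b))"
      by (rule sum_flip[symmetric])
    also have "\<dots> = (\<Sum>c<m. H $$ (flip m b, c) * antitranspose m \<xi> $$ (c, flip m a))"
      using a bm by (intro sum.cong) (auto simp: antitranspose_index flip_less flip_flip)
    also have "\<dots> = (H * antitranspose m \<xi>) $$ (flip m b, flip m a)"
      by (rule mat_mult_index[OF Hc antitranspose_carrier fb(2) fa(2), symmetric])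
    also have "\<dots> = 0"
      using cut fa fb bm a by (intro H\<xi>) (auto simp: cuts_reflect_flip flip_less flip_flip cuts_reflect)
    finally show "(\<xi> * antitranspose m H) $$ (a, b) = 0" .
  qed
qed

text \<open>
  Gaussian elimination: multiplying by \<open>H\<close> on the left clears rows, multiplying by \<open>G\<close> on the
  right clears columns, and the conjugation by \<open>G H\<^sup>-\<^sup>1\<close> agrees with \<open>\<xi> \<mapsto> H \<xi> G\<close> on the
  entries that matter.
\<close>

lemma conj_reduced:
  assumes S: "S \<subseteq> {..m}" and \<xi>: "\<xi> \<in> carrier_mat m m"
    and minors: "\<And>i. i \<le> k \<Longrightarrow> minor i (flip m) id \<xi> \<noteq> 0"
  obtains g h where "g \<in> unip_mats m S" "h \<in> unip_mats m S" "g * h = 1\<^sub>m m" "h * g = 1\<^sub>m m"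
    "reduced m k S (h * \<xi> * g)"
proof -
  obtain H where H: "H \<in> unip_mats m S"
    and H0: "\<And>a c. a < m \<Longrightarrow> c < m \<Longrightarrow> a \<noteq> c \<Longrightarrow> \<not> (k \<le> a \<and> m - k \<le> c) \<Longrightarrow> H $$ (a, c) = 0"
    and H\<xi>: "\<And>a b. k \<le> a \<Longrightarrow> a < m \<Longrightarrow> b < k \<Longrightarrow> cuts S a (flip m b) \<Longrightarrow> (H * \<xi>) $$ (a, b) = 0"
    using clearing_rows[OF \<xi> minors] by blast
  obtain G where G: "G \<in> unip_mats m S"
    and G0: "\<And>a c. a < m \<Longrightarrow> c < m \<Longrightarrow> a \<noteq> c \<Longrightarrow> \<not> (a < k \<and> c < m - k) \<Longrightarrow> G $$ (a, c) = 0"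
    and G\<xi>: "\<And>a b. m - k \<le> a \<Longrightarrow> a < m \<Longrightarrow> b < m - k \<Longrightarrow> cuts S (flip m a) b \<Longrightarrow> (\<xi> * G) $$ (a, b) = 0"
    using clearing_columns[OF S \<xi> minors] by blast
  obtain H' where H': "H' \<in> unip_mats m S" "H * H' = 1\<^sub>m m" "H' * H = 1\<^sub>m m" using unip_mats_inverse[OF H] .
  obtain G' where G': "G' \<in> unip_mats m S" "G * G' = 1\<^sub>m m" "G' * G = 1\<^sub>m m" using unip_mats_inverse[OF G] .
  note c = unip_mats_carrier[OF H] unip_mats_carrier[OF G] unip_mats_carrier[OF H'(1)] unip_mats_carrier[OF G'(1)]
  note diag = unip_mats_index[OF H _ _ not_cuts_refl] unip_mats_index[OF G _ _ not_cuts_refl]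
  define g where "g = G * H'"
  define h where "h = H * G'"
  have g: "g \<in> unip_mats m S" and h: "h \<in> unip_mats m S"
    unfolding g_def h_def by (intro unip_mats_mult G H G'(1) H'(1))+
  note gc = unip_mats_carrier[OF g] and hc = unip_mats_carrier[OF h]
  have gh: "g * h = 1\<^sub>m m"
    unfolding g_def h_def using c by (simp add: mat_mult_assoc[of _ m] mat_mult_cancel[OF H'(3) c(1,3)] mat_mult_carrier G'(2))
  have hg: "h * g = 1\<^sub>m m"
    unfolding g_def h_def using c by (simp add: mat_mult_assoc[of _ m] mat_mult_cancel[OF G'(3) c(2,4)] mat_mult_carrier H'(2))
  \<comment> \<open>The off-diagonal entries of G lie in rows below k, so the remaining rows of G,
    and with them those of its inverse, are trivial.\<close>
  have G'_row: "G' $$ (a, b) = (if a = b then 1 else 0)" if "k \<le> a" "a < m" "b < m" for a b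
  proof -
    have "(G * G') $$ (a, b) = (\<Sum>d<m. if d = a then G' $$ (a, b) else 0)"
      unfolding mat_mult_index[OF c(2,4) that(2,3)]
      using G0 diag that by (intro sum.cong) auto
    then show ?thesis using G'(2) that by simp
  qed
  \<comment> \<open>In a row a \<ge> k, H has off-diagonal entries only in columns d \<ge> m - k
    \<ge> k, where the rows of \<open>G'\<close> are trivial.\<close>
  have h_row: "h $$ (a, b) = H $$ (a, b)" if "k \<le> a" "a < m" "b < m" for a b
  proof -
    have "h $$ (a, b) = (\<Sum>d<m. if d = b then H $$ (a, b) else 0)"
      unfolding h_def mat_mult_index[OF c(1,4) that(2,3)]
    proof (rule sum.cong)
      fix d assume "d \<in> {..<m}"
      then show "H $$ (a, d) * G' $$ (d, b) = (if d = b then H $$ (a, b) else 0)"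
        using H0[of a d] G'_row[of d b] that two_k by (cases "k \<le> d") auto
    qed simp
    then show ?thesis using that by simp
  qed
  have H'_col: "H' $$ (a, b) = (if a = b then 1 else 0)" if "b < m - k" "a < m" for a b
  proof -
    have b: "b < m" using that by simp
    have "(H' * H) $$ (a, b) = (\<Sum>d<m. if d = b then H' $$ (a, b) else 0)"
      unfolding mat_mult_index[OF c(3,1) that(2) b]
      using H0 diag that by (intro sum.cong) auto
    then show ?thesis using H'(3) that by simp
  qed
  have g_col: "g $$ (a, b) = G $$ (a, b)" if "b < m - k" "a < m" for a b
  proof -
    have b: "b < m" using that by simp
    have "g $$ (a, b) = (\<Sum>d<m. if d = b then G $$ (a, b) else 0)"
      unfolding g_def mat_mult_index[OF c(2,3) that(2) b]
      using H'_col that by (intro sum.cong) auto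
    then show ?thesis using b by simp
  qed
  define \<eta> where "\<eta> = h * \<xi> * g"
  have H\<xi>c: "H * \<xi> \<in> carrier_mat m m" and \<xi>Gc: "\<xi> * G \<in> carrier_mat m m" and h\<xi>c: "h * \<xi> \<in> carrier_mat m m"
    and \<eta>c: "\<eta> \<in> carrier_mat m m"
    unfolding \<eta>_def by (rule mat_mult_carrier c \<xi> gc hc)+
  \<comment> \<open>All entries that \<open>reduced\<close> constrains, as well as the corner, lie
    in rows from k on and columns before m - k. There the correction factors \<open>G'\<close> and
    \<open>H'\<close> do not show.\<close>
  have \<eta>: "\<eta> $$ (a, b) = (H * \<xi> * G) $$ (a, b)" if "k \<le> a" "a < m" "b < m - k" for a b
  proof -
    have b: "b < m" using that by simp
    have "(h * \<xi>) $$ (a, d) = (H * \<xi>) $$ (a, d)" if "d < m" for d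
      unfolding mat_mult_index[OF hc \<xi> \<open>a < m\<close> that] mat_mult_index[OF c(1) \<xi> \<open>a < m\<close> that]
      using h_row \<open>k \<le> a\<close> \<open>a < m\<close> by (intro sum.cong) auto
    then show ?thesis
      unfolding \<eta>_def mat_mult_index[OF h\<xi>c gc that(2) b] mat_mult_index[OF H\<xi>c c(2) that(2) b]
      using g_col that by (intro sum.cong) auto
  qed
  have "reduced m k S \<eta>"
    unfolding reduced_def
  proof (intro conjI allI impI; (elim conjE)?)
    fix a b
    show "\<eta> $$ (a, b) = 0" if a: "k \<le> a" "a < m" and b: "b < k" and cut: "cuts S a (flip m b)"
    proof -
      note bm = k_less[OF b]
      show ?thesis unfolding \<eta>[OF a bm(1)] mat_mult_index[OF H\<xi>c c(2) a(2) bm(2)]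
      proof (rule sum.neutral, rule ballI)
        fix d assume "d \<in> {..<m}"
        then have d: "d < m" by simp
        \<comment> \<open>G is upper triangular, so only columns d \<le> b of
          \<open>H * \<xi>\<close> enter, and the cleared pattern is closed under passing to earlier
          columns. Dually, H brings in only later rows of \<open>\<xi> * G\<close>.\<close>
        show "(H * \<xi>) $$ (a, d) * G $$ (d, b) = 0"
        proof (cases "d \<le> b")
          case True
          then have "cuts S a (flip m d)" using cut by (auto simp: flip_def elim!: cuts_mono)
          then show ?thesis using H\<xi>[OF a, of d] True b by simp
        next
          case False
          then have "\<not> cuts S d b" by (auto dest: cuts_less)
          then show ?thesis using unip_mats_index[OF G d bm(2)] False by simp
        qed
      qed
    qed
    show "\<eta> $$ (a, b) = 0" if a: "m - k \<le> a" "a < m" and b: "b < m - k" and cut: "cuts S (flip m a) b"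
    proof -
      have bm: "b < m" and ka: "k \<le> a" using a b two_k by auto
      have assoc: "H * \<xi> * G = H * (\<xi> * G)" by (rule mat_mult_assoc[OF c(1) \<xi> c(2)])
      show ?thesis unfolding \<eta>[OF ka a(2) b] assoc mat_mult_index[OF c(1) \<xi>Gc a(2) bm]
      proof (rule sum.neutral, rule ballI)
        fix d assume "d \<in> {..<m}"
        then have d: "d < m" by simp
        show "H $$ (a, d) * (\<xi> * G) $$ (d, b) = 0"
        proof (cases "a \<le> d")
          case True
          then have "cuts S (flip m d) b" using cut by (auto simp: flip_def elim!: cuts_mono)
          then show ?thesis using G\<xi>[OF _ d b] True a by simp
        next
          case False
          then have "\<not> cuts S a d" by (auto dest: cuts_less)
          then show ?thesis using unip_mats_index[OF H a(2) d] False by simp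
        qed
      qed
    qed
  next
    \<comment> \<open>With rows read from the bottom, the corner of H is lower unitriangular and
      that of G upper unitriangular. In the rows and columns concerned H and G have no further
      entries, so the corner of the product is A C B and keeps its determinant.\<close>
    define A where "A = mat k k (\<lambda>(i, j). H $$ (flip m i, flip m j))"
    define B where "B = mat k k (\<lambda>(i, j). G $$ (i, j))"
    define C where "C = mat k k (\<lambda>(i, j). \<xi> $$ (flip m i, id j))"
    have ABC: "A \<in> carrier_mat k k" "B \<in> carrier_mat k k" "C \<in> carrier_mat k k"
      by (simp_all add: A_def B_def C_def)
    have "det A = 1"
    proof (rule det_lower_unitriangular[OF ABC(1)])
      fix i j assume ij: "i < j" "j < k"
      then have "flip m j < flip m i" using k_less[of j] by (auto simp: flip_def)
      then have "\<not> cuts S (flip m i) (flip m j)" "flip m i \<noteq> flip m j" by (auto dest: cuts_less)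
      then show "A $$ (i, j) = 0"
        using ij unip_mats_index[OF H, of "flip m i" "flip m j"] flip_first(3) by (simp add: A_def)
    qed (use diag flip_first in \<open>simp add: A_def\<close>)
    have "det (transpose_mat B) = 1"
    proof (rule det_lower_unitriangular)
      show "transpose_mat B \<in> carrier_mat k k" using ABC by simp
      fix i j assume ij: "i < j" "j < k"
      then have "\<not> cuts S j i" by (auto dest: cuts_less)
      then show "transpose_mat B $$ (i, j) = 0"
        using ij unip_mats_index[OF G, of j i] k_less by (simp add: B_def)
    qed (use diag k_less in \<open>simp add: B_def\<close>)
    then have "det B = 1" using det_transpose[OF ABC(2)] by simp
    have "mat k k (\<lambda>(i, j). \<eta> $$ (flip m i, id j)) = A * (C * B)"
    proof (rule eq_matI)
      fix i j assume "i < dim_row (A * (C * B))" "j < dim_col (A * (C * B))"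
      then have ij: "i < k" "j < k" using ABC by auto
      note f = flip_first[OF ij(1)] and j = k_less[OF ij(2)]
      have inner: "(\<xi> * G) $$ (flip m c, j) = (C * B) $$ (c, j)" if c': "c < k" for c
      proof -
        have "(\<xi> * G) $$ (flip m c, j) = (\<Sum>d<m. \<xi> $$ (flip m c, d) * G $$ (d, j))"
          by (rule mat_mult_index[OF \<xi> c(2) flip_first(3)[OF c'] j(2)])
        also have "\<dots> = (\<Sum>d<k. C $$ (c, d) * B $$ (d, j))"
          by (rule sum.mono_neutral_cong_right) (use G0 ij k_less c' two_k in \<open>auto simp: B_def C_def\<close>)
        also have "\<dots> = (C * B) $$ (c, j)" by (rule mat_mult_index[OF ABC(3,2) c' ij(2), symmetric])
        finally show ?thesis .
      qed
      have assoc: "H * \<xi> * G = H * (\<xi> * G)" by (rule mat_mult_assoc[OF c(1) \<xi> c(2)])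
      have "\<eta> $$ (flip m i, j) = (\<Sum>d<m. H $$ (flip m i, d) * (\<xi> * G) $$ (d, j))"
        unfolding \<eta>[OF f(2,3) j(1)] assoc by (rule mat_mult_index[OF c(1) \<xi>Gc f(3) j(2)])
      also have "\<dots> = (\<Sum>d<m. H $$ (flip m i, flip m d) * (\<xi> * G) $$ (flip m d, j))"
        by (rule sum_flip[symmetric])
      also have "\<dots> = (\<Sum>d<k. A $$ (i, d) * (C * B) $$ (d, j))"
      proof (rule sum.mono_neutral_cong_right)
        show "{..<k} \<subseteq> {..<m}" using two_k by auto
        show "\<forall>d\<in>{..<m} - {..<k}. H $$ (flip m i, flip m d) * (\<xi> * G) $$ (flip m d, j) = 0"
        proof
          fix d assume d: "d \<in> {..<m} - {..<k}"
          then have "flip m d < m - k" "flip m d < m" by (auto simp: flip_def)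
          then have "H $$ (flip m i, flip m d) = 0" using f by (intro H0) auto
          then show "H $$ (flip m i, flip m d) * (\<xi> * G) $$ (flip m d, j) = 0" by simp
        qed
        show "H $$ (flip m i, flip m d) * (\<xi> * G) $$ (flip m d, j) = A $$ (i, d) * (C * B) $$ (d, j)"
          if "d \<in> {..<k}" for d
          using that inner[of d] ij by (simp add: A_def)
      qed simp
      also have "\<dots> = (A * (C * B)) $$ (i, j)"
        by (rule mat_mult_index[OF ABC(1) mat_mult_carrier[OF ABC(3,2)] ij, symmetric])
      finally show "mat k k (\<lambda>(i, j). \<eta> $$ (flip m i, id j)) $$ (i, j) = (A * (C * B)) $$ (i, j)"
        using ij by simp
    qed (use ABC in auto)
    then have "minor k (flip m) id \<eta> = det A * (det C * det B)"
      unfolding minor_def using det_mult[OF ABC(1) mat_mult_carrier[OF ABC(3,2)]] det_mult[OF ABC(3,2)] by simp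
    also have "\<dots> = minor k (flip m) id \<xi>"
      using \<open>det A = 1\<close> \<open>det B = 1\<close> by (simp add: C_def minor_def)
    finally show "minor k (flip m) id \<eta> \<noteq> 0" using minors by simp
  qed (rule \<eta>c)
  then show thesis using that[OF g h gh hg] unfolding \<eta>_def by blast
qed

end

section \<open>Moving stabilisers and cascade points\<close>

lemma antitranspose_mult:
  assumes "A \<in> carrier_mat m m" "B \<in> carrier_mat m m"
  shows "antitranspose m (A * B) = antitranspose m B * antitranspose m A"
proof (rule eq_matI)
  note c = antitranspose_carrier[of m B] antitranspose_carrier[of m A]
  fix i j assume "i < dim_row (antitranspose m B * antitranspose m A)"
    "j < dim_col (antitranspose m B * antitranspose m A)"
  then have ij: "i < m" "j < m" by (auto simp: antitranspose_def)
  have "antitranspose m (A * B) $$ (i, j) = (A * B) $$ (flip m j, flip m i)"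
    using ij by (simp add: antitranspose_def)
  also have "\<dots> = (\<Sum>c<m. A $$ (flip m j, c) * B $$ (c, flip m i))"
    by (rule mat_mult_index[OF assms flip_less[OF ij(2)] flip_less[OF ij(1)]])
  also have "\<dots> = (\<Sum>c<m. A $$ (flip m j, flip m c) * B $$ (flip m c, flip m i))"
    by (rule sum_flip[symmetric])
  also have "\<dots> = (\<Sum>c<m. antitranspose m B $$ (i, c) * antitranspose m A $$ (c, j))"
    using ij by (intro sum.cong) (auto simp: antitranspose_index)
  also have "\<dots> = (antitranspose m B * antitranspose m A) $$ (i, j)"
    by (rule mat_mult_index[OF c ij, symmetric])
  finally show "antitranspose m (A * B) $$ (i, j) = (antitranspose m B * antitranspose m A) $$ (i, j)" .
qed (auto simp: antitranspose_def)

lemma antitranspose_antitranspose: "x \<in> carrier_mat m m \<Longrightarrow> antitranspose m (antitranspose m x) = x"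
  by (rule eq_matI) (auto simp: antitranspose_def flip_flip flip_less)

lemma mat_polynomial_antitranspose:
  "mat_polynomial m f \<Longrightarrow> mat_polynomial m (\<lambda>x. f (antitranspose m x))"
proof (induction rule: mat_polynomial.induct)
  case (entry i j)
  have "mat_polynomial m (\<lambda>x. x $$ (flip m j, flip m i))"
    using entry by (intro mat_polynomial.entry flip_less)
  then show ?case using entry by (simp add: antitranspose_index)
qed (auto intro: mat_polynomial.intros)

lemma antitranspose_opp_mats:
  "x \<in> opp_mats m (reflect m S) \<Longrightarrow> antitranspose m x \<in> opp_mats m S"
  unfolding opp_mats_def
  by (auto simp: antitranspose_carrier antitranspose_index cuts_reflect flip_less flip_flip)

text \<open>For l < k, a root vector of the cascade root \<open>\<beta>\<close> with index l + 1;
  reflection fixes it.\<close>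

definition corner_unit :: "nat \<Rightarrow> nat \<Rightarrow> complex mat" where
  "corner_unit m l = mat m m (\<lambda>(i, j). if i = l \<and> j = flip m l then 1 else 0)"

lemma corner_unit_carrier: "corner_unit m l \<in> carrier_mat m m"
  by (simp add: corner_unit_def)

lemma antitranspose_corner_unit: "l < m \<Longrightarrow> antitranspose m (corner_unit m l) = corner_unit m l"
proof (rule eq_matI)
  fix i j assume "l < m" "i < dim_row (corner_unit m l)" "j < dim_col (corner_unit m l)"
  then have ij: "l < m" "i < m" "j < m" by (auto simp: corner_unit_def)
  then have "flip m j = l \<and> flip m i = flip m l \<longleftrightarrow> i = l \<and> j = flip m l" by (metis flip_flip)
  then show "antitranspose m (corner_unit m l) $$ (i, j) = corner_unit m l $$ (i, j)"
    using ij by (simp add: corner_unit_def antitranspose_index flip_less)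
qed (auto simp: corner_unit_def antitranspose_def)

lemma conj_corner_unit_index:
  assumes g: "g \<in> carrier_mat m m" and h: "h \<in> carrier_mat m m" and lt: "l < m" "i < m" "j < m"
  shows "(g * corner_unit m l * h) $$ (i, j) = g $$ (i, l) * h $$ (flip m l, j)"
proof -
  note E = corner_unit_carrier[of m l]
  have gE: "(g * corner_unit m l) $$ (i, c) = (if c = flip m l then g $$ (i, l) else 0)" if "c < m" for c
  proof -
    have "(g * corner_unit m l) $$ (i, c) = (\<Sum>d<m. if d = l then if c = flip m l then g $$ (i, l) else 0 else 0)"
      unfolding mat_mult_index[OF g E lt(2) that]
      using that lt by (intro sum.cong) (auto simp: corner_unit_def)
    then show ?thesis using lt by simp
  qed
  have "(g * corner_unit m l * h) $$ (i, j) = (\<Sum>c<m. if c = flip m l then g $$ (i, l) * h $$ (flip m l, j) else 0)"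
    unfolding mat_mult_index[OF mat_mult_carrier[OF g E] h lt(2,3)]
    using gE by (intro sum.cong) auto
  then show ?thesis using flip_less[OF lt(1)] by simp
qed

context cascade_blocks
begin

text \<open>
  If a conjugate of the unit at \<open>(l, flip m l)\<close> stabilises \<open>\<xi>\<close>, then row \<open>flip m l\<close> of the corner
  of \<open>\<xi>\<close>, cut at column \<open>l\<close>, is a combination of the \<open>l - 1\<close> last rows only.
\<close>

lemma corner_unit_moves:
  assumes l: "0 < l" "l < k" "l \<in> S" "m - l \<notin> S"
  defines "r \<equiv> \<lambda>a. if a < l - 1 then flip m a else flip m l"
  assumes \<xi>: "\<xi> \<in> carrier_mat m m" and nz: "minor l r id \<xi> \<noteq> 0"
    and g: "g \<in> unip_mats m S" and h: "h \<in> unip_mats m S"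
  shows "g * corner_unit m l * h \<notin> stab m S \<xi>"
proof
  assume x: "g * corner_unit m l * h \<in> stab m S \<xi>"
  note gc = unip_mats_carrier[OF g] and hc = unip_mats_carrier[OF h]
  have lm: "l < m" and fl: "k \<le> flip m l" "flip m l < m" using l k_less flip_first by auto
  let ?w = "\<lambda>c. h $$ (flip m l, c)"
  have w: "?w c = (if c = flip m l then 1 else 0)" if "c < m" "\<not> cuts S (flip m l) c" for c
    using unip_mats_index[OF h fl(2) that] by auto
  \<comment> \<open>The asymmetry enters here: only a boundary at m - l could separate these two
    neighbouring indices.\<close>
  have not_cut: "\<not> cuts S (flip m l) (flip m (l - 1))"
  proof
    assume "cuts S (flip m l) (flip m (l - 1))"
    then obtain s where "s \<in> S" "flip m l < s" "s \<le> flip m (l - 1)" by (auto simp: cuts_def)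
    then have "s = m - l" using l lm by (auto simp: flip_def)
    with \<open>s \<in> S\<close> l show False by simp
  qed
  obtain l0 where l0: "l = Suc l0" using l by (cases l) auto
  have ker: "(\<Sum>a<l. ?w (r a) * \<xi> $$ (r a, id b)) = 0" if b: "b < l" for b
  proof -
    \<comment> \<open>Because l is a boundary, every position (l, b) with b < l is below the
      diagonal blocks, so the stabiliser provides an equation there.\<close>
    have bm: "b < m" and bl: "cuts S b l" using b lm l by (auto simp: cuts_def)
    let ?f = "\<lambda>c. ?w (flip m c) * \<xi> $$ (flip m c, b)"
    have fl0: "?f l0 = 0"
      using w[of "flip m l0"] not_cut l0 lm flip_less[of l0 m] by (auto simp: flip_def)
    have "(\<Sum>c<m. (g * corner_unit m l * h) $$ (l, c) * \<xi> $$ (c, b))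
        = (\<Sum>c<m. \<xi> $$ (l, c) * (g * corner_unit m l * h) $$ (c, b))"
      using x bl lm bm unfolding mem_stab_iff[OF \<xi>] by (simp del: index_mult_mat)
    moreover have "(g * corner_unit m l * h) $$ (c, b) = 0" if "c < m" for c
    proof -
      have "\<not> cuts S (flip m l) b" "b \<noteq> flip m l" using b l fl by (auto dest: cuts_less)
      then show ?thesis
        unfolding conj_corner_unit_index[OF gc hc lm that bm] using w[OF bm] by simp
    qed
    moreover have "(g * corner_unit m l * h) $$ (l, c) = ?w c" if "c < m" for c
      unfolding conj_corner_unit_index[OF gc hc lm lm that]
      using unip_mats_index[OF g lm lm not_cuts_refl] by simp
    \<comment> \<open>Row l of the conjugate is row \<open>flip m l\<close> of h because g has
      diagonal entry 1, and its columns b < l vanish. What remains is one linear relation among the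
      rows of \<xi>, valid in each column b < l.\<close>
    ultimately have "(\<Sum>c<m. ?w c * \<xi> $$ (c, b)) = 0" by (simp del: index_mult_mat)
    then have "0 = (\<Sum>c<m. ?f c)" using sum_flip[of "\<lambda>c. ?w c * \<xi> $$ (c, b)" m] by simp
    also have "\<dots> = (\<Sum>c<Suc (Suc l0). ?f c)"
    proof (rule sum.mono_neutral_right)
      show "\<forall>c\<in>{..<m} - {..<Suc (Suc l0)}. ?f c = 0"
      proof
        fix c assume c: "c \<in> {..<m} - {..<Suc (Suc l0)}"
        then have "flip m c < flip m l" using l0 by (auto simp: flip_def)
        then have "\<not> cuts S (flip m l) (flip m c)" by (auto dest: cuts_less)
        then show "?f c = 0" using w[of "flip m c"] \<open>flip m c < flip m l\<close> flip_less[of c m] c by auto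
      qed
    qed (use l0 lm in auto)
    also have "\<dots> = (\<Sum>c<l0. ?f c) + ?f l" using fl0 l0 by simp
    also have "\<dots> = (\<Sum>a<l. ?w (r a) * \<xi> $$ (r a, id b))" unfolding l0 by (simp add: r_def l0)
    finally show ?thesis by simp
  qed
  have "?w (r l0) = 0"
    by (rule minor_nonzero_imp_trivial_left_kernel[OF nz ker]) (simp_all add: l0)
  moreover have "?w (r l0) = 1" using w[OF fl(2) not_cuts_refl] by (simp add: r_def l0)
  ultimately show False by simp
qed

text \<open>The condition must be nonvacuous on the opposite nilradical. As l < k, all rows of the
  minor are among the last k and all its columns among the first k, so a zero-one matrix making the
  minor equal to 1 is admissible.\<close>

lemma corner_unit_moves_exists:
  assumes l: "0 < l" "l < k" "l \<in> S" "m - l \<notin> S"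
  shows "\<exists>f. mat_polynomial m f \<and> (\<exists>\<xi>\<in>opp_mats m S. f \<xi> \<noteq> 0) \<and>
    (\<forall>\<xi>\<in>carrier_mat m m. f \<xi> \<noteq> 0 \<longrightarrow>
      (\<forall>g\<in>unip_mats m S. \<forall>h\<in>unip_mats m S. g * corner_unit m l * h \<notin> stab m S \<xi>))"
proof -
  define r where "r a = (if a < l - 1 then flip m a else flip m l)" for a
  have r: "m - k \<le> r a" "r a < m" if "a < l" for a
    using that l flip_first[of a] flip_first[of l] by (auto simp: r_def)
  have r_inj: "r a = r b \<longleftrightarrow> a = b" if "a < l" "b < l" for a b
    using that l k_less(2)[of l] by (auto simp: r_def flip_def)
  define \<xi> where "\<xi> = mat m m (\<lambda>(i, j). if j < l \<and> i = r j then 1 else (0::complex))"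
  have "\<xi> \<in> opp_mats m S"
    using r l by (auto simp: opp_mats_def \<xi>_def intro: cuts_outer)
  moreover have "minor l r id \<xi> \<noteq> 0"
  proof -
    have "mat l l (\<lambda>(a, b). \<xi> $$ (r a, id b)) = 1\<^sub>m l"
      by (rule eq_matI) (use r l r_inj k_less(2)[of l] in \<open>auto simp: \<xi>_def\<close>)
    then show ?thesis by (simp add: minor_def)
  qed
  moreover have "mat_polynomial m (minor l r id)"
    using r l k_less by (intro mat_polynomial_minor) auto
  ultimately show ?thesis
    using corner_unit_moves[OF l] unfolding r_def[abs_def, symmetric] by blast
qed

text \<open>If m - l is the boundary and l is not, reflection interchanges the two. It fixes the
  matrix unit and swaps the roles of g and h.\<close>

lemma asymmetric_corner_unit_moves:
  assumes S: "S \<subseteq> {..m}" and l: "0 < l" "l < k" "(l \<in> S) \<noteq> (m - l \<in> S)"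
  shows "\<exists>f. mat_polynomial m f \<and> (\<exists>\<xi>\<in>opp_mats m S. f \<xi> \<noteq> 0) \<and>
    (\<forall>\<xi>\<in>carrier_mat m m. f \<xi> \<noteq> 0 \<longrightarrow>
      (\<forall>g\<in>unip_mats m S. \<forall>h\<in>unip_mats m S. g * corner_unit m l * h \<notin> stab m S \<xi>))"
proof (cases "l \<in> S")
  case True
  then show ?thesis using corner_unit_moves_exists l by simp
next
  case False
  interpret R: cascade_blocks m k "reflect m S" by (rule cascade_blocks_reflect)
  have lm: "l < m" using l k_less by simp
  have "l \<in> reflect m S" "m - l \<notin> reflect m S" using False l lm by (auto simp: reflect_def)
  from R.corner_unit_moves_exists[OF l(1,2) this] obtain f \<xi>0 where f: "mat_polynomial m f"
    and \<xi>0: "\<xi>0 \<in> opp_mats m (reflect m S)" "f \<xi>0 \<noteq> 0"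
    and moves: "\<And>\<xi> g h. \<xi> \<in> carrier_mat m m \<Longrightarrow> f \<xi> \<noteq> 0 \<Longrightarrow> g \<in> unip_mats m (reflect m S) \<Longrightarrow>
      h \<in> unip_mats m (reflect m S) \<Longrightarrow> g * corner_unit m l * h \<notin> stab m (reflect m S) \<xi>" by blast
  have "g * corner_unit m l * h \<notin> stab m S \<xi>"
    if \<xi>: "\<xi> \<in> carrier_mat m m" "f (antitranspose m \<xi>) \<noteq> 0"
      and g: "g \<in> unip_mats m S" and h: "h \<in> unip_mats m S" for \<xi> g h
  proof
    note gc = unip_mats_carrier[OF g] and hc = unip_mats_carrier[OF h]
    note E = corner_unit_carrier[of m l]
    assume "g * corner_unit m l * h \<in> stab m S \<xi>"
    then have "antitranspose m (g * corner_unit m l * h) \<in> stab m (reflect m S) (antitranspose m \<xi>)"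
      by (rule antitranspose_stab[OF \<xi>(1)])
    also have "antitranspose m (g * corner_unit m l * h)
        = antitranspose m h * (corner_unit m l * antitranspose m g)"
      using antitranspose_mult[OF mat_mult_carrier[OF gc E] hc] antitranspose_mult[OF gc E]
      by (simp add: antitranspose_corner_unit[OF lm])
    also have "\<dots> = antitranspose m h * corner_unit m l * antitranspose m g"
      by (rule mat_mult_assoc[OF antitranspose_carrier E antitranspose_carrier, symmetric])
    finally show False
      using moves[OF antitranspose_carrier \<xi>(2) antitranspose_unip_mats[OF h] antitranspose_unip_mats[OF g]]
      by blast
  qed
  moreover have "f (antitranspose m (antitranspose m \<xi>0)) \<noteq> 0"
    using \<xi>0 by (simp add: antitranspose_antitranspose opp_mats_def)
  ultimately show ?thesis
    using mat_polynomial_antitranspose[OF f] antitranspose_opp_mats[OF \<xi>0(1)]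
    by (intro exI[of _ "\<lambda>x. f (antitranspose m x)"]) blast
qed

text \<open>The matrix form of a cascade point: column j < k holds the root vector of the negative
  of \<open>\<beta>\<close> with index j + 1, at (flip m j, j).\<close>

definition antidiagonal :: "complex mat \<Rightarrow> bool" where
  "antidiagonal \<zeta> \<longleftrightarrow> \<zeta> \<in> carrier_mat m m \<and>
     (\<forall>i<m. \<forall>j<m. \<zeta> $$ (i, j) \<noteq> 0 \<longleftrightarrow> j < k \<and> i = flip m j)"

context
  fixes \<zeta> :: "complex mat"
  assumes \<zeta>: "antidiagonal \<zeta>"
begin

lemma antidiagonal_carrier: "\<zeta> \<in> carrier_mat m m"
  and antidiagonal_index: "i < m \<Longrightarrow> j < m \<Longrightarrow> \<zeta> $$ (i, j) \<noteq> 0 \<longleftrightarrow> j < k \<and> i = flip m j"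
  using \<zeta> by (auto simp: antidiagonal_def)

lemma antidiagonal_opp_mats: "\<zeta> \<in> opp_mats m S"
proof -
  have "cuts S j i" if "i < m" "j < m" "\<zeta> $$ (i, j) \<noteq> 0" for i j
    using antidiagonal_index[OF that(1,2)] that(3) cuts_outer flip_first(1) by auto
  then show ?thesis using antidiagonal_carrier by (auto simp: opp_mats_def)
qed

lemma antidiagonal_minor:
  assumes "i \<le> k"
  shows "minor i (flip m) id \<zeta> \<noteq> 0"
proof -
  let ?A = "mat i i (\<lambda>(a, b). \<zeta> $$ (flip m a, id b))"
  have A: "?A \<in> carrier_mat i i" by simp
  have entry: "\<zeta> $$ (flip m a, b) \<noteq> 0 \<longleftrightarrow> a = b" if "a < i" "b < i" for a b
  proof -
    have "a < m" "b < m" "b < k" using that assms k_less by auto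
    then have "\<zeta> $$ (flip m a, b) \<noteq> 0 \<longleftrightarrow> flip m a = flip m b"
      using antidiagonal_index[OF flip_less] by simp
    also have "\<dots> \<longleftrightarrow> a = b" using \<open>a < m\<close> \<open>b < m\<close> by (metis flip_flip)
    finally show ?thesis .
  qed
  have "det ?A = prod_list (diag_mat ?A)"
  proof (rule det_lower_triangular[OF _ A])
    fix a b assume "a < b" "b < i"
    then show "?A $$ (a, b) = 0" using entry[of a b] by auto
  qed
  moreover have "0 \<notin> set (diag_mat ?A)"
  proof
    assume "0 \<in> set (diag_mat ?A)"
    then obtain a where "a < i" "\<zeta> $$ (flip m a, a) = 0" by (auto simp: diag_mat_def)
    then show False using entry[of a a] by simp
  qed
  ultimately show ?thesis by (simp add: minor_def prod_list_zero_iff)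
qed

lemma antidiagonal_reduced: "reduced m k S \<zeta>"
  unfolding reduced_def
proof (intro conjI allI impI; (elim conjE)?)
  fix a b
  show "\<zeta> $$ (a, b) = 0" if "k \<le> a" "a < m" "b < k" "cuts S a (flip m b)"
    using antidiagonal_index[of a b] that k_less(2) not_cuts_refl by blast
  show "\<zeta> $$ (a, b) = 0" if "m - k \<le> a" "a < m" "b < m - k" "cuts S (flip m a) b"
  proof -
    have "b < m" "flip m a \<noteq> b" using that not_cuts_refl by auto
    then have "a \<noteq> flip m b" by (auto simp: flip_flip)
    then show ?thesis using antidiagonal_index[OF that(2) \<open>b < m\<close>] by blast
  qed
qed (use antidiagonal_carrier antidiagonal_minor in auto)

text \<open>Both products with \<zeta> are multiples of diagonal matrix units, so the commutator is
  diagonal.\<close>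

lemma corner_unit_stab_antidiagonal:
  assumes l: "l < k"
  shows "corner_unit m l \<in> stab m S \<zeta>"
  unfolding mem_stab_iff[OF antidiagonal_carrier]
proof (intro conjI allI impI)
  have lm: "l < m" and fl: "flip m l < m" using k_less[OF l] flip_less by auto
  show "corner_unit m l \<in> nil_mats m S"
    using cuts_outer[OF l flip_first(1)[OF l]] by (auto simp: nil_mats_def corner_unit_def)
  fix a b assume ab: "a < m" "b < m" "cuts S b a"
  then have ne: "a \<noteq> b" using not_cuts_refl by blast
  have "corner_unit m l $$ (a, c) * \<zeta> $$ (c, b) = 0" if "c < m" for c
  proof -
    have "\<zeta> $$ (flip m l, b) = 0" if "a = l"
    proof -
      have "flip m l \<noteq> flip m b" using ne that lm ab by (metis flip_flip)
      then show ?thesis using antidiagonal_index[OF fl ab(2)] by blast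
    qed
    then show ?thesis using that ab by (auto simp: corner_unit_def)
  qed
  moreover have "\<zeta> $$ (a, c) * corner_unit m l $$ (c, b) = 0" if "c < m" for c
    using antidiagonal_index[OF ab(1) lm] ne that ab by (auto simp: corner_unit_def)
  ultimately show "(\<Sum>c<m. corner_unit m l $$ (a, c) * \<zeta> $$ (c, b)) = (\<Sum>c<m. \<zeta> $$ (a, c) * corner_unit m l $$ (c, b))"
    by (simp del: mult_eq_0_iff)
qed

end

end

section \<open>Generic stabilisers\<close>

lemma generic_stabiliser_symmetric:
  assumes S: "S \<subseteq> {1..n}" and sym: "symmetric_blocks (n + 1) k S"
    and \<zeta>: "cascade_blocks.antidiagonal (n + 1) k \<zeta>"
  shows "is_generic n (simple_root ` S) \<zeta>"
proof -
  interpret symmetric_blocks "n + 1" k S by (rule sym)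
  let ?m = "n + 1" and ?O = "opp_mats (n + 1) S"
  \<comment> \<open>Nonvanishing of the product selects the functionals to which the elimination
    applies, and \<zeta> is among them.\<close>
  define f where "f \<xi> = (\<Prod>i\<le>k. minor i (flip ?m) id \<xi>)" for \<xi>
  have "mat_polynomial ?m (minor i (flip ?m) id)" if "i \<le> k" for i
    using that two_k by (intro mat_polynomial_minor) (auto simp: flip_def)
  then have f: "mat_polynomial ?m f" unfolding f_def[abs_def] by (intro mat_polynomial_prod) auto
  have \<zeta>_opp: "\<zeta> \<in> ?O" by (rule antidiagonal_opp_mats[OF \<zeta>])
  have f\<zeta>: "f \<zeta> \<noteq> 0" using antidiagonal_minor[OF \<zeta>] by (simp add: f_def)
  have dense: "zariski ?m ?O closure_of {\<xi> \<in> ?O. f \<xi> \<noteq> 0} = ?O"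
    by (rule zariski_dense_nonzero[OF _ opp_mats_line f \<zeta>_opp f\<zeta>]) (auto simp: opp_mats_def)
  have S': "S \<subseteq> {..?m}" using S by auto
  have conj: "conjugate_under (unip_mats ?m S) (stab ?m S \<xi>) (stab ?m S \<zeta>)"
    if \<xi>: "\<xi> \<in> ?O" "f \<xi> \<noteq> 0" for \<xi>
  proof -
    have \<xi>c: "\<xi> \<in> carrier_mat ?m ?m" using \<xi> by (simp add: opp_mats_def)
    have "minor i (flip ?m) id \<xi> \<noteq> 0" if "i \<le> k" for i using \<xi>(2) that by (simp add: f_def)
    then obtain g h where gh: "g \<in> unip_mats ?m S" "h \<in> unip_mats ?m S" "g * h = 1\<^sub>m ?m" "h * g = 1\<^sub>m ?m"
      and red: "reduced ?m k S (h * \<xi> * g)"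
      using conj_reduced[OF S' \<xi>c] by blast
    note c = unip_mats_carrier[OF gh(1)] unip_mats_carrier[OF gh(2)]
    have hc: "h * \<xi> * g \<in> carrier_mat ?m ?m" by (rule mat_mult_carrier c \<xi>c)+
    have "stab ?m S (g * (h * \<xi> * g) * h) = (\<lambda>y. g * y * h) ` stab ?m S (h * \<xi> * g)"
      by (rule stab_conj[OF gh hc])
    \<comment> \<open>The reduced form of \<xi> and the cascade point share the stabiliser
      \<open>paired_blocks\<close>, so only the conjugation by g remains.\<close>
    then have "stab ?m S \<xi> = (\<lambda>y. g * y * h) ` stab ?m S \<zeta>"
      unfolding conj_mat_inverse[OF c(2,1) gh(3) \<xi>c] stab_reduced[OF red]
        stab_reduced[OF antidiagonal_reduced[OF \<zeta>]] .
    moreover have "inverts_mat g h" "inverts_mat h g" using gh c by (simp_all add: inverts_mat_def)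
    ultimately show ?thesis unfolding conjugate_under_def using gh(1) by blast
  qed
  have stab: "stabiliser n (simple_root ` S) \<xi> = stab ?m S \<xi>" if "\<xi> \<in> ?O" for \<xi>
    by (rule stabiliser_eq[OF S]) (use that in \<open>simp add: opp_mats_def\<close>)
  show ?thesis
    unfolding is_generic_def opp_nilradical_eq[OF S] nilpotent_group_eq[OF S]
  proof (intro exI[of _ "{\<xi> \<in> ?O. f \<xi> \<noteq> 0}"] conjI ballI)
    show "openin (zariski ?m ?O) {\<xi> \<in> ?O. f \<xi> \<noteq> 0}" by (rule openin_zariski_nonzero[OF f])
    show "zariski ?m ?O closure_of {\<xi> \<in> ?O. f \<xi> \<noteq> 0} = ?O" by (rule dense)
    show "\<zeta> \<in> {\<xi> \<in> ?O. f \<xi> \<noteq> 0}" using \<zeta>_opp f\<zeta> by simp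
    fix \<xi> assume "\<xi> \<in> {\<xi> \<in> ?O. f \<xi> \<noteq> 0}"
    then show "conjugate_under (unip_mats ?m S) (stabiliser n (simple_root ` S) \<xi>) (stabiliser n (simple_root ` S) \<zeta>)"
      using conj \<zeta>_opp by (simp add: stab)
  qed
qed

lemma symmetric_if_generic_stabiliser:
  assumes S: "S \<subseteq> {1..n}" and blocks: "cascade_blocks (n + 1) k S"
    and \<zeta>: "cascade_blocks.antidiagonal (n + 1) k \<zeta>"
    and generic: "is_generic_stabiliser n (simple_root ` S) (stabiliser n (simple_root ` S) \<zeta>)"
  shows "symmetric_blocks (n + 1) k S"
proof (intro symmetric_blocks.intro blocks symmetric_blocks_axioms.intro)
  interpret cascade_blocks "n + 1" k S by (rule blocks)
  let ?m = "n + 1" and ?O = "opp_mats (n + 1) S"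
  fix l assume l: "0 < l" "l < k"
  show "l \<in> S \<longleftrightarrow> ?m - l \<in> S"
  proof (rule ccontr)
    assume "\<not> ?thesis"
    then have asym: "(l \<in> S) \<noteq> (?m - l \<in> S)" by blast
    have stab: "stabiliser n (simple_root ` S) \<xi> = stab ?m S \<xi>" if "\<xi> \<in> ?O" for \<xi>
      by (rule stabiliser_eq[OF S]) (use that in \<open>simp add: opp_mats_def\<close>)
    have S': "S \<subseteq> {..?m}" using S by auto
    obtain f \<xi>0 where f: "mat_polynomial ?m f" and \<xi>0: "\<xi>0 \<in> ?O" "f \<xi>0 \<noteq> 0"
      and moves: "\<And>\<xi> g h. \<xi> \<in> carrier_mat ?m ?m \<Longrightarrow> f \<xi> \<noteq> 0 \<Longrightarrow> g \<in> unip_mats ?m S \<Longrightarrow>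
        h \<in> unip_mats ?m S \<Longrightarrow> g * corner_unit ?m l * h \<notin> stab ?m S \<xi>"
      using asymmetric_corner_unit_moves[OF S' l asym] by blast
    \<comment> \<open>The hypothesis yields a generic \<xi> with the same stabiliser as \<zeta>.
      Nothing places \<zeta> itself in the dense open set.\<close>
    obtain \<xi> where "is_generic n (simple_root ` S) \<xi>"
      and \<xi>: "stabiliser n (simple_root ` S) \<zeta> = stabiliser n (simple_root ` S) \<xi>"
      using generic unfolding is_generic_stabiliser_def by blast
    then obtain \<Omega> where \<Omega>: "openin (zariski ?m ?O) \<Omega>" "zariski ?m ?O closure_of \<Omega> = ?O"
      and conj: "\<And>\<xi>'. \<xi>' \<in> \<Omega> \<Longrightarrow> conjugate_under (unip_mats ?m S)
        (stabiliser n (simple_root ` S) \<xi>') (stabiliser n (simple_root ` S) \<zeta>)"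
      unfolding is_generic_def opp_nilradical_eq[OF S] nilpotent_group_eq[OF S] \<xi> by blast
    \<comment> \<open>The nonvanishing locus of f is an open neighbourhood of \<open>\<xi>0\<close>,
      so by density it meets \<Omega>.\<close>
    have "\<xi>0 \<in> zariski ?m ?O closure_of \<Omega>" using \<Omega>(2) \<xi>0 by simp
    note closure = this[unfolded in_closure_of, THEN conjunct2, rule_format, OF conjI]
    obtain \<xi>' where \<xi>': "\<xi>' \<in> \<Omega>" "\<xi>' \<in> {\<xi> \<in> ?O. f \<xi> \<noteq> 0}"
      using closure[OF _ openin_zariski_nonzero[OF f]] \<xi>0 by auto
    then have \<xi>'_opp: "\<xi>' \<in> ?O" and f\<xi>': "f \<xi>' \<noteq> 0" by auto
    from conj[OF \<xi>'(1)] obtain g h where g: "g \<in> unip_mats ?m S"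
      and inv: "inverts_mat g h" "inverts_mat h g"
      and eq: "stab ?m S \<xi>' = (\<lambda>y. g * y * h) ` stab ?m S \<zeta>"
      unfolding conjugate_under_def stab[OF \<xi>'_opp] stab[OF antidiagonal_opp_mats[OF \<zeta>]] by blast
    note gc = unip_mats_carrier[OF g]
    \<comment> \<open>\<open>inverts_mat\<close> does not fix the size of h, so its dimensions are
      read off from the two products.\<close>
    have gh: "g * h = 1\<^sub>m ?m" and hg: "h * g = 1\<^sub>m (dim_row h)"
      using inv gc by (auto simp: inverts_mat_def)
    have "dim_col h = ?m" using arg_cong[OF gh, of dim_col] by simp
    moreover have "dim_row h = ?m" using arg_cong[OF hg, of dim_col] gc by simp
    ultimately have "h \<in> carrier_mat ?m ?m" by auto
    then have h: "h \<in> unip_mats ?m S" by (rule unip_mats_right_inverse[OF g _ gh])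
    have "g * corner_unit ?m l * h \<in> stab ?m S \<xi>'"
      unfolding eq using corner_unit_stab_antidiagonal[OF \<zeta> l(2)] by blast
    moreover have "\<xi>' \<in> carrier_mat ?m ?m" using \<xi>'_opp by (simp add: opp_mats_def)
    ultimately show False using moves[OF _ f\<xi>' g h] by blast
  qed
qed

section \<open>From cascade roots and the diagram symmetry to block boundaries\<close>

lemma cascade_root_eq: "cascade_root n (Suc i) = idx_root (i, flip (n + 1) i)" if "i \<le> n"
proof -
  have "n + 2 - Suc i = Suc (flip (n + 1) i)" using that by (simp add: flip_def)
  then show ?thesis unfolding cascade_root_def idx_root_def by (simp only: prod.case)
qed

lemma cascade_root_mem_nilradical_roots:
  assumes S: "S \<subseteq> {1..n}" and i: "i < (n + 1) div 2"
  shows "cascade_root n (Suc i) \<in> nilradical_roots n (simple_root ` S) \<longleftrightarrow> cuts S i (flip (n + 1) i)"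
proof -
  have lt: "i \<le> n" "i \<noteq> flip (n + 1) i" "flip (n + 1) i \<le> n" using i by (auto simp: flip_def)
  show ?thesis
    unfolding nilradical_roots_eq[OF S] cascade_root_eq[OF lt(1)]
  proof
    assume "idx_root (i, flip (n + 1) i) \<in> idx_root ` {(i, j). i \<le> n \<and> j \<le> n \<and> cuts S i j}"
    then obtain p q where eq: "idx_root (i, flip (n + 1) i) = idx_root (p, q)" and cut: "cuts S p q" by blast
    have "p = i" "q = flip (n + 1) i" using iffD1[OF idx_root_eq_iff[OF lt(2)] eq] by blast+
    with cut show "cuts S i (flip (n + 1) i)" by (simp only:)
  qed (use lt in blast)
qed

text \<open>For i below (n + 1) div 2, membership of the cascade root with index i + 1 says that
  some boundary separates i from its mirror index. At i = k - 1 this gives the middle cut. A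
  boundary strictly between k and n + 1 - k would put the next cascade root into the
  nilradical.\<close>

lemma cascade_blocks_of_cascade:
  assumes S: "S \<subseteq> {1..n}" and k: "k \<in> {1..(n + 1) div 2}"
    and cascade: "nilradical_cascade n (simple_root ` S) = cascade_root n ` {1..k}"
  shows "cascade_blocks (n + 1) k S"
proof -
  have mem: "cuts S i (flip (n + 1) i) \<longleftrightarrow> i < k" if i: "i < (n + 1) div 2" for i
  proof -
    have "cascade_root n (Suc i) \<in> kostant_cascade n" using i by (auto simp: kostant_cascade_def)
    then have "cuts S i (flip (n + 1) i) \<longleftrightarrow> cascade_root n (Suc i) \<in> cascade_root n ` {1..k}"
      using cascade_root_mem_nilradical_roots[OF S i] cascade by (auto simp: nilradical_cascade_def)
    also have "\<dots> \<longleftrightarrow> i < k"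
    proof
      assume "cascade_root n (Suc i) \<in> cascade_root n ` {1..k}"
      then obtain j where j: "j \<in> {1..k}" "cascade_root n (Suc i) = cascade_root n j" by blast
      then obtain j' where j': "j = Suc j'" by (cases j) auto
      have "i \<noteq> flip (n + 1) i" "i \<le> n" "j' \<le> n" using i j j' k by (auto simp: flip_def)
      then have "i = j'" using j(2) by (simp add: j' cascade_root_eq idx_root_eq_iff)
      then show "i < k" using j j' by simp
    qed auto
    finally show ?thesis .
  qed
  show ?thesis
  proof
    show "2 * k \<le> n + 1" using k by auto
    have "cuts S (k - 1) (flip (n + 1) (k - 1))" using mem[of "k - 1"] k by auto
    then obtain l where "l \<in> S" "k - 1 < l" "l \<le> flip (n + 1) (k - 1)" by (auto simp: cuts_def)
    then show "\<exists>l\<in>S. k \<le> l \<and> l \<le> n + 1 - k" using k by (intro bexI[of _ l]) (auto simp: flip_def)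
    show "n + 1 - k \<le> l" if l: "l \<in> S" "k < l" for l
    proof (rule ccontr)
      assume "\<not> n + 1 - k \<le> l"
      then have "k < (n + 1) div 2" "cuts S k (flip (n + 1) k)"
        using l by (auto simp: cuts_def flip_def intro!: bexI[of _ l])
      then show False using mem[of k] by simp
    qed
  qed
qed

lemma cascade_point_antidiagonal:
  assumes k: "k \<in> {1..(n + 1) div 2}" and blocks: "cascade_blocks (n + 1) k S"
    and cascade: "nilradical_cascade n T = cascade_root n ` {1..k}"
    and \<zeta>: "is_cascade_point n T \<zeta>"
  shows "cascade_blocks.antidiagonal (n + 1) k \<zeta>"
proof -
  interpret cascade_blocks "n + 1" k S by (rule blocks)
  let ?m = "n + 1"
  have image: "cascade_root n ` {1..k} = (\<lambda>i. idx_root (i, flip ?m i)) ` {..<k}"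
  proof -
    have "{1..k} = Suc ` {..<k}" by (simp add: lessThan_atLeast0 atLeastLessThanSuc_atLeastAtMost)
    then have "cascade_root n ` {1..k} = (\<lambda>i. cascade_root n (Suc i)) ` {..<k}" by (simp only: image_image)
    also have "\<dots> = (\<lambda>i. idx_root (i, flip ?m i)) ` {..<k}"
    proof (rule image_cong)
      fix i assume "i \<in> {..<k}"
      then have "i \<le> n" using k_less(2)[of i] by simp
      then show "cascade_root n (Suc i) = idx_root (i, flip ?m i)" by (rule cascade_root_eq)
    qed simp
    finally show ?thesis .
  qed
  obtain e where e: "\<And>i. i < k \<Longrightarrow> e (idx_root (i, flip ?m i)) \<in> root_space n (- idx_root (i, flip ?m i))"
      "\<And>i. i < k \<Longrightarrow> e (idx_root (i, flip ?m i)) \<noteq> 0\<^sub>m ?m ?m"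
    and \<zeta>_eq: "\<zeta> = mat_sum ?m e ((\<lambda>i. idx_root (i, flip ?m i)) ` {..<k})"
    using \<zeta> unfolding is_cascade_point_def cascade image by blast
  have neq: "i \<noteq> flip ?m i" "i \<le> n" "flip ?m i \<le> n" if "i < k" for i
    using that two_k by (auto simp: flip_def)
  have inj: "inj_on (\<lambda>i. idx_root (i, flip ?m i)) {..<k}"
    by (rule inj_onI) (use neq idx_root_eq_iff in auto)
  have e0: "e (idx_root (i, flip ?m i)) $$ (p, q) \<noteq> 0 \<longleftrightarrow> p = flip ?m i \<and> q = i"
    if i: "i < k" and pq: "p \<le> n" "q \<le> n" for i p q
  proof -
    note ei = e(1)[OF i, unfolded uminus_idx_root root_space_idx_root[OF neq(3,2)[OF i] neq(1)[OF i, symmetric]]]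
    have zero: "e (idx_root (i, flip ?m i)) $$ (p, q) = 0"
      if "p \<le> n" "q \<le> n" "(p, q) \<noteq> (flip ?m i, i)" for p q
      using ei that by blast
    have "e (idx_root (i, flip ?m i)) $$ (flip ?m i, i) \<noteq> 0"
    proof
      assume "e (idx_root (i, flip ?m i)) $$ (flip ?m i, i) = 0"
      then have "e (idx_root (i, flip ?m i)) $$ (p, q) = 0" if "p \<le> n" "q \<le> n" for p q
        using zero[OF that] by (cases "(p, q) = (flip ?m i, i)") auto
      then have "e (idx_root (i, flip ?m i)) = 0\<^sub>m ?m ?m"
        using ei by (intro eq_matI) auto
      with e(2)[OF i] show False by blast
    qed
    with zero pq show ?thesis by blast
  qed
  have entry: "\<zeta> $$ (p, q) = (if q < k then e (idx_root (q, flip ?m q)) $$ (p, q) else 0)"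
    if pq: "p < ?m" "q < ?m" for p q
  proof -
    have "\<zeta> $$ (p, q) = (\<Sum>i<k. e (idx_root (i, flip ?m i)) $$ (p, q))"
      using pq unfolding \<zeta>_eq mat_sum_def by (simp only: index_mat prod.case sum.reindex[OF inj] o_def)
    also have "\<dots> = (\<Sum>i<k. if i = q then e (idx_root (q, flip ?m q)) $$ (p, q) else 0)"
    proof (rule sum.cong)
      fix i assume "i \<in> {..<k}"
      then show "e (idx_root (i, flip ?m i)) $$ (p, q) = (if i = q then e (idx_root (q, flip ?m q)) $$ (p, q) else 0)"
        using e0[of i p q] pq by (cases "i = q") auto
    qed simp
    finally show ?thesis by simp
  qed
  have "\<zeta> $$ (p, q) \<noteq> 0 \<longleftrightarrow> q < k \<and> p = flip ?m q" if pq: "p < ?m" "q < ?m" for p q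
    using entry[OF pq] e0[of q p q] pq by auto
  then show ?thesis unfolding antidiagonal_def by (simp add: \<zeta>_eq mat_sum_def)
qed

lemma diagram_sym_image:
  assumes "A \<subseteq> {1..n}"
  shows "diagram_sym n ` simple_root ` A = simple_root ` (\<lambda>l. n + 1 - l) ` A"
  unfolding image_image
  by (rule image_cong) (use assms diagram_sym_simple_root in auto)

text \<open>The map sending l to n + 1 - l carries {1..k - 1} bijectively onto {n + 2 - k..n}, so
  equality of the two sets of roots is an equivalence for each single l.\<close>

lemma symmetric_blocks_iff_diagram_sym:
  assumes S: "S \<subseteq> {1..n}" and k: "1 \<le> k" and blocks: "cascade_blocks (n + 1) k S"
  shows "symmetric_blocks (n + 1) k S \<longleftrightarrow>
    diagram_sym n ` (simple_root ` S \<inter> simple_root ` {1..k - 1}) = simple_root ` S \<inter> simple_root ` {n + 2 - k..n}"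
proof -
  interpret cascade_blocks "n + 1" k S by (rule blocks)
  have inter: "simple_root ` S \<inter> simple_root ` A = simple_root ` (S \<inter> A)" for A
    by (rule image_Int[OF inj_simple_root, symmetric])
  have "diagram_sym n ` (simple_root ` S \<inter> simple_root ` {1..k - 1}) = simple_root ` S \<inter> simple_root ` {n + 2 - k..n}
    \<longleftrightarrow> (\<lambda>l. n + 1 - l) ` (S \<inter> {1..k - 1}) = S \<inter> {n + 2 - k..n}"
    unfolding inter using S by (subst diagram_sym_image) (auto simp: inj_image_eq_iff[OF inj_simple_root])
  also have "\<dots> \<longleftrightarrow> (\<forall>l. 0 < l \<and> l < k \<longrightarrow> (l \<in> S \<longleftrightarrow> n + 1 - l \<in> S))"
  proof
    assume eq: "(\<lambda>l. n + 1 - l) ` (S \<inter> {1..k - 1}) = S \<inter> {n + 2 - k..n}"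
    show "\<forall>l. 0 < l \<and> l < k \<longrightarrow> (l \<in> S \<longleftrightarrow> n + 1 - l \<in> S)"
    proof (intro allI impI iffI; elim conjE)
      fix l assume l: "0 < l" "l < k"
      show "n + 1 - l \<in> S" if "l \<in> S"
      proof -
        have "n + 1 - l \<in> (\<lambda>l. n + 1 - l) ` (S \<inter> {1..k - 1})" using that l by auto
        then show ?thesis using eq by blast
      qed
      show "l \<in> S" if "n + 1 - l \<in> S"
      proof -
        have "n + 1 - l \<in> S \<inter> {n + 2 - k..n}" using that l by auto
        then obtain l' where "l' \<in> S" "l' \<le> k - 1" "n + 1 - l = n + 1 - l'" unfolding eq[symmetric] by auto
        then have "l = l'" using l two_k by linarith
        then show ?thesis using \<open>l' \<in> S\<close> by simp
      qed
    qed
  next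
    assume sym: "\<forall>l. 0 < l \<and> l < k \<longrightarrow> (l \<in> S \<longleftrightarrow> n + 1 - l \<in> S)"
    show "(\<lambda>l. n + 1 - l) ` (S \<inter> {1..k - 1}) = S \<inter> {n + 2 - k..n}"
    proof (intro equalityI subsetI)
      fix x assume "x \<in> (\<lambda>l. n + 1 - l) ` (S \<inter> {1..k - 1})"
      then obtain l where "l \<in> S" "1 \<le> l" "l \<le> k - 1" "x = n + 1 - l" by auto
      then show "x \<in> S \<inter> {n + 2 - k..n}" using sym k by auto
    next
      fix x assume x: "x \<in> S \<inter> {n + 2 - k..n}"
      then have "0 < n + 1 - x" "n + 1 - x < k" "n + 1 - (n + 1 - x) = x" using k two_k by auto
      then show "x \<in> (\<lambda>l. n + 1 - l) ` (S \<inter> {1..k - 1})"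
        using sym x by (intro image_eqI[of _ _ "n + 1 - x"]) auto
    qed
  qed
  also have "\<dots> \<longleftrightarrow> symmetric_blocks (n + 1) k S"
    using blocks by (auto simp: symmetric_blocks_def symmetric_blocks_axioms_def)
  finally show ?thesis by blast
qed

lemma has_generic_stabiliser_if_symmetric:
  assumes S: "S \<subseteq> {1..n}" "S \<noteq> {}" and sym: "diagram_sym n ` simple_root ` S = simple_root ` S"
  shows "has_generic_stabiliser n (simple_root ` S)"
proof -
  let ?m = "n + 1"
  have "(\<lambda>l. ?m - l) ` S = S"
    using sym diagram_sym_image[OF S(1)] by (simp add: inj_image_eq_iff[OF inj_simple_root])
  then have flip_S: "?m - l \<in> S" if "l \<in> S" for l using that by blast
  \<comment> \<open>A boundary l separates i from its mirror index exactly when i < min l (n + 1 -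
    l), so this maximum is the length of the cascade. Reading it off from S makes the argument
    independent of a given description of the cascade.\<close>
  define k where "k = Max ((\<lambda>l. min l (?m - l)) ` S)"
  have fin: "finite ((\<lambda>l. min l (?m - l)) ` S)" using S(1) finite_subset by blast
  have "k \<in> (\<lambda>l. min l (?m - l)) ` S" unfolding k_def using fin S(2) by (intro Max_in) auto
  then obtain l0 where l0: "l0 \<in> S" "k = min l0 (?m - l0)" by blast
  have max: "min l (?m - l) \<le> k" if "l \<in> S" for l unfolding k_def using fin that by (intro Max_ge) auto
  have sym_blocks: "symmetric_blocks ?m k S"
  proof
    show "2 * k \<le> ?m" using l0 S(1) by auto
    show "\<exists>l\<in>S. k \<le> l \<and> l \<le> ?m - k" using l0 S(1) by (intro bexI[of _ l0]) (auto simp: min_def)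
    show "?m - k \<le> l" if "l \<in> S" "k < l" for l using max[OF that(1)] that by auto
    show "l \<in> S \<longleftrightarrow> ?m - l \<in> S" if "0 < l" "l < k" for l
      using flip_S[of l] flip_S[of "?m - l"] that l0 by auto
  qed
  interpret symmetric_blocks ?m k S by (rule sym_blocks)
  \<comment> \<open>The zero-one antidiagonal matrix serves as the generic functional.\<close>
  have "antidiagonal (mat ?m ?m (\<lambda>(i, j). if j < k \<and> i = flip ?m j then 1 else 0))"
    unfolding antidiagonal_def by simp
  from generic_stabiliser_symmetric[OF S(1) sym_blocks this] show ?thesis
    unfolding has_generic_stabiliser_def is_generic_stabiliser_def by blast
qed

theorem theorem5p1:
  fixes n :: nat and T :: "weight set"
  assumes "T \<subseteq> simple_roots n" and "T \<noteq> {}"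
  shows "(\<forall>k \<zeta> T' T''.
            k \<in> {1..(n + 1) div 2} \<and> nilradical_cascade n T = cascade_root n ` {1..k} \<and>
            T' = T \<inter> simple_root ` {1..k - 1} \<and>
            T'' = T \<inter> simple_root ` {n + 2 - k..n} \<and>
            is_cascade_point n T \<zeta> \<longrightarrow>
            (is_generic_stabiliser n T (stabiliser n T \<zeta>) \<longleftrightarrow> diagram_sym n ` T' = T'')) \<and>
         (diagram_sym n ` T = T \<longrightarrow> has_generic_stabiliser n T)"
proof -
  obtain S where S: "S \<subseteq> {1..n}" and T: "T = simple_root ` S"
    using assms(1) unfolding simple_roots_def by (meson subset_imageE)
  have "S \<noteq> {}" using assms(2) T by blast
  have "is_generic_stabiliser n T (stabiliser n T \<zeta>) \<longleftrightarrow>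
      diagram_sym n ` (T \<inter> simple_root ` {1..k - 1}) = T \<inter> simple_root ` {n + 2 - k..n}"
    if k: "k \<in> {1..(n + 1) div 2}" and cascade: "nilradical_cascade n T = cascade_root n ` {1..k}"
      and \<zeta>: "is_cascade_point n T \<zeta>" for k \<zeta>
  proof -
    have blocks: "cascade_blocks (n + 1) k S"
      using cascade_blocks_of_cascade[OF S k] cascade unfolding T by blast
    note anti = cascade_point_antidiagonal[OF k blocks cascade \<zeta>]
    have "is_generic_stabiliser n T (stabiliser n T \<zeta>) \<longleftrightarrow> symmetric_blocks (n + 1) k S"
      unfolding T using symmetric_if_generic_stabiliser[OF S blocks anti]
        generic_stabiliser_symmetric[OF S _ anti] is_generic_stabiliser_def by blast
    also have "\<dots> \<longleftrightarrow> diagram_sym n ` (T \<inter> simple_root ` {1..k - 1}) = T \<inter> simple_root ` {n + 2 - k..n}"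
      unfolding T by (rule symmetric_blocks_iff_diagram_sym[OF S _ blocks]) (use k in auto)
    finally show ?thesis .
  qed
  moreover have "has_generic_stabiliser n T" if "diagram_sym n ` T = T"
    using has_generic_stabiliser_if_symmetric[OF S \<open>S \<noteq> {}\<close>] that unfolding T by blast
  ultimately show ?thesis by blast
qed

end
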